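(* Let $(u,v)\in\mathcal I\times\mathcal I$ be generic, with reflection coefficient $\tilde r\in H^{1,1}_0(\mathbb R)$, eigenvalues $\lambda_j$ and norming constants $\tilde c_j$ ($1\le j\le N_1$), and for $x\in\mathbb R$ let $\widetilde M(x;\lambda)$ be the solution of the Riemann--Hilbert problem with these data described in the context. Then $$\overline{u(x)}=\lim_{|\lambda|\to0}\big[\widetilde M(x;\lambda)\big]_{12},$$ the limit $\lambda\to0$ being taken non-tangentially to $\mathbb R$.
   Context: $\|f\|_{L^{2,1}}=\|(1+|x|)f\|_{L^2(\mathbb R)}$; $\mathcal I=\{f:\mathbb R\to\mathbb C:\ f,f',f''\in L^{2,1}(\mathbb R)\}$; $H^{1,1}(\mathbb R)=\{f: f,f'\in L^{2,1}(\mathbb R)\}$; $H^{1,1}_0(\mathbb R)=\{f\in H^{1,1}(\mathbb R):\lim_{\lambda\to0}f(\lambda)/\lambda=0\}$. $\mathbb C^+$ is the open upper half plane; $\sigma_3=\mathrm{diag}(1,-1)$; $e^{ic\,\mathrm{ad}\,\sigma_3}A=e^{ic\sigma_3}Ae^{-ic\sigma_3}$. Scattering data. Put $J(\lambda)=\frac14(\lambda-\lambda^{-1})$, $$\widetilde Q_1=\begin{pmatrix}\frac i4(|u|^2+|v|^2)&-\frac i2\bar v\\ v_x+\frac i2|u|^2v+\frac i2u&-\frac i4(|u|^2+|v|^2)\end{pmatrix},\qquad \widetilde Q_2=-\frac i2\begin{pmatrix}\bar uv&-\bar u\\ v+\bar uv^2&-\bar uv\end{pmatrix}.$$ For $\lambda\in\mathbb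 R\setminus\{0\}$ let $\tilde n^{(\pm)}(x;\lambda)=[\tilde n_1^{(\pm)},\tilde n_2^{(\pm)}]$ be the bounded $2\times2$ solution of $$\tilde n^{(\pm)}(x;\lambda)=I+\int_{\pm\infty}^x e^{iJ(\lambda)(x-y)\mathrm{ad}\,\sigma_3}\big([\widetilde Q_1(y)+\lambda^{-1}\widetilde Q_2(y)]\tilde n^{(\pm)}(y;\lambda)\big)dy .$$ The columns $\tilde n_1^{(+)},\tilde n_2^{(-)}$ extend analytically to $\mathbb C^+$. Define (independently of $x$) $\tilde\alpha(\lambda)=\det[\tilde n_1^{(+)},\tilde n_2^{(-)}]$ on $\mathbb C^+\cup\mathbb R\setminus\{0\}$, $\tilde\beta(\lambda)=e^{-2iJ(\lambda)x}\det[\tilde n_2^{(+)},\tilde n_2^{(-)}]$ on $\mathbb R\setminus\{0\}$, extended to $\lambda=0$ by limits, and $\tilde r=\tilde\beta/\tilde\alpha$. The eigenvalues are the zeros $\lambda_j\in\mathbb C^+$ of $\tilde\alpha$; there $\tilde n_1^{(+)}(x;\lambda_j)=d_je^{-ix(\lambda_j-\lambda_j^{-1})/2}\tilde n_2^{(-)}(x;\lambda_j)$, $d_j\ne0$, and $\tilde c_j=1/(d_j\tilde\alpha'(\lambda_j))$. Generic: (1) $\tilde\alpha$ has only finitely many zeros in $\mathbb C^+$, all simple, and $|\tilde\alpha|\ge A>0$ on $\mathbb R$ for some $A$; (2) the moduli $|\lambda_j|$ are pairwise distinct. Riemann--Hilbert problem. $\widetilde M(x;\cdot)$ is $2\times2$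 matrix valued, analytic in $\mathbb C\setminus\mathbb R$ except for simple poles at $\lambda_j,\bar\lambda_j$, with continuous boundary values $\widetilde M_\pm$ on $\mathbb R$ from $\mathbb C^\pm$; $\widetilde M\to I$ as $|\lambda|\to\infty$; on $\mathbb R$ $$\widetilde M_+=\widetilde M_-\begin{pmatrix}1&-\tilde r(\lambda)e^{\frac i2(\lambda-\lambda^{-1})x}\\-\lambda\overline{\tilde r(\lambda)}e^{-\frac i2(\lambda-\lambda^{-1})x}&1+\lambda|\tilde r(\lambda)|^2\end{pmatrix};$$ $\mathrm{Res}_{\lambda_j}\widetilde M=\lim_{\lambda\to\lambda_j}\widetilde M\begin{pmatrix}0&\tilde c_je^{ix(\lambda_j-\lambda_j^{-1})/2}\\0&0\end{pmatrix}$ and $\mathrm{Res}_{\bar\lambda_j}\widetilde M=\lim_{\lambda\to\bar\lambda_j}\widetilde M\begin{pmatrix}0&0\\-\bar\lambda_j\overline{\tilde c_j}e^{-ix(\bar\lambda_j-\bar\lambda_j^{-1})/2}&0\end{pmatrix}$. *)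

theory Defs
  imports "HOL-Complex_Analysis.Complex_Analysis"
begin

section \<open>Function spaces\<close>

definition L21 :: "(real \<Rightarrow> complex) set" where
  "L21 = {f. f \<in> borel_measurable lebesgue \<and>
             integrable lebesgue (\<lambda>x. ((1 + \<bar>x\<bar>) * norm (f x))\<^sup>2)}"

text \<open>
  \<open>f\<close> is locally absolutely continuous with derivative \<open>g\<close>. This is the weak derivative
  on the line, for the continuous representative \<open>f\<close> of its class; fixing that representative
  is what gives point values such as \<open>u x\<close> a meaning.
\<close>

definition has_ac_derivative :: "(real \<Rightarrow> complex) \<Rightarrow> (real \<Rightarrow> complex) \<Rightarrow> bool" where
  "has_ac_derivative f g \<longleftrightarrow>
     (\<forall>a b. a \<le> b \<longrightarrow>
        set_integrable lebesgue {a..b} g \<and>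
        f b - f a = set_lebesgue_integral lebesgue {a..b} g)"

definition I_space :: "(real \<Rightarrow> complex) set" where
  "I_space = {f. f \<in> L21 \<and>
     (\<exists>f1 f2. has_ac_derivative f f1 \<and> has_ac_derivative f1 f2 \<and> f1 \<in> L21 \<and> f2 \<in> L21)}"

definition H11 :: "(real \<Rightarrow> complex) set" where
  "H11 = {f. f \<in> L21 \<and> (\<exists>f1. has_ac_derivative f f1 \<and> f1 \<in> L21)}"

definition H11_0 :: "(real \<Rightarrow> complex) set" where
  "H11_0 = {f \<in> H11. ((\<lambda>s. f s / of_real s) \<longlongrightarrow> 0) (at 0)}"


section \<open>Matrices and half planes\<close>

definition mat2 :: "complex \<Rightarrow> complex \<Rightarrow> complex \<Rightarrow> complex \<Rightarrow> complex^2^2" where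
  "mat2 a b c d = vector [vector [a, b], vector [c, d]]"

definition cols2 :: "complex^2 \<Rightarrow> complex^2 \<Rightarrow> complex^2^2" where
  "cols2 a b = (\<chi> i j. if j = 1 then a $ i else b $ i)"

text \<open>\<open>exp_sigma3 c\<close> is $e^{c\sigma_3}$; \<open>exp_ad_sigma3 c A\<close> is $e^{c\,\mathrm{ad}\,\sigma_3}A$.\<close>

definition exp_sigma3 :: "complex \<Rightarrow> complex^2^2" where
  "exp_sigma3 c = mat2 (exp c) 0 0 (exp (- c))"

definition exp_ad_sigma3 :: "complex \<Rightarrow> complex^2^2 \<Rightarrow> complex^2^2" where
  "exp_ad_sigma3 c A = exp_sigma3 c ** A ** exp_sigma3 (- c)"

definition upper_half_plane :: "complex set" where
  "upper_half_plane = {z. Im z > 0}"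

definition lower_half_plane :: "complex set" where
  "lower_half_plane = {z. Im z < 0}"


section \<open>Jost solutions\<close>

definition J :: "complex \<Rightarrow> complex" where
  "J l = (l - inverse l) / 4"

definition Q1 :: "(real \<Rightarrow> complex) \<Rightarrow> (real \<Rightarrow> complex) \<Rightarrow> real \<Rightarrow> complex^2^2" where
  "Q1 u v x =
     mat2 (\<i> / 4 * of_real ((norm (u x))\<^sup>2 + (norm (v x))\<^sup>2))
          (- (\<i> / 2) * cnj (v x))
          (vector_derivative v (at x) + \<i> / 2 * of_real ((norm (u x))\<^sup>2) * v x + \<i> / 2 * u x)
          (- (\<i> / 4) * of_real ((norm (u x))\<^sup>2 + (norm (v x))\<^sup>2))"

definition Q2 :: "(real \<Rightarrow> complex) \<Rightarrow> (real \<Rightarrow> complex) \<Rightarrow> real \<Rightarrow> complex^2^2" where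
  "Q2 u v x =
     mat (- (\<i> / 2)) **
     mat2 (cnj (u x) * v x)
          (- cnj (u x))
          (v x + cnj (u x) * (v x)\<^sup>2)
          (- (cnj (u x) * v x))"

definition jost_integrand ::
  "(real \<Rightarrow> complex) \<Rightarrow> (real \<Rightarrow> complex) \<Rightarrow> real \<Rightarrow> (real \<Rightarrow> complex^2^2) \<Rightarrow> real \<Rightarrow> real \<Rightarrow> complex^2^2"
where
  "jost_integrand u v s n x y =
     exp_ad_sigma3 (\<i> * J (of_real s) * of_real (x - y))
       ((Q1 u v y + mat (inverse (of_real s)) ** Q2 u v y) ** n y)"

text \<open>The endpoint \<open>e\<close> is \<open>\<infinity>\<close> for the superscript (+) and \<open>-\<infinity>\<close> for the superscript (-).
  The interval integral is oriented, so \<open>LBINT y=\<infinity>..x\<close> is minus the integral over \<open>{x<..}\<close>.\<close>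

definition is_jost ::
  "ereal \<Rightarrow> (real \<Rightarrow> complex) \<Rightarrow> (real \<Rightarrow> complex) \<Rightarrow> real \<Rightarrow> (real \<Rightarrow> complex^2^2) \<Rightarrow> bool"
where
  "is_jost e u v s n \<longleftrightarrow>
     bounded (range n) \<and>
     (\<forall>x. interval_lebesgue_integrable lborel e (ereal x) (jost_integrand u v s n x) \<and>
          n x = mat 1 + (LBINT y=e..ereal x. jost_integrand u v s n x y))"

definition jost ::
  "ereal \<Rightarrow> (real \<Rightarrow> complex) \<Rightarrow> (real \<Rightarrow> complex) \<Rightarrow> real \<Rightarrow> real \<Rightarrow> complex^2^2"
where
  "jost e u v s = (THE n. is_jost e u v s n)"

text \<open>Analytic extension to the open upper half plane of a function on the punctured real line,
  continuous up to the punctured line. By the reflection principle such an extension is determined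
  on the upper half plane and the punctured line; other values are unspecified.\<close>

definition is_upper_extension :: "(real \<Rightarrow> complex^2) \<Rightarrow> (complex \<Rightarrow> complex^2) \<Rightarrow> bool" where
  "is_upper_extension f F \<longleftrightarrow>
     (\<forall>i. (\<lambda>z. F z $ i) holomorphic_on upper_half_plane) \<and>
     continuous_on (upper_half_plane \<union> (\<real> - {0})) F \<and>
     (\<forall>s. s \<noteq> 0 \<longrightarrow> F (of_real s) = f s)"

definition upper_extension :: "(real \<Rightarrow> complex^2) \<Rightarrow> complex \<Rightarrow> complex^2" where
  "upper_extension f = (SOME F. is_upper_extension f F)"

definition n1_plus :: "(real \<Rightarrow> complex) \<Rightarrow> (real \<Rightarrow> complex) \<Rightarrow> real \<Rightarrow> complex \<Rightarrow> complex^2" where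
  "n1_plus u v x = upper_extension (\<lambda>s. column 1 (jost \<infinity> u v s x))"

definition n2_minus :: "(real \<Rightarrow> complex) \<Rightarrow> (real \<Rightarrow> complex) \<Rightarrow> real \<Rightarrow> complex \<Rightarrow> complex^2" where
  "n2_minus u v x = upper_extension (\<lambda>s. column 2 (jost (-\<infinity>) u v s x))"


section \<open>Scattering data\<close>

text \<open>The determinants do not depend on \<open>x\<close>; \<open>THE\<close> selects their common value.
  The value at \<open>0\<close> is the limit within the closed upper half plane (for \<open>alpha\<close>)
  and along the real line (for \<open>beta\<close>).\<close>

definition alpha0 :: "(real \<Rightarrow> complex) \<Rightarrow> (real \<Rightarrow> complex) \<Rightarrow> complex \<Rightarrow> complex" where
  "alpha0 u v l = (THE a. \<forall>x. a = det (cols2 (n1_plus u v x l) (n2_minus u v x l)))"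

definition alpha :: "(real \<Rightarrow> complex) \<Rightarrow> (real \<Rightarrow> complex) \<Rightarrow> complex \<Rightarrow> complex" where
  "alpha u v l = (if l = 0 then Lim (at 0 within {z. Im z \<ge> 0}) (alpha0 u v) else alpha0 u v l)"

definition beta0 :: "(real \<Rightarrow> complex) \<Rightarrow> (real \<Rightarrow> complex) \<Rightarrow> real \<Rightarrow> complex" where
  "beta0 u v s = (THE b. \<forall>x. b = exp (- 2 * \<i> * J (of_real s) * of_real x) *
      det (cols2 (column 2 (jost \<infinity> u v s x)) (column 2 (jost (-\<infinity>) u v s x))))"

definition beta :: "(real \<Rightarrow> complex) \<Rightarrow> (real \<Rightarrow> complex) \<Rightarrow> real \<Rightarrow> complex" where
  "beta u v s = (if s = 0 then Lim (at 0) (beta0 u v) else beta0 u v s)"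

definition refl_coeff :: "(real \<Rightarrow> complex) \<Rightarrow> (real \<Rightarrow> complex) \<Rightarrow> real \<Rightarrow> complex" where
  "refl_coeff u v s = beta u v s / alpha u v (of_real s)"

definition eigenvalues :: "(real \<Rightarrow> complex) \<Rightarrow> (real \<Rightarrow> complex) \<Rightarrow> complex set" where
  "eigenvalues u v = {l \<in> upper_half_plane. alpha u v l = 0}"

definition is_norming_constant ::
  "(real \<Rightarrow> complex) \<Rightarrow> (real \<Rightarrow> complex) \<Rightarrow> complex \<Rightarrow> complex \<Rightarrow> bool"
where
  "is_norming_constant u v l c \<longleftrightarrow>
     (\<exists>d. d \<noteq> 0 \<and>
        (\<forall>x. n1_plus u v x l =
              (d * exp (- \<i> * of_real x * (l - inverse l) / 2)) *s n2_minus u v x l) \<and>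
        c = 1 / (d * deriv (alpha u v) l))"

definition generic :: "(real \<Rightarrow> complex) \<Rightarrow> (real \<Rightarrow> complex) \<Rightarrow> bool" where
  "generic u v \<longleftrightarrow>
     finite (eigenvalues u v) \<and>
     (\<forall>l \<in> eigenvalues u v. deriv (alpha u v) l \<noteq> 0) \<and>
     (\<exists>A>0. \<forall>s::real. norm (alpha u v (of_real s)) \<ge> A) \<and>
     inj_on norm (eigenvalues u v)"


section \<open>The Riemann--Hilbert problem\<close>

text \<open>At \<open>s = 0\<close> the exponentials are meaningless, but for \<open>r \<in> H11_0\<close> one has \<open>r 0 = 0\<close>, so
  the matrix below is the identity there, which is also its limit as \<open>s\<close> tends to \<open>0\<close>.\<close>

definition jump_matrix :: "real \<Rightarrow> (real \<Rightarrow> complex) \<Rightarrow> real \<Rightarrow> complex^2^2" where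
  "jump_matrix x r s =
     mat2 1
          (- r s * exp (\<i> / 2 * of_real ((s - inverse s) * x)))
          (- of_real s * cnj (r s) * exp (- (\<i> / 2) * of_real ((s - inverse s) * x)))
          (1 + of_real s * of_real ((norm (r s))\<^sup>2))"

text \<open>A pole of order at most one, in every entry, with the prescribed residue
  $\mathrm{Res}_{z_0}\,M = \lim_{z\to z_0} M(z)\,N$.\<close>

definition simple_pole_with ::
  "(complex \<Rightarrow> complex^2^2) \<Rightarrow> complex \<Rightarrow> complex^2^2 \<Rightarrow> bool"
where
  "simple_pole_with M z0 N \<longleftrightarrow>
     (\<forall>i j. \<exists>R. ((\<lambda>z. (z - z0) * M z $ i $ j) \<longlongrightarrow> R) (at z0)) \<and>
     ((\<lambda>z. M z ** N) \<longlongrightarrow> (\<chi> i j. residue (\<lambda>z. M z $ i $ j) z0)) (at z0)"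

definition is_RHP_solution ::
  "real \<Rightarrow> (real \<Rightarrow> complex) \<Rightarrow> nat \<Rightarrow> (nat \<Rightarrow> complex) \<Rightarrow> (nat \<Rightarrow> complex) \<Rightarrow>
   (complex \<Rightarrow> complex^2^2) \<Rightarrow> bool"
where
  "is_RHP_solution x r N1 lam c M \<longleftrightarrow>
     (\<forall>i j. (\<lambda>z. M z $ i $ j) holomorphic_on (- \<real> - (lam ` {1..N1} \<union> cnj ` lam ` {1..N1}))) \<and>
     (\<forall>j\<in>{1..N1}.
        simple_pole_with M (lam j)
          (mat2 0 (c j * exp (\<i> * of_real x * (lam j - inverse (lam j)) / 2)) 0 0)) \<and>
     (\<forall>j\<in>{1..N1}.
        simple_pole_with M (cnj (lam j))
          (mat2 0 0 (- cnj (lam j) * cnj (c j) *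
                      exp (- \<i> * of_real x * (cnj (lam j) - inverse (cnj (lam j))) / 2)) 0)) \<and>
     (\<exists>Mp Mm :: real \<Rightarrow> complex^2^2.
        continuous_on UNIV Mp \<and> continuous_on UNIV Mm \<and>
        (\<forall>s. (M \<longlongrightarrow> Mp s) (at (of_real s) within upper_half_plane)) \<and>
        (\<forall>s. (M \<longlongrightarrow> Mm s) (at (of_real s) within lower_half_plane)) \<and>
        (\<forall>s. Mp s = Mm s ** jump_matrix x r s)) \<and>
     (M \<longlongrightarrow> mat 1) (inf at_infinity (principal (- \<real>)))"

end

theory Submission
  imports Defs
begin

text \<open>The Riemann--Hilbert problem has an explicit solution built from the Jost columns, its solution is
unique, and the limit of the explicit one at \<open>\<lambda> = 0\<close> can be computed.

Write $f$ and $g$ for the columns $\tilde n_1^{(+)}$ and $\tilde n_2^{(-)}$, continued to $\mathbb C^+$,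
and $\alpha = \det[f,g]$. On $\mathbb C^+$ the matrix $[f, g/\alpha]$ has determinant one. In
$\mathbb C^-$ its counterpart comes from the conjugation symmetry of the spectral problem, which turns a
solution at $\bar\lambda$ into one at $\lambda$ (\<open>conj_swap\<close>, \<open>plus_column_symmetry\<close>). Across the
punctured real line the two matrices are related by the jump matrix of the problem (\<open>jump_second_column\<close>,
\<open>jump_first_column\<close>), and at the eigenvalues they satisfy its residue conditions. Hence the product of any
solution $M$ with the adjugate of this matrix has no jump and only removable singularities away
from \<open>0\<close> (\<open>quot_holomorphic\<close>, \<open>quot_extension\<close>), and by a Liouville argument it is constant
(\<open>constant_by_half_plane_limits\<close>, \<open>quot_constant\<close>). As $\lambda\to\infty$ in $\mathbb C^+$ one has
$f\to(E,0)^T$ with $E=\exp(-\int_x^\infty\frac i4(|u|^2+|v|^2))$, while $g$ tends to a nonzero multiple of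
$(0,1)^T$. This evaluates the constant, and the first row of $M$ gives $M_{12}=g_1/(E\alpha)$ in $\mathbb C^+$.

As $\lambda\to0$ the roles of \<open>\<lambda>\<close> and $\lambda^{-1}$ interchange. The singular part
$\lambda^{-1}(-\frac i4\sigma_3+\widetilde Q_2)$ of the coefficient has constant eigenvalues and is diagonalised by the
unimodular matrix with columns $(1,v)^T$ and $(\bar u,1+\bar uv)^T$. The gauge by this matrix changes the sign of
the diagonal of $\widetilde Q_1$, so that $f\to E^{-1}(1,v)^T$ and $g\to e\,(\bar u,1+\bar uv)^T$ for some
$e\neq0$. Therefore $\alpha\to e/E$ and $M_{12}\to\bar u$ (\<open>M12_upper_zero\<close>). Since the reflection coefficient
vanishes at \<open>0\<close>, the boundary values of $M$ from the two half-planes agree there, which gives the limit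
in $\mathbb C^-$ as well.

The analysis behind this is that of Volterra equations on half-lines. The weight $\exp(2\int_x^\infty k)$ makes the
Volterra operator a contraction by the factor $1/2$; this yields existence, uniqueness, holomorphic dependence on
\<open>\<lambda>\<close> and a Gronwall estimate. Both limits are instances of \<open>volterra_solution_asymptotics\<close>:
when $|J|\to\infty$ in the closed half-plane, the off-diagonal coupling disappears by a Riemann--Lebesgue argument that is
uniform in the closed half-plane.\<close>

section \<open>Integrals over right half-lines\<close>

definition tail :: "(real \<Rightarrow> 'a::euclidean_space) \<Rightarrow> real \<Rightarrow> 'a" where
  "tail f x = (LINT y:{x<..}|lborel. f y)"

lemma tail_eq_integral:
  fixes f :: "real \<Rightarrow> 'a::euclidean_space"
  assumes f: "set_integrable lborel {a<..} f" and ab: "a \<le> b"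
  shows "tail f b = tail f a - integral {a..b} f"
proof -
  have 1: "set_integrable lborel {a<..b} f" "set_integrable lborel {b<..} f"
    by (rule set_integrable_subset[OF f]; use ab in auto)+
  have "{a<..} = {a<..b} \<union> {b<..}" using ab by auto
  then have "tail f a = (LINT y:{a<..b}|lborel. f y) + tail f b"
    unfolding tail_def using set_integral_Un[OF _ 1] by (metis Int_commute ivl_disj_int_one(7) ivl_disj_int_two(3) disjoint_iff greaterThan_iff greaterThanAtMost_iff leD)
  moreover have "(LINT y:{a<..b}|lborel. f y) = integral {a<..b} f"
    using set_borel_integral_eq_integral[OF 1(1)] by simp
  moreover have "integral {a<..b} f = integral {a..b} f"
    by (rule integral_spike_set; rule negligible_subset[of "{a}"]) auto
  ultimately show ?thesis by simp
qed

lemma continuous_on_tail: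
  fixes f :: "real \<Rightarrow> 'a::euclidean_space"
  assumes f: "set_integrable lborel {a<..} f"
  shows "continuous_on {a..} (tail f)"
proof (rule continuous_on_subset[of "{a..}"], unfold continuous_on_eq_continuous_within, safe)
  fix x assume x: "a \<le> x"
  have "f integrable_on {a<..x+1}"
    by (intro set_borel_integral_eq_integral(1) set_integrable_subset[OF f]) auto
  then have int: "f integrable_on {a..x+1}"
    by (rule integrable_spike_set) (auto intro: negligible_subset[of "{a}"])
  have "continuous_on {a..x+1} (\<lambda>t. tail f a - integral {a..t} f)"
    by (intro continuous_intros indefinite_integral_continuous_1 int)
  then have "continuous (at x within {a..x+1}) (\<lambda>t. tail f a - integral {a..t} f)"
    using x by (auto simp: continuous_on_eq_continuous_within)
  then have "continuous (at x within {a..x+1}) (tail f)"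
  proof (rule continuous_transform_within[where \<delta>=1])
    show "tail f a - integral {a..t} f = tail f t" if "t \<in> {a..x+1}" for t
      using tail_eq_integral[OF f, of t] that by simp
  qed (use x in auto)
  moreover have "at x within {a..x+1} = at x within {a..}"
    by (rule at_within_nhd[of x "{..<x+1}"]) auto
  ultimately show "continuous (at x within {a..}) (tail f)" by simp
qed

lemma tail_has_vector_derivative:
  fixes f :: "real \<Rightarrow> 'a::euclidean_space"
  assumes f: "\<And>a. set_integrable lborel {a<..} f" and cont: "continuous_on UNIV f"
  shows "(tail f has_vector_derivative - f x) (at x)"
proof -
  have "((\<lambda>t. integral {x-1..t} f) has_vector_derivative f x) (at x within {x-1..x+1})"
    by (rule integral_has_vector_derivative) (auto intro: continuous_on_subset[OF cont])
  then have "((\<lambda>t. integral {x-1..t} f) has_vector_derivative f x) (at x)"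
    by (subst (asm) at_within_interior) auto
  then have "((\<lambda>t. tail f (x-1) - integral {x-1..t} f) has_vector_derivative 0 - f x) (at x)"
    by (intro has_vector_derivative_diff) auto
  then have "((\<lambda>t. tail f (x-1) - integral {x-1..t} f) has_vector_derivative - f x) (at x)"
    by simp
  moreover have "tail f (x-1) - integral {x-1..t} f = tail f t" if "t \<in> {x-1<..}" for t
    using tail_eq_integral[OF f, of "x-1" t] that by simp
  ultimately show ?thesis
    by (intro has_vector_derivative_transform_within_open
          [of "\<lambda>t. tail f (x-1) - integral {x-1..t} f" _ x "{x-1<..}" "tail f"]) auto
qed

lemma tail_tendsto_0:
  fixes f :: "real \<Rightarrow> 'a::euclidean_space"
  assumes f: "set_integrable lborel {a<..} f"
  shows "(tail f \<longlongrightarrow> 0) at_top"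
proof -
  have m: "(\<lambda>y. indicator {a<..} y *\<^sub>R f y) \<in> borel_measurable lborel"
    using f unfolding set_integrable_def by auto
  have m2: "(\<lambda>y. indicator {max a t<..} y *\<^sub>R f y) \<in> borel_measurable lborel" for t
  proof -
    have "set_integrable lborel {max a t<..} f"
      by (rule set_integrable_subset[OF f]) auto
    then show ?thesis unfolding set_integrable_def by auto
  qed
  show ?thesis
  proof (rule tendsto_at_topI_sequentially)
    fix X :: "nat \<Rightarrow> real" assume X: "filterlim X at_top sequentially"
    have "(\<lambda>n. integral\<^sup>L lborel (\<lambda>y. indicator {max a (X n)<..} y *\<^sub>R f y)) \<longlonglongrightarrow> integral\<^sup>L lborel (\<lambda>y::real. 0::'a)"
    proof (rule integral_dominated_convergence[where w="\<lambda>y. norm (indicator {a<..} y *\<^sub>R f y)"])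
      show "integrable lborel (\<lambda>y. norm (indicator {a<..} y *\<^sub>R f y))"
        using f unfolding set_integrable_def by (rule integrable_norm)
      have "(\<lambda>n. indicator {max a (X n)<..} y *\<^sub>R f y) \<longlonglongrightarrow> 0" for y
        by (rule tendsto_eventually, rule eventually_mono[OF filterlim_at_top[THEN iffD1, OF X, rule_format, of y]])
           (auto simp: indicator_def)
      then show "AE y in lborel. (\<lambda>n. indicator {max a (X n)<..} y *\<^sub>R f y) \<longlonglongrightarrow> 0"
        by auto
    qed (use m2 in \<open>auto simp: indicator_def\<close>)
    then have "(\<lambda>n. tail f (max a (X n))) \<longlonglongrightarrow> 0"
      by (simp add: tail_def set_lebesgue_integral_def)
    then show "(\<lambda>n. tail f (X n)) \<longlonglongrightarrow> 0"
      by (rule Lim_transform_eventually)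
         (rule eventually_mono[OF filterlim_at_top[THEN iffD1, OF X, rule_format, of a]], auto simp: max_def)
  qed
qed

text \<open>Both sides differ by a constant in \<open>x\<close>, because the tail is an antiderivative of \<open>- f\<close>; the limits at
infinity identify that constant.\<close>

lemma tail_FTC:
  fixes F :: "real \<Rightarrow> 'a::euclidean_space"
  assumes f: "\<And>a. set_integrable lborel {a<..} f" and cont: "continuous_on UNIV f"
    and F: "\<And>y. (F has_vector_derivative f y) (at y)" and L: "(F \<longlongrightarrow> L) at_top"
  shows "tail f x = L - F x"
proof -
  have "((\<lambda>t. F t + tail f t) has_vector_derivative 0) (at t within UNIV)" for t
    using has_vector_derivative_add[OF F[of t] tail_has_vector_derivative[OF f cont, of t]] by simp
  then obtain c where c: "\<And>t. F t + tail f t = c"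
    using has_vector_derivative_zero_constant[of UNIV "\<lambda>t. F t + tail f t"] by auto
  have "((\<lambda>t. F t + tail f t) \<longlongrightarrow> L + 0) at_top"
    by (intro tendsto_add L tail_tendsto_0[OF f])
  then have "c = L" unfolding c by (simp add: tendsto_const_iff)
  with c[of x] show ?thesis by (simp add: algebra_simps)
qed

text \<open>The functions that dominate the kernels of the Volterra operators below. Continuity makes the tail
differentiable, so that \<open>exp (2 * tail k x)\<close> can serve as a weight.\<close>

definition weight :: "(real \<Rightarrow> real) \<Rightarrow> bool" where
  "weight k \<longleftrightarrow> continuous_on UNIV k \<and> (\<forall>y. 0 \<le> k y) \<and> integrable lborel k"

lemma weight_set_integrable: "weight k \<Longrightarrow> A \<in> sets lborel \<Longrightarrow> set_integrable lborel A k"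
  unfolding weight_def set_integrable_def
  by (intro integrable_mult_indicator) auto

lemma
  fixes q :: "real \<Rightarrow> 'a::euclidean_space"
  assumes q: "set_borel_measurable lborel {x<..} q" and h: "set_integrable lborel {x<..} h"
    and le: "\<And>y. x < y \<Longrightarrow> norm (q y) \<le> h y"
  shows tail_bound_integrable: "set_integrable lborel {x<..} q"
    and norm_tail_le: "norm (tail q x) \<le> tail h x"
proof -
  show i: "set_integrable lborel {x<..} q"
    by (rule set_integrable_bound[OF h q]) (use order_trans[OF le abs_ge_self] in auto)
  have "norm (tail q x) \<le> (LINT y:{x<..}|lborel. norm (q y))"
    unfolding tail_def by (rule set_integral_norm_bound[OF i])
  also have "\<dots> \<le> tail h x"
    unfolding tail_def by (rule set_integral_mono[OF set_integrable_norm[OF i] h]) (use le in auto)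
  finally show "norm (tail q x) \<le> tail h x" .
qed

lemma continuous_set_borel_measurable:
  fixes q :: "real \<Rightarrow> 'a::euclidean_space"
  assumes "continuous_on UNIV q"
  shows "set_borel_measurable lborel {x<..} q"
  unfolding set_borel_measurable_def
  using borel_measurable_continuous_onI[OF assms] by auto

lemma weight_tail_nonneg: "weight k \<Longrightarrow> 0 \<le> tail k x"
  unfolding tail_def set_lebesgue_integral_def weight_def
  by (intro integral_nonneg_AE) auto

lemma weight_tail_le: "weight k \<Longrightarrow> tail k x \<le> integral\<^sup>L lborel k"
  using set_integral_mono_AE[of lborel UNIV "\<lambda>y. indicator {x<..} y *\<^sub>R k y" k]
    weight_set_integrable[of k "{x<..}"] weight_set_integrable[of k UNIV]
  unfolding tail_def set_lebesgue_integral_def set_integrable_def weight_def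
  by (simp add: indicator_def)

lemma weight_continuous_tail:
  assumes "weight k" shows "continuous_on UNIV (tail k)"
proof -
  have "(tail k has_vector_derivative - k x) (at x)" for x
    by (rule tail_has_vector_derivative) (use assms in \<open>auto intro: weight_set_integrable simp: weight_def\<close>)
  then show ?thesis
    by (meson continuous_at_imp_continuous_on has_vector_derivative_continuous)
qed

text \<open>The integrand is the derivative of \<open>- exp (2 * tail k y) / 2\<close>. The factor \<open>1/2\<close> in the value is the
contraction constant of every Volterra operator whose kernel is dominated by \<open>k\<close>, in the norm weighted by
\<open>exp (2 * tail k x)\<close>.\<close>

lemma
  assumes k: "weight k"
  shows exp_weight_integrable: "set_integrable lborel {x<..} (\<lambda>y. k y * exp (2 * tail k y))"
    and tail_exp_weight: "tail (\<lambda>y. k y * exp (2 * tail k y)) x = (exp (2 * tail k x) - 1) / 2"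
proof -
  have kc: "continuous_on UNIV k" using k by (simp add: weight_def)
  have c: "continuous_on UNIV (\<lambda>y. k y * exp (2 * tail k y))"
    by (intro continuous_intros kc weight_continuous_tail k)
  have i: "set_integrable lborel {x<..} (\<lambda>y. k y * exp (2 * tail k y))" for x
    by (rule tail_bound_integrable[where h="\<lambda>y. k y * exp (2 * integral\<^sup>L lborel k)"])
       (use k weight_tail_le[OF k] in \<open>auto simp: weight_def abs_mult
         intro!: continuous_set_borel_measurable[OF c] set_integrable_mult_left
            weight_set_integrable mult_left_mono\<close>)
  then show "set_integrable lborel {x<..} (\<lambda>y. k y * exp (2 * tail k y))" .
  have d: "(tail k has_real_derivative - k x) (at x)" for x
    using tail_has_vector_derivative[OF weight_set_integrable[OF k] kc, of x]
    by (simp add: has_real_derivative_iff_has_vector_derivative)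
  have D: "((\<lambda>y. - exp (2 * tail k y) / 2) has_vector_derivative k y * exp (2 * tail k y)) (at y)" for y
    unfolding has_real_derivative_iff_has_vector_derivative[symmetric]
    by (auto intro!: derivative_eq_intros d)
  have "((\<lambda>y. - exp (2 * tail k y) / 2) \<longlongrightarrow> - exp (2 * 0) / 2) at_top"
    by (intro tendsto_intros tail_tendsto_0[of 0] weight_set_integrable k) auto
  from tail_FTC[OF i c D this]
  show "tail (\<lambda>y. k y * exp (2 * tail k y)) x = (exp (2 * tail k x) - 1) / 2"
    by (simp add: field_simps)
qed

lemma weight_bounded_integrable:
  fixes d :: "real \<Rightarrow> real"
  assumes k: "weight k" and d: "continuous_on {a..} d" and b: "\<And>y. a \<le> y \<Longrightarrow> \<bar>d y\<bar> \<le> b" and ax: "a \<le> x"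
  shows "set_integrable lborel {x<..} (\<lambda>y. k y * d y)"
proof (rule tail_bound_integrable[where h="\<lambda>y. k y * b"])
  have kc: "continuous_on UNIV k" using k by (simp add: weight_def)
  have "continuous_on {x<..} (\<lambda>y. k y * d y)"
    using ax by (intro continuous_intros continuous_on_subset[OF kc] continuous_on_subset[OF d]) auto
  then show "set_borel_measurable lborel {x<..} (\<lambda>y. k y * d y)"
    unfolding set_borel_measurable_def
    using borel_measurable_continuous_on_indicator[of "{x<..}" "\<lambda>y. k y * d y"] by auto
  show "set_integrable lborel {x<..} (\<lambda>y. k y * b)"
    using weight_set_integrable[OF k] by auto
qed (use k b ax in \<open>auto intro!: mult_left_mono simp: abs_mult weight_def\<close>)

text \<open>Inserting a bound \<open>m * exp (2 * tail k x)\<close> into the hypothesis improves \<open>m\<close> to \<open>\<eta> + m / 2\<close>. The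
iteration starts from \<open>m = 2 * \<eta> + b\<close> and converges to the fixed point \<open>2 * \<eta>\<close>.\<close>

lemma gronwall_half_line:
  fixes d :: "real \<Rightarrow> real"
  assumes k: "weight k" and d: "continuous_on {a..} d"
    and nn: "\<And>y. a \<le> y \<Longrightarrow> 0 \<le> d y" and b: "\<And>y. a \<le> y \<Longrightarrow> d y \<le> b" and eta: "0 \<le> \<eta>"
    and le: "\<And>x. a \<le> x \<Longrightarrow> d x \<le> \<eta> + tail (\<lambda>y. k y * d y) x"
    and x: "a \<le> x"
  shows "d x \<le> 2 * \<eta> * exp (2 * tail k x)"
proof -
  have b0: "0 \<le> b" using nn[of a] b[of a] by auto
  have step: "\<forall>x\<ge>a. d x \<le> (2 * \<eta> + b / 2 ^ n) * exp (2 * tail k x)" for n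
  proof (induction n)
    case 0
    show ?case
    proof safe
      fix x assume "a \<le> x"
      then have "d x \<le> (2 * \<eta> + b) * 1" using b[of x] eta by auto
      also have "\<dots> \<le> (2 * \<eta> + b / 2 ^ 0) * exp (2 * tail k x)"
        using b0 eta weight_tail_nonneg[OF k, of x] by (intro mult_mono) auto
      finally show "d x \<le> (2 * \<eta> + b / 2 ^ 0) * exp (2 * tail k x)" .
    qed
  next
    case (Suc n)
    show ?case
    proof safe
      fix x assume x: "a \<le> x"
      let ?m = "2 * \<eta> + b / 2 ^ n"
      have m0: "0 \<le> ?m" using eta b0 by simp
      have "tail (\<lambda>y. k y * d y) x \<le> tail (\<lambda>y. ?m * (k y * exp (2 * tail k y))) x"
        unfolding tail_def[where x=x]
      proof (rule set_integral_mono)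
        show "set_integrable lborel {x<..} (\<lambda>y. k y * d y)"
          by (rule weight_bounded_integrable[OF k d _ x, where b=b]) (use nn b in auto)
        show "set_integrable lborel {x<..} (\<lambda>y. ?m * (k y * exp (2 * tail k y)))"
          using exp_weight_integrable[OF k] by auto
        fix y assume "y \<in> {x<..}"
        then have "k y * d y \<le> k y * (?m * exp (2 * tail k y))"
          using Suc x k by (intro mult_left_mono) (auto simp: weight_def)
        then show "k y * d y \<le> ?m * (k y * exp (2 * tail k y))" by (simp add: mult_ac)
      qed
      also have "\<dots> = ?m * ((exp (2 * tail k x) - 1) / 2)"
        using tail_exp_weight[OF k, of x] unfolding tail_def[where x=x] by simp
      finally have "d x \<le> \<eta> + ?m * ((exp (2 * tail k x) - 1) / 2)" using le[OF x] by linarith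
      also have "\<dots> \<le> \<eta> * exp (2 * tail k x) + ?m * (exp (2 * tail k x) / 2)"
        using m0 eta weight_tail_nonneg[OF k, of x]
        by (intro add_mono mult_left_mono) (auto simp: mult_le_cancel_left1)
      also have "\<dots> = (2 * \<eta> + b / 2 ^ Suc n) * exp (2 * tail k x)"
        by (simp add: field_simps)
      finally show "d x \<le> (2 * \<eta> + b / 2 ^ Suc n) * exp (2 * tail k x)" .
    qed
  qed
  have "(\<lambda>n. (2 * \<eta> + b * (1/2) ^ n) * exp (2 * tail k x)) \<longlonglongrightarrow> (2 * \<eta> + b * 0) * exp (2 * tail k x)"
    by (intro tendsto_intros LIMSEQ_realpow_zero) auto
  then show ?thesis
    by (intro LIMSEQ_le_const[where X="\<lambda>n. (2 * \<eta> + b * (1/2) ^ n) * exp (2 * tail k x)"])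
       (use step x in \<open>auto simp: power_divide\<close>)
qed

section \<open>Volterra equations on a half-line\<close>

definition entry_norm :: "complex^'n::finite^'n \<Rightarrow> real" where
  "entry_norm A = (\<Sum>l\<in>UNIV. \<Sum>m\<in>UNIV. norm (A $ l $ m))"

text \<open>The oscillating or decaying factors $e^{i\theta_l t}$ that the operator
$e^{iJ(x-y)\,\mathrm{ad}\,\sigma_3}$ produces on a single column, with \<open>t = y - x\<close>.\<close>

definition damp :: "('n::finite \<Rightarrow> complex) \<Rightarrow> real \<Rightarrow> complex^'n \<Rightarrow> complex^'n" where
  "damp \<theta> t w = (\<chi> l. exp (\<i> * \<theta> l * of_real t) * w $ l)"

definition dissipative :: "('n \<Rightarrow> complex) \<Rightarrow> bool" where
  "dissipative \<theta> \<longleftrightarrow> (\<forall>l. 0 \<le> Im (\<theta> l))"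

definition volterra ::
  "('n::finite \<Rightarrow> complex) \<Rightarrow> (real \<Rightarrow> complex^'n^'n) \<Rightarrow> complex^'n \<Rightarrow> (real \<Rightarrow> complex^'n) \<Rightarrow> real \<Rightarrow> complex^'n"
  where "volterra \<theta> A c w x = c - tail (\<lambda>y. damp \<theta> (y - x) (A y *v w y)) x"

definition dominated :: "(real \<Rightarrow> complex^'n::finite^'n) \<Rightarrow> (real \<Rightarrow> real) \<Rightarrow> bool" where
  "dominated A k \<longleftrightarrow> continuous_on UNIV A \<and> weight k \<and> (\<forall>y. entry_norm (A y) \<le> k y)"

text \<open>The class on which the Volterra operators act. Boundedness is asked on right half-lines only, because that is
what a limit at \<open>+\<infinity>\<close> provides.\<close>

definition bounded_right :: "(real \<Rightarrow> complex^'n::finite) \<Rightarrow> bool" where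
  "bounded_right w \<longleftrightarrow> continuous_on UNIV w \<and> (\<forall>a. bounded (w ` {a..}))"

lemma bounded_right_diff: "bounded_right v \<Longrightarrow> bounded_right w \<Longrightarrow> bounded_right (\<lambda>y. v y - w y)"
  unfolding bounded_right_def by (auto intro!: continuous_intros bounded_minus_comp)

lemma norm_le_mult_componentwise:
  fixes x y :: "complex^'n::finite"
  assumes "\<And>l. norm (x $ l) \<le> C * norm (y $ l)" and "0 \<le> C"
  shows "norm x \<le> C * norm y"
  unfolding norm_vec_def L2_set_right_distrib[OF assms(2)]
  by (rule L2_set_mono) (use assms in auto)

lemma norm_le_sum_components:
  fixes x :: "complex^'n::finite"
  shows "norm x \<le> (\<Sum>l\<in>UNIV. norm (x $ l))"
  unfolding norm_vec_def by (rule L2_set_le_sum) auto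

lemma norm_matrix_vector_le: "norm (A *v w) \<le> entry_norm A * norm (w::complex^'n::finite)"
proof -
  have "norm ((A *v w) $ l) \<le> (\<Sum>m\<in>UNIV. norm (A $ l $ m)) * norm w" for l
  proof -
    have "norm ((A *v w) $ l) \<le> (\<Sum>m\<in>UNIV. norm (A $ l $ m * w $ m))"
      by (simp add: matrix_vector_mult_def norm_sum)
    also have "\<dots> \<le> (\<Sum>m\<in>UNIV. norm (A $ l $ m) * norm w)"
      by (intro sum_mono) (auto simp: norm_mult intro!: mult_left_mono Finite_Cartesian_Product.norm_nth_le)
    finally show ?thesis by (simp add: sum_distrib_right)
  qed
  then have "(\<Sum>l\<in>UNIV. norm ((A *v w) $ l)) \<le> (\<Sum>l\<in>UNIV. (\<Sum>m\<in>UNIV. norm (A $ l $ m)) * norm w)"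
    by (intro sum_mono)
  then show ?thesis
    using norm_le_sum_components[of "A *v w"] by (simp add: entry_norm_def sum_distrib_right)
qed

lemma norm_damp_le:
  assumes "dissipative \<theta>" and "0 \<le> t"
  shows "norm (damp \<theta> t w) \<le> norm w"
proof -
  have "norm (damp \<theta> t w) \<le> 1 * norm w"
    by (rule norm_le_mult_componentwise) (use assms in \<open>auto simp: dissipative_def damp_def norm_mult mult_left_le_one_le\<close>)
  then show ?thesis by simp
qed

lemma damp_diff: "damp \<theta> t (v - w) = damp \<theta> t v - damp \<theta> t w"
  by (simp add: damp_def vec_eq_iff algebra_simps)

lemma tail_component:
  fixes f :: "real \<Rightarrow> complex^'n::finite"
  assumes "set_integrable lborel {x<..} f"
  shows "tail f x $ l = tail (\<lambda>y. f y $ l) x"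
  using integral_bounded_linear[OF bounded_linear_vec_nth[of l], of lborel "\<lambda>y. indicator {x<..} y *\<^sub>R f y"] assms
  by (simp add: tail_def set_lebesgue_integral_def set_integrable_def)

lemma bounded_linear_axis: "bounded_linear (axis l :: 'b::real_normed_vector \<Rightarrow> 'b^'n::finite)"
proof (rule bounded_linear_intro[where K=1])
  fix z :: 'b
  have "norm (axis l z :: 'b^'n) = norm z"
    by (simp add: norm_vec_def L2_set_def axis_def if_distrib[of norm] if_distrib[of "\<lambda>t. t^2"] cong: if_cong)
  then show "norm (axis l z :: 'b^'n) \<le> norm z * 1" by simp
qed (simp_all add: vec_eq_iff axis_def)

lemma sum_axis_components: "(\<Sum>l\<in>UNIV. axis l (w $ l)) = (w :: ('b::real_normed_vector)^'n::finite)"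
  by (simp add: vec_eq_iff axis_def if_distrib cong: if_cong)

lemma has_vector_derivative_componentwise:
  fixes f :: "real \<Rightarrow> complex^'n::finite"
  shows "(f has_vector_derivative f') F \<longleftrightarrow> (\<forall>l. ((\<lambda>x. f x $ l) has_vector_derivative f' $ l) F)" (is "?L = ?R")
proof
  assume ?L then show ?R
    by (auto intro: bounded_linear.has_vector_derivative[OF bounded_linear_vec_nth])
next
  assume R: ?R
  have "((\<lambda>x. \<Sum>l\<in>UNIV. axis l (f x $ l)) has_vector_derivative (\<Sum>l\<in>UNIV. axis l (f' $ l))) F"
    by (intro has_vector_derivative_sum bounded_linear.has_vector_derivative[OF bounded_linear_axis]) (use R in auto)
  then show ?L by (simp add: sum_axis_components)
qed

lemma continuous_on_damp [continuous_intros]: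
  "continuous_on S t \<Longrightarrow> continuous_on S w \<Longrightarrow> continuous_on S (\<lambda>x. damp \<theta> (t x) (w x))"
  unfolding damp_def by (intro continuous_intros)

lemma continuous_on_matrix_vector_mult [continuous_intros]:
  fixes A :: "'a::topological_space \<Rightarrow> complex^'n::finite^'n"
  shows "continuous_on S A \<Longrightarrow> continuous_on S w \<Longrightarrow> continuous_on S (\<lambda>x. A x *v w x)"
  unfolding matrix_vector_mult_def by (intro continuous_intros)

text \<open>Integrability over a half-line that starts to the left of \<open>x\<close> needs a bound for the factors at
negative times as well.\<close>

lemma damp_crude_bound:
  fixes \<theta> :: "'n::finite \<Rightarrow> complex"
  assumes "dissipative \<theta>" and "a \<le> t"
  shows "norm (damp \<theta> t w) \<le> exp ((\<Sum>l\<in>UNIV. norm (\<theta> l)) * \<bar>a\<bar>) * norm w"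
proof (rule norm_le_mult_componentwise)
  fix l
  have "Im (\<theta> l) * a \<le> Im (\<theta> l) * t" using assms by (intro mult_left_mono) (auto simp: dissipative_def)
  moreover have "- (Im (\<theta> l) * a) \<le> \<bar>Im (\<theta> l)\<bar> * \<bar>a\<bar>" by (metis abs_ge_minus_self abs_mult)
  moreover have "\<bar>Im (\<theta> l)\<bar> * \<bar>a\<bar> \<le> norm (\<theta> l) * \<bar>a\<bar>" by (intro mult_right_mono abs_Im_le_cmod) auto
  moreover have "norm (\<theta> l) \<le> (\<Sum>l\<in>UNIV. norm (\<theta> l))" by (rule member_le_sum) auto
  then have "norm (\<theta> l) * \<bar>a\<bar> \<le> (\<Sum>l\<in>UNIV. norm (\<theta> l)) * \<bar>a\<bar>" by (intro mult_right_mono) auto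
  ultimately have "- (Im (\<theta> l) * t) \<le> (\<Sum>l\<in>UNIV. norm (\<theta> l)) * \<bar>a\<bar>" by linarith
  then show "norm (damp \<theta> t w $ l) \<le> exp ((\<Sum>l\<in>UNIV. norm (\<theta> l)) * \<bar>a\<bar>) * norm (w $ l)"
    by (auto simp: damp_def norm_mult intro!: mult_right_mono)
qed auto

context
  fixes \<theta> :: "'n::finite \<Rightarrow> complex" and A :: "real \<Rightarrow> complex^'n^'n" and k
  assumes im: "dissipative \<theta>" and dom: "dominated A k"
begin

lemma dominated_facts: "continuous_on UNIV A" "weight k" "entry_norm (A y) \<le> k y" "0 \<le> k y" "continuous_on UNIV k"
  using dom by (auto simp: dominated_def weight_def)

lemma norm_coefficient_le: "norm (A y *v w) \<le> k y * norm w"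
  by (rule order_trans[OF norm_matrix_vector_le]) (intro mult_right_mono dominated_facts, auto)

lemma volterra_integrable:
  assumes w: "bounded_right w"
  shows "set_integrable lborel {a<..} (\<lambda>y. damp \<theta> (y - x) (A y *v w y))"
proof -
  obtain b where b: "\<And>y. a \<le> y \<Longrightarrow> norm (w y) \<le> b"
    using w unfolding bounded_right_def bounded_iff by force
  let ?E = "exp ((\<Sum>l\<in>UNIV. norm (\<theta> l)) * \<bar>a - x\<bar>)"
  show ?thesis
  proof (rule tail_bound_integrable[where h="\<lambda>y. k y * (?E * b)"])
    show "set_borel_measurable lborel {a<..} (\<lambda>y. damp \<theta> (y - x) (A y *v w y))"
      using w dominated_facts by (intro continuous_set_borel_measurable continuous_intros) (auto simp: bounded_right_def)
    show "set_integrable lborel {a<..} (\<lambda>y. k y * (?E * b))"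
      using weight_set_integrable[OF dominated_facts(2)] by auto
    fix y assume y: "a < y"
    have "norm (damp \<theta> (y - x) (A y *v w y)) \<le> ?E * norm (A y *v w y)"
      by (rule damp_crude_bound[OF im]) (use y in auto)
    also have "\<dots> \<le> ?E * (k y * norm (w y))"
      by (intro mult_left_mono norm_coefficient_le) auto
    also have "\<dots> \<le> ?E * (k y * b)"
      using y by (intro mult_left_mono b dominated_facts) auto
    finally show "norm (damp \<theta> (y - x) (A y *v w y)) \<le> k y * (?E * b)" by (simp add: mult_ac)
  qed
qed

lemma norm_tail_damp_le:
  assumes w: "bounded_right w"
  shows "norm (tail (\<lambda>y. damp \<theta> (y - x) (A y *v w y)) x) \<le> tail (\<lambda>y. k y * norm (w y)) x"
proof (rule norm_tail_le)
  show "set_borel_measurable lborel {x<..} (\<lambda>y. damp \<theta> (y - x) (A y *v w y))"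
    using w dominated_facts by (intro continuous_set_borel_measurable continuous_intros) (auto simp: bounded_right_def)
  obtain b where b: "\<And>y. x \<le> y \<Longrightarrow> norm (w y) \<le> b"
    using w unfolding bounded_right_def bounded_iff by force
  show "set_integrable lborel {x<..} (\<lambda>y. k y * norm (w y))"
    by (rule weight_bounded_integrable[OF dominated_facts(2), where a=x and b=b])
       (use w b in \<open>auto simp: bounded_right_def intro!: continuous_intros intro: continuous_on_subset\<close>)
  fix y assume "x < y"
  then show "norm (damp \<theta> (y - x) (A y *v w y)) \<le> k y * norm (w y)"
    using norm_damp_le[of \<theta> "y - x" "A y *v w y"] im norm_coefficient_le[of y "w y"] by force
qed

lemma volterra_diff:
  assumes v: "bounded_right v" and w: "bounded_right w"
  shows "volterra \<theta> A c v x - volterra \<theta> A c w x = - tail (\<lambda>y. damp \<theta> (y - x) (A y *v (v y - w y))) x"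
proof -
  have "tail (\<lambda>y. damp \<theta> (y - x) (A y *v (v y - w y))) x
    = tail (\<lambda>y. damp \<theta> (y - x) (A y *v v y)) x - tail (\<lambda>y. damp \<theta> (y - x) (A y *v w y)) x"
    unfolding tail_def matrix_vector_mult_diff_distrib damp_diff
    by (rule set_integral_diff(2)) (intro volterra_integrable v w)+
  then show ?thesis by (simp add: volterra_def)
qed

lemma volterra_diff_le:
  assumes v: "bounded_right v" and w: "bounded_right w"
  shows "norm (volterra \<theta> A c v x - volterra \<theta> A c w x) \<le> tail (\<lambda>y. k y * norm (v y - w y)) x"
  unfolding volterra_diff[OF assms] using norm_tail_damp_le[OF bounded_right_diff[OF v w]] by simp

text \<open>Factoring $e^{-i\theta_l x}$ out of the \<open>l\<close>-th component leaves the tail of a fixed function, which is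
differentiable. The terms with \<open>c\<close> cancel where \<open>\<theta> l * c $ l = 0\<close>.\<close>

lemma volterra_has_vector_derivative:
  assumes w: "bounded_right w"
  shows "(volterra \<theta> A c w has_vector_derivative
           (A x *v w x + (\<chi> l. \<i> * \<theta> l * (c $ l - volterra \<theta> A c w x $ l)))) (at x)"
  unfolding has_vector_derivative_componentwise
proof
  fix l
  define q where "q y = damp \<theta> y (A y *v w y) $ l" for y
  have q_cont: "continuous_on UNIV q"
    unfolding q_def using w dominated_facts by (intro continuous_intros) (auto simp: bounded_right_def)
  have q_int: "set_integrable lborel {a<..} q" for a
  proof -
    have "integrable lborel (\<lambda>y. (indicator {a<..} y *\<^sub>R damp \<theta> (y - 0) (A y *v w y)) $ l)"
      using volterra_integrable[OF w, of a 0] unfolding set_integrable_def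
      by (rule integrable_bounded_linear[OF bounded_linear_vec_nth])
    then show ?thesis by (simp add: q_def set_integrable_def)
  qed
  have rep: "volterra \<theta> A c w t $ l = c $ l - exp (- (\<i> * \<theta> l * of_real t)) * tail q t" for t
  proof -
    have "exp (\<i> * \<theta> l * of_real (y - t)) = exp (- (\<i> * \<theta> l * of_real t)) * exp (\<i> * \<theta> l * of_real y)" for y
      unfolding mult_exp_exp by (rule arg_cong[where f=exp]) (simp add: algebra_simps)
    then have "damp \<theta> (y - t) (A y *v w y) $ l = exp (- (\<i> * \<theta> l * of_real t)) * q y" for y
      unfolding q_def damp_def by simp
    then show ?thesis
      by (simp add: volterra_def tail_component[OF volterra_integrable[OF w]]) (simp add: tail_def)
  qed
  have tq: "(tail q has_vector_derivative - q x) (at x)"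
    by (rule tail_has_vector_derivative[OF q_int q_cont])
  have "((\<lambda>t. exp (- (\<i> * \<theta> l * of_real t))) has_vector_derivative - (\<i> * \<theta> l) * exp (- (\<i> * \<theta> l * of_real x))) (at x)"
    by (rule has_vector_derivative_real_field[where f="\<lambda>z. exp (- (\<i> * \<theta> l * z))"])
       (auto intro!: derivative_eq_intros simp del: exp_minus)
  from has_vector_derivative_diff[OF has_vector_derivative_const[of "c $ l"] has_vector_derivative_mult[OF this tq]]
  have "((\<lambda>t. volterra \<theta> A c w t $ l) has_vector_derivative
     0 - (exp (- (\<i> * \<theta> l * of_real x)) * - q x + - (\<i> * \<theta> l) * exp (- (\<i> * \<theta> l * of_real x)) * tail q x)) (at x)"
    unfolding rep .
  moreover have "exp (- (\<i> * \<theta> l * of_real x)) * q x = (A x *v w x) $ l"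
    unfolding q_def damp_def vec_lambda_beta mult.assoc[symmetric] mult_exp_exp by simp
  ultimately show "((\<lambda>t. volterra \<theta> A c w t $ l) has_vector_derivative
      (A x *v w x + (\<chi> l. \<i> * \<theta> l * (c $ l - volterra \<theta> A c w x $ l))) $ l) (at x)"
    by (simp add: rep algebra_simps)
qed

lemma continuous_on_volterra: "bounded_right w \<Longrightarrow> continuous_on UNIV (volterra \<theta> A c w)"
  using volterra_has_vector_derivative
  by (meson continuous_at_imp_continuous_on has_vector_derivative_continuous)

lemma norm_volterra_le:
  assumes w: "bounded_right w" and b: "\<And>y. x \<le> y \<Longrightarrow> norm (w y) \<le> b"
  shows "norm (volterra \<theta> A c w x - c) \<le> b * tail k x"
proof -
  have "norm (volterra \<theta> A c w x - c) \<le> tail (\<lambda>y. k y * norm (w y)) x"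
    using norm_tail_damp_le[OF w] by (simp add: volterra_def)
  also have "\<dots> \<le> tail (\<lambda>y. k y * b) x"
    unfolding tail_def
    by (rule set_integral_mono)
       (use weight_set_integrable[OF dominated_facts(2)] weight_bounded_integrable[OF dominated_facts(2), of x "\<lambda>y. norm (w y)" b x] w b dominated_facts
         in \<open>auto simp: bounded_right_def intro!: mult_left_mono continuous_intros intro: continuous_on_subset\<close>)
  finally show ?thesis by (simp add: tail_def mult.commute)
qed

lemma bounded_right_volterra:
  assumes w: "bounded_right w" shows "bounded_right (volterra \<theta> A c w)"
  unfolding bounded_right_def
proof safe
  fix a
  obtain b where b: "\<And>y. a \<le> y \<Longrightarrow> norm (w y) \<le> b"
    using w unfolding bounded_right_def bounded_iff by force
  have b0: "0 \<le> b" using b[of a] norm_ge_zero order_trans by blast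
  have "norm (volterra \<theta> A c w x) \<le> norm c + b * integral\<^sup>L lborel k" if "a \<le> x" for x
  proof -
    have "norm (volterra \<theta> A c w x - c) \<le> b * tail k x"
      by (rule norm_volterra_le[OF w b]) (use that in auto)
    also have "\<dots> \<le> b * integral\<^sup>L lborel k"
      by (intro mult_left_mono weight_tail_le dominated_facts b0)
    finally show ?thesis using norm_triangle_ineq2[of "volterra \<theta> A c w x" c] by linarith
  qed
  then show "bounded (volterra \<theta> A c w ` {a..})" unfolding bounded_iff by auto
qed (rule continuous_on_volterra[OF w])

lemma volterra_unique:
  assumes v: "bounded_right v" "\<And>x. v x = volterra \<theta> A c v x" and w: "bounded_right w" "\<And>x. w x = volterra \<theta> A c w x"
  shows "v = w"
proof
  fix x
  obtain b where b: "\<And>y. x \<le> y \<Longrightarrow> norm (v y - w y) \<le> b"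
    using bounded_right_diff[OF v(1) w(1)] unfolding bounded_right_def bounded_iff by force
  have "norm (v x - w x) \<le> 2 * 0 * exp (2 * tail k x)"
  proof (rule gronwall_half_line[OF dominated_facts(2), where a=x and b=b])
    show "norm (v y - w y) \<le> 0 + tail (\<lambda>y. k y * norm (v y - w y)) y" for y
      using volterra_diff_le[OF v(1) w(1), of c y] v(2)[of y] w(2)[of y] by simp
  qed (use b v w in \<open>auto simp: bounded_right_def intro!: continuous_intros intro: continuous_on_subset\<close>)
  then show "v x = w x" by simp
qed

end

primrec picard ::
  "('n::finite \<Rightarrow> complex) \<Rightarrow> (real \<Rightarrow> complex^'n^'n) \<Rightarrow> complex^'n \<Rightarrow> nat \<Rightarrow> real \<Rightarrow> complex^'n"
where
  "picard \<theta> A c 0 = (\<lambda>x. c)"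
| "picard \<theta> A c (Suc n) = volterra \<theta> A c (picard \<theta> A c n)"

definition volterra_solution ::
  "('n::finite \<Rightarrow> complex) \<Rightarrow> (real \<Rightarrow> complex^'n^'n) \<Rightarrow> complex^'n \<Rightarrow> real \<Rightarrow> complex^'n"
where
  "volterra_solution \<theta> A c x = c + (\<Sum>n. picard \<theta> A c (Suc n) x - picard \<theta> A c n x)"

lemma bounded_right_const: "bounded_right (\<lambda>x. c)"
  unfolding bounded_right_def by (auto simp: bounded_iff)

lemma bounded_right_picard:
  assumes "dissipative \<theta>" and "dominated A k"
  shows "bounded_right (picard \<theta> A c n)"
  by (induction n) (auto intro: bounded_right_const bounded_right_volterra[OF assms])

text \<open>Geometric convergence of the iteration: each step gains the factor \<open>1/2\<close> of \<open>tail_exp_weight\<close>.\<close>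

lemma picard_step_bound:
  assumes im: "dissipative \<theta>" and dom: "dominated A k"
  shows "norm (picard \<theta> A c (Suc n) x - picard \<theta> A c n x) \<le> norm c * (1/2) ^ n * exp (2 * tail k x)"
proof (induction n arbitrary: x)
  case 0
  have k: "weight k" using dom by (simp add: dominated_def)
  have "norm (volterra \<theta> A c (\<lambda>x. c) x - c) \<le> norm c * tail k x"
    by (rule norm_volterra_le[OF im dom bounded_right_const]) auto
  also have "tail k x \<le> exp (2 * tail k x)"
    using weight_tail_nonneg[OF k, of x] exp_ge_add_one_self[of "2 * tail k x"] by linarith
  finally show ?case by (simp add: mult_left_mono)
next
  case (Suc n)
  have k: "weight k" using dom by (simp add: dominated_def)
  let ?p = "picard \<theta> A c"
  let ?M = "norm c * (1/2) ^ n"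
  have t: "bounded_right (?p n)" for n by (rule bounded_right_picard[OF im dom])
  have "norm (?p (Suc (Suc n)) x - ?p (Suc n) x) \<le> tail (\<lambda>y. k y * norm (?p (Suc n) y - ?p n y)) x"
    using volterra_diff_le[OF im dom t[of "Suc n"] t[of n]] by simp
  also have "\<dots> \<le> tail (\<lambda>y. ?M * (k y * exp (2 * tail k y))) x"
    unfolding tail_def[where x=x]
  proof (rule set_integral_mono)
    have td: "bounded_right (\<lambda>y. ?p (Suc n) y - ?p n y)" by (rule bounded_right_diff[OF t t])
    then obtain b where b: "\<And>y. x \<le> y \<Longrightarrow> norm (?p (Suc n) y - ?p n y) \<le> b"
      unfolding bounded_right_def bounded_iff by force
    show "set_integrable lborel {x<..} (\<lambda>y. k y * norm (?p (Suc n) y - ?p n y))"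
      by (rule weight_bounded_integrable[OF k, where a=x and b=b])
         (use td b in \<open>auto simp: bounded_right_def intro!: continuous_on_norm intro: continuous_on_subset\<close>)
    show "set_integrable lborel {x<..} (\<lambda>y. ?M * (k y * exp (2 * tail k y)))"
      using exp_weight_integrable[OF k] by auto
    fix y
    have "k y * norm (?p (Suc n) y - ?p n y) \<le> k y * (?M * exp (2 * tail k y))"
      using Suc k by (intro mult_left_mono) (auto simp: weight_def)
    then show "k y * norm (?p (Suc n) y - ?p n y) \<le> ?M * (k y * exp (2 * tail k y))"
      by (simp add: mult_ac)
  qed
  also have "\<dots> = ?M * ((exp (2 * tail k x) - 1) / 2)"
    using tail_exp_weight[OF k, of x] unfolding tail_def[where x=x] by simp
  also have "\<dots> \<le> ?M * (exp (2 * tail k x) / 2)" by (intro mult_left_mono) auto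
  finally show ?case by simp
qed

text \<open>Uniformity in the parameter holds because the bound of \<open>picard_step_bound\<close> involves only the common weight;
continuity and holomorphy in the parameter will pass to the limit through it.\<close>

lemma picard_uniform_limit:
  assumes im: "\<And>z. z \<in> \<Lambda> \<Longrightarrow> dissipative (\<theta> z)" and dom: "\<And>z. z \<in> \<Lambda> \<Longrightarrow> dominated (A z) k"
  shows "uniform_limit (\<Lambda> \<times> UNIV) (\<lambda>n (z, x). picard (\<theta> z) (A z) c n x)
           (\<lambda>(z, x). volterra_solution (\<theta> z) (A z) c x) sequentially"
proof -
  let ?d = "\<lambda>n (z, x). picard (\<theta> z) (A z) c (Suc n) x - picard (\<theta> z) (A z) c n x"
  let ?M = "\<lambda>n. (norm c * exp (2 * integral\<^sup>L lborel k)) * (1/2) ^ n"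
  have "uniform_limit (\<Lambda> \<times> UNIV) (\<lambda>n p. \<Sum>i<n. ?d i p) (\<lambda>p. suminf (\<lambda>i. ?d i p)) sequentially"
  proof (rule Weierstrass_m_test[where M="?M"])
    show "summable ?M" by (intro summable_mult summable_geometric) auto
    fix n p assume "p \<in> \<Lambda> \<times> (UNIV::real set)"
    then obtain z x where p: "p = (z, x)" "z \<in> \<Lambda>" by auto
    have k: "weight k" using dom[OF p(2)] by (simp add: dominated_def)
    have "norm (?d n p) \<le> norm c * (1/2) ^ n * exp (2 * tail k x)"
      using picard_step_bound[OF im[OF p(2)] dom[OF p(2)], of c n x] p by simp
    also have "\<dots> \<le> norm c * (1/2) ^ n * exp (2 * integral\<^sup>L lborel k)"
      using weight_tail_le[OF k] by (intro mult_left_mono) auto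
    finally show "norm (?d n p) \<le> ?M n" by (simp add: mult_ac)
  qed
  then have "uniform_limit (\<Lambda> \<times> UNIV) (\<lambda>n p. c + (\<Sum>i<n. ?d i p)) (\<lambda>p. c + suminf (\<lambda>i. ?d i p)) sequentially"
    by (intro uniform_limit_intros)
  moreover have "c + (\<Sum>i<n. ?d i (z, x)) = picard (\<theta> z) (A z) c n x" for n z x
    using sum_lessThan_telescope[of "\<lambda>i. picard (\<theta> z) (A z) c i x" n] by simp
  ultimately show ?thesis
    by (simp add: volterra_solution_def case_prod_unfold)
qed

context
  fixes \<theta> :: "'n::finite \<Rightarrow> complex" and A :: "real \<Rightarrow> complex^'n^'n" and k
  assumes im: "dissipative \<theta>" and dom: "dominated A k"
begin

lemma picard_uniform_limit1:
  "uniform_limit UNIV (\<lambda>n x. picard \<theta> A c n x) (volterra_solution \<theta> A c) sequentially"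
proof -
  have "uniform_limit (UNIV \<times> UNIV) (\<lambda>n (z, x). picard \<theta> A c n x)
           (\<lambda>(z::unit, x). volterra_solution \<theta> A c x) sequentially"
    by (rule picard_uniform_limit) (auto intro: im dom)
  then show ?thesis by (auto simp: uniform_limit_iff)
qed

lemma norm_volterra_solution_le:
  "norm (volterra_solution \<theta> A c x) \<le> norm c * (1 + 2 * exp (2 * integral\<^sup>L lborel k))"
proof -
  have k: "weight k" using dom by (simp add: dominated_def)
  let ?E = "exp (2 * integral\<^sup>L lborel k)"
  have le: "norm (picard \<theta> A c (Suc n) x - picard \<theta> A c n x) \<le> (norm c * ?E) * (1/2) ^ n" for n
  proof -
    have "norm (picard \<theta> A c (Suc n) x - picard \<theta> A c n x) \<le> norm c * (1/2) ^ n * exp (2 * tail k x)"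
      by (rule picard_step_bound[OF im dom])
    also have "\<dots> \<le> norm c * (1/2) ^ n * ?E"
      using weight_tail_le[OF k] by (intro mult_left_mono) auto
    finally show ?thesis by (simp add: mult_ac)
  qed
  have "norm (\<Sum>n. picard \<theta> A c (Suc n) x - picard \<theta> A c n x) \<le> (\<Sum>n. (norm c * ?E) * (1/2) ^ n)"
    by (rule norm_suminf_le[OF le]) (intro summable_mult summable_geometric, auto)
  also have "\<dots> = norm c * ?E * 2"
    by (subst suminf_mult) (auto simp: suminf_geometric)
  finally show ?thesis
    unfolding volterra_solution_def
    using norm_triangle_ineq[of c "\<Sum>n. picard \<theta> A c (Suc n) x - picard \<theta> A c n x"]
    by (simp add: algebra_simps)
qed

lemma bounded_right_volterra_solution: "bounded_right (volterra_solution \<theta> A c)"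
  unfolding bounded_right_def
proof safe
  show "continuous_on UNIV (volterra_solution \<theta> A c)"
    by (rule uniform_limit_theorem[OF _ picard_uniform_limit1])
       (use bounded_right_picard[OF im dom] in \<open>auto simp: bounded_right_def\<close>)
  show "bounded (volterra_solution \<theta> A c ` {a..})" for a
    unfolding bounded_iff using norm_volterra_solution_le by auto
qed

lemma volterra_solution_eq: "volterra_solution \<theta> A c x = volterra \<theta> A c (volterra_solution \<theta> A c) x"
proof -
  have k: "weight k" using dom by (simp add: dominated_def)
  let ?w = "volterra_solution \<theta> A c" and ?p = "picard \<theta> A c"
  have t: "bounded_right (?p n)" for n by (rule bounded_right_picard[OF im dom])
  have lim: "(\<lambda>n. ?p n x) \<longlonglongrightarrow> ?w x"
    using tendsto_uniform_limitI[OF picard_uniform_limit1] by auto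
  have "(\<lambda>n. ?p (Suc n) x) \<longlonglongrightarrow> volterra \<theta> A c ?w x"
  proof (rule tendstoI)
    fix e :: real assume e: "0 < e"
    define d where "d = e / (1 + tail k x)"
    have T: "0 \<le> tail k x" by (rule weight_tail_nonneg[OF k])
    have d: "0 < d" "d * tail k x < e" using e T by (auto simp: d_def field_simps)
    from picard_uniform_limit1[where c=c] d(1)
    have "\<forall>\<^sub>F n in sequentially. \<forall>y. dist (?p n y) (?w y) < d"
      by (auto simp: uniform_limit_iff)
    then show "\<forall>\<^sub>F n in sequentially. dist (?p (Suc n) x) (volterra \<theta> A c ?w x) < e"
    proof eventually_elim
      case (elim n)
      have "norm (volterra \<theta> A c (?p n) x - volterra \<theta> A c ?w x) \<le> tail (\<lambda>y. k y * norm (?p n y - ?w y)) x"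
        by (rule volterra_diff_le[OF im dom t bounded_right_volterra_solution])
      also have "\<dots> \<le> tail (\<lambda>y. k y * d) x"
        unfolding tail_def
      proof (rule set_integral_mono)
        have td: "bounded_right (\<lambda>y. ?p n y - ?w y)" by (rule bounded_right_diff[OF t bounded_right_volterra_solution])
        show "set_integrable lborel {x<..} (\<lambda>y. k y * norm (?p n y - ?w y))"
          by (rule weight_bounded_integrable[OF k, where a=x and b=d])
             (use td elim in \<open>auto simp: bounded_right_def dist_norm less_imp_le intro!: continuous_on_norm intro: continuous_on_subset\<close>)
        show "k y * norm (?p n y - ?w y) \<le> k y * d" for y
          using elim k by (intro mult_left_mono) (auto simp: dist_norm less_imp_le weight_def)
      qed (use weight_set_integrable[OF k] in auto)
      also have "\<dots> < e" using d(2) by (simp add: tail_def mult.commute)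
      finally show ?case by (simp add: dist_norm)
    qed
  qed
  then have "(\<lambda>n. ?p n x) \<longlonglongrightarrow> volterra \<theta> A c ?w x" by (rule LIMSEQ_imp_Suc)
  with lim show ?thesis by (rule LIMSEQ_unique)
qed

lemma volterra_solution_eqI:
  assumes "bounded_right w" and "\<And>x. w x = volterra \<theta> A c w x"
  shows "w = volterra_solution \<theta> A c"
  by (rule volterra_unique[OF im dom assms bounded_right_volterra_solution volterra_solution_eq])

lemma volterra_solution_tendsto: "(volterra_solution \<theta> A c \<longlongrightarrow> c) at_top"
proof -
  have k: "weight k" using dom by (simp add: dominated_def)
  define B where "B = norm c * (1 + 2 * exp (2 * integral\<^sup>L lborel k))"
  have le: "norm (volterra_solution \<theta> A c x - c) \<le> B * tail k x" for x
    by (subst volterra_solution_eq)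
       (rule norm_volterra_le[OF im dom bounded_right_volterra_solution], auto simp: B_def norm_volterra_solution_le)
  have "((\<lambda>x. B * tail k x) \<longlongrightarrow> B * 0) at_top"
    by (intro tendsto_intros tail_tendsto_0[of 0] weight_set_integrable[OF k]) auto
  then have "((\<lambda>x. volterra_solution \<theta> A c x - c) \<longlongrightarrow> 0) at_top"
    unfolding mult_zero_right by (rule Lim_null_comparison[OF always_eventually[OF allI[OF le]]])
  then show ?thesis by (simp add: LIM_zero_iff)
qed

end

text \<open>The differential equation behind the integral equation; it has the form of the spectral problem after
the exponential of one column has been split off.\<close>

definition damped_ode :: "('n::finite \<Rightarrow> complex) \<Rightarrow> (real \<Rightarrow> complex^'n^'n) \<Rightarrow> (real \<Rightarrow> complex^'n) \<Rightarrow> bool" where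
  "damped_ode \<theta> A w \<longleftrightarrow>
     (\<forall>x. (w has_vector_derivative (A x *v w x - (\<chi> l. \<i> * \<theta> l * w x $ l))) (at x))"

lemma damped_ode_volterra_solution:
  fixes \<theta> :: "'n::finite \<Rightarrow> complex"
  assumes im: "dissipative \<theta>" and dom: "dominated A k" and c: "\<And>l. \<theta> l * c $ l = 0"
  shows "damped_ode \<theta> A (volterra_solution \<theta> A c)"
  unfolding damped_ode_def
proof
  fix x
  let ?w = "volterra_solution \<theta> A c"
  have eq: "volterra \<theta> A c ?w = ?w" using volterra_solution_eq[OF im dom] by auto
  have "(\<chi> l. \<i> * \<theta> l * (c $ l - ?w x $ l)) = - (\<chi> l. \<i> * \<theta> l * ?w x $ l)"
    using c by (simp add: vec_eq_iff right_diff_distrib mult.assoc)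
  then show "(?w has_vector_derivative (A x *v ?w x - (\<chi> l. \<i> * \<theta> l * ?w x $ l))) (at x)"
    using volterra_has_vector_derivative[OF im dom bounded_right_volterra_solution[OF im dom], of c c x] eq by simp
qed

lemma bounded_right_if_tendsto:
  fixes w :: "real \<Rightarrow> complex^'n::finite"
  assumes w: "continuous_on UNIV w" and lim: "(w \<longlongrightarrow> c) at_top"
  shows "bounded_right w"
  unfolding bounded_right_def
proof safe
  fix a
  have "\<forall>\<^sub>F x in at_top. dist (w x) c < 1" using lim by (rule tendstoD) auto
  then obtain b where b: "\<And>x. b \<le> x \<Longrightarrow> dist (w x) c < 1"
    by (auto simp: eventually_at_top_linorder)
  have "bounded (w ` {a..b})"
    by (intro compact_imp_bounded compact_continuous_image continuous_on_subset[OF w]) auto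
  moreover have "bounded (w ` {b..})"
    using b by (intro bounded_subset[OF bounded_ball, of _ c 1]) (auto simp: dist_commute)
  ultimately have "bounded (w ` {a..b} \<union> w ` {b..})" by simp
  moreover have "w ` {a..} \<subseteq> w ` {a..b} \<union> w ` {b..}" by force
  ultimately show "bounded (w ` {a..})" by (rule bounded_subset)
qed (rule w)

text \<open>Multiplying the \<open>l\<close>-th component by $e^{i\theta_l(y-x)}$ turns the differential equation into an exact derivative,
and integration to \<open>+\<infinity>\<close> recovers the integral equation. Components with \<open>\<theta> l \<noteq> 0\<close> contribute
no boundary term, since there the limit is \<open>0\<close> and the exponential stays bounded.\<close>

lemma damped_ode_unique:
  fixes \<theta> :: "'n::finite \<Rightarrow> complex"
  assumes im: "dissipative \<theta>" and dom: "dominated A k" and c: "\<And>l. \<theta> l * c $ l = 0"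
    and w: "damped_ode \<theta> A w" and lim: "(w \<longlongrightarrow> c) at_top"
  shows "w = volterra_solution \<theta> A c"
proof (rule volterra_solution_eqI[OF im dom])
  have cont: "continuous_on UNIV w"
    using w unfolding damped_ode_def
    by (meson continuous_at_imp_continuous_on has_vector_derivative_continuous)
  show t: "bounded_right w" by (rule bounded_right_if_tendsto[OF cont lim])
  have Ac: "continuous_on UNIV A" using dom by (simp add: dominated_def)
  fix x
  let ?f = "\<lambda>y. damp \<theta> (y - x) (A y *v w y)"
  have "tail ?f x = c - damp \<theta> (x - x) (w x)"
  proof (rule tail_FTC[where F="\<lambda>y. damp \<theta> (y - x) (w y)"])
    show "continuous_on UNIV ?f" by (intro continuous_intros Ac cont)
    show "set_integrable lborel {a<..} ?f" for a by (rule volterra_integrable[OF im dom t])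
    show "((\<lambda>y. damp \<theta> (y - x) (w y)) has_vector_derivative ?f y) (at y)" for y
      unfolding has_vector_derivative_componentwise
    proof
      fix l
      have 1: "((\<lambda>y. w y $ l) has_vector_derivative ((A y *v w y) $ l - \<i> * \<theta> l * w y $ l)) (at y)"
        using w unfolding damped_ode_def has_vector_derivative_componentwise by simp
      have 2: "((\<lambda>y. exp (\<i> * \<theta> l * of_real (y - x))) has_vector_derivative \<i> * \<theta> l * exp (\<i> * \<theta> l * of_real (y - x))) (at y)"
        unfolding of_real_diff
        by (rule has_vector_derivative_real_field[where f="\<lambda>z. exp (\<i> * \<theta> l * (z - of_real x))"])
           (auto intro!: derivative_eq_intros)
      show "((\<lambda>y. damp \<theta> (y - x) (w y) $ l) has_vector_derivative ?f y $ l) (at y)"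
        using has_vector_derivative_mult[OF 2 1] by (simp add: damp_def algebra_simps)
    qed
    show "((\<lambda>y. damp \<theta> (y - x) (w y)) \<longlongrightarrow> c) at_top"
    proof (rule vec_tendstoI)
      fix l
      have wl: "((\<lambda>y. w y $ l) \<longlongrightarrow> c $ l) at_top" by (intro tendsto_intros lim)
      show "((\<lambda>y. damp \<theta> (y - x) (w y) $ l) \<longlongrightarrow> c $ l) at_top"
      proof (cases "\<theta> l = 0")
        case True
        then show ?thesis using wl by (simp add: damp_def)
      next
        case False
        then have cl: "c $ l = 0" using c[of l] by simp
        have "\<forall>\<^sub>F y in at_top. norm (damp \<theta> (y - x) (w y) $ l) \<le> norm (w y $ l)"
          using eventually_ge_at_top[of x]
        proof eventually_elim
          case (elim y)
          then show ?case using im by (auto simp: dissipative_def damp_def norm_mult intro!: mult_left_le_one_le)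
        qed
        then show ?thesis
          unfolding cl by (rule Lim_null_comparison) (rule tendsto_norm_zero[OF wl[unfolded cl]])
      qed
    qed
  qed
  then show "w x = volterra \<theta> A c w x" by (simp add: volterra_def damp_def)
qed

section \<open>Dependence on a parameter\<close>

lemma continuous_on_lebesgue_integral:
  fixes F :: "'z::metric_space \<Rightarrow> 'y \<Rightarrow> 'b::{banach, second_countable_topology}"
  assumes cont: "\<And>y. continuous_on S (\<lambda>z. F z y)"
    and meas: "\<And>z. z \<in> S \<Longrightarrow> F z \<in> borel_measurable M"
    and bound: "\<And>z y. z \<in> S \<Longrightarrow> norm (F z y) \<le> g y" and g: "integrable M g"
  shows "continuous_on S (\<lambda>z. integral\<^sup>L M (F z))"
  unfolding continuous_on_sequentially comp_def
proof (intro allI ballI impI)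
  fix X a assume a: "a \<in> S" and X: "(\<forall>n. X n \<in> S) \<and> X \<longlonglongrightarrow> a"
  show "(\<lambda>n. integral\<^sup>L M (F (X n))) \<longlonglongrightarrow> integral\<^sup>L M (F a)"
  proof (rule integral_dominated_convergence[where w=g])
    have "(\<lambda>n. F (X n) y) \<longlonglongrightarrow> F a y" for y
      using cont[of y] a X unfolding continuous_on_sequentially comp_def by blast
    then show "AE y in M. (\<lambda>n. F (X n) y) \<longlonglongrightarrow> F a y" by auto
  qed (use a X meas bound g in auto)
qed

text \<open>Cauchy's inequality bounds the derivative of the integrand, hence also its difference quotients, by a multiple of
\<open>g\<close>, so dominated convergence applies to the difference quotients.\<close>

lemma holomorphic_on_lebesgue_integral:
  fixes F :: "complex \<Rightarrow> 'y \<Rightarrow> complex"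
  assumes U: "open U" and hol: "\<And>y. (\<lambda>z. F z y) holomorphic_on U"
    and meas: "\<And>z. z \<in> U \<Longrightarrow> F z \<in> borel_measurable M"
    and bound: "\<And>z y. z \<in> U \<Longrightarrow> norm (F z y) \<le> g y" and g: "integrable M g"
  shows "(\<lambda>z. integral\<^sup>L M (F z)) holomorphic_on U"
proof -
  have int: "integrable M (F z)" if "z \<in> U" for z
    by (rule Bochner_Integration.integrable_bound[OF g meas[OF that]]) (use order_trans[OF bound[OF that] abs_ge_self] in auto)
  have "\<exists>D. ((\<lambda>z. integral\<^sup>L M (F z)) has_field_derivative D) (at a)" if a: "a \<in> U" for a
  proof -
    obtain r where r: "0 < r" "cball a r \<subseteq> U" using U a open_contains_cball by blast
    define d where "d z y = deriv (\<lambda>z. F z y) z" for z y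
    have D: "((\<lambda>z. F z y) has_field_derivative d z y) (at z)" if "z \<in> U" for z y
      unfolding d_def by (rule holomorphic_derivI[OF hol U that])
    have dle: "norm (d z y) \<le> g y / (r/2)" if z: "z \<in> cball a (r/2)" for z y
    proof -
      have sub: "cball z (r/2) \<subseteq> U"
      proof
        fix t assume "t \<in> cball z (r/2)"
        then have "dist a t \<le> r" using z dist_triangle[of a t z] by auto
        then show "t \<in> U" using r by auto
      qed
      have "norm ((deriv ^^ 1) (\<lambda>z. F z y) z) \<le> fact 1 * g y / (r/2) ^ 1"
      proof (rule Cauchy_inequality)
        show "(\<lambda>z. F z y) holomorphic_on ball z (r/2)"
          using sub by (intro holomorphic_on_subset[OF hol]) auto
        show "continuous_on (cball z (r/2)) (\<lambda>z. F z y)"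
          using sub by (intro holomorphic_on_imp_continuous_on holomorphic_on_subset[OF hol]) auto
        show "norm (F x y) \<le> g y" if "norm (z - x) = r/2" for x
          using sub that by (intro bound) (auto simp: dist_norm)
      qed (use r in auto)
      then show ?thesis by (simp add: d_def)
    qed
    have quot: "norm ((F (a + h) y - F a y) / h) \<le> g y / (r/2)" if h: "h \<noteq> 0" "norm h \<le> r/2" for h y
    proof -
      have "norm (F (a + h) y - F a y) \<le> (g y / (r/2)) * norm (a + h - a)"
      proof (rule field_differentiable_bound[OF convex_cball[of a "r/2"], where f'="\<lambda>z. d z y"])
        fix z assume z: "z \<in> cball a (r/2)"
        then have "z \<in> U" using r by auto
        then show "((\<lambda>z. F z y) has_field_derivative d z y) (at z within cball a (r/2))"
          using D has_field_derivative_at_within by blast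
        show "norm (d z y) \<le> g y / (r/2)" by (rule dle[OF z])
      qed (use r h in \<open>auto simp: dist_norm\<close>)
      then show ?thesis using h r(1) by (simp add: norm_divide divide_simps)
    qed
    have "((\<lambda>h. (integral\<^sup>L M (F (a + h)) - integral\<^sup>L M (F a)) / h) \<longlongrightarrow> integral\<^sup>L M (d a)) (at 0)"
      unfolding tendsto_at_iff_sequentially comp_def
    proof (intro allI impI)
      fix X :: "nat \<Rightarrow> complex" assume X0: "\<forall>i. X i \<in> UNIV - {0}" and X: "X \<longlonglongrightarrow> 0"
      \<comment> \<open>The bound on the quotients holds only for small increments, so finitely many terms of the sequence are replaced.\<close>
      define Y where "Y n = (if norm (X n) \<le> r/2 then X n else of_real (r/2))" for n
      have Y: "Y n \<noteq> 0" "norm (Y n) \<le> r/2" for n using X0 r by (auto simp: Y_def)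
      have "\<forall>\<^sub>F n in sequentially. norm (X n) < r/2"
        using tendstoD[OF X, of "r/2"] r by (auto simp: dist_norm)
      then have XY: "\<forall>\<^sub>F n in sequentially. Y n = X n" by eventually_elim (auto simp: Y_def)
      have Y0: "Y \<longlonglongrightarrow> 0" using X by (rule Lim_transform_eventually) (use XY in \<open>auto elim: eventually_mono\<close>)
      have inU: "a + Y n \<in> U" for n
        using Y[of n] r by (intro subsetD[OF r(2)]) (auto simp: dist_norm)
      have "(\<lambda>n. integral\<^sup>L M (\<lambda>y. (F (a + Y n) y - F a y) / Y n)) \<longlonglongrightarrow> integral\<^sup>L M (d a)"
      proof (rule integral_dominated_convergence[where w="\<lambda>y. g y / (r/2)"])
        have lim: "(\<lambda>n. (F (a + Y n) y - F a y) / Y n) \<longlonglongrightarrow> d a y" for y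
        proof -
          have "filterlim Y (at 0) sequentially"
            using Y0 Y(1) by (auto simp: filterlim_at)
          then show ?thesis
            using D[OF a, of y, unfolded DERIV_def] by (rule filterlim_compose[rotated])
        qed
        then show "AE y in M. (\<lambda>n. (F (a + Y n) y - F a y) / Y n) \<longlonglongrightarrow> d a y" by auto
        show "(\<lambda>y. (F (a + Y n) y - F a y) / Y n) \<in> borel_measurable M" for n
          using meas[OF inU[of n]] meas[OF a] by auto
        then show "d a \<in> borel_measurable M"
          by (rule borel_measurable_LIMSEQ_metric[OF _ lim])
        show "integrable M (\<lambda>y. g y / (r/2))" using g by auto
        show "AE y in M. norm ((F (a + Y n) y - F a y) / Y n) \<le> g y / (r/2)" for n
          using quot[OF Y] by auto
      qed
      moreover have "integral\<^sup>L M (\<lambda>y. (F (a + Y n) y - F a y) / Y n) = (integral\<^sup>L M (F (a + Y n)) - integral\<^sup>L M (F a)) / Y n" for n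
        using int[OF inU] int[OF a] by (simp add: Bochner_Integration.integral_diff)
      ultimately have "(\<lambda>n. (integral\<^sup>L M (F (a + Y n)) - integral\<^sup>L M (F a)) / Y n) \<longlonglongrightarrow> integral\<^sup>L M (d a)"
        by (simp only:)
      then show "(\<lambda>n. (integral\<^sup>L M (F (a + X n)) - integral\<^sup>L M (F a)) / X n) \<longlonglongrightarrow> integral\<^sup>L M (d a)"
        by (rule Lim_transform_eventually) (use XY in eventually_elim, auto)
    qed
    then show ?thesis unfolding DERIV_def by blast
  qed
  then show ?thesis using U by (simp add: holomorphic_on_open)
qed

context
  fixes \<theta> :: "complex \<Rightarrow> 'n::finite \<Rightarrow> complex" and A :: "complex \<Rightarrow> real \<Rightarrow> complex^'n^'n" and k \<Lambda>
  assumes im: "\<And>z. z \<in> \<Lambda> \<Longrightarrow> dissipative (\<theta> z)" and dom: "\<And>z. z \<in> \<Lambda> \<Longrightarrow> dominated (A z) k"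
begin

lemma picard_bounded: "\<exists>B\<ge>0. \<forall>z\<in>\<Lambda>. \<forall>x. norm (picard (\<theta> z) (A z) c n x) \<le> B"
proof (induction n)
  case (Suc n)
  then obtain B where B: "0 \<le> B" "\<And>z x. z \<in> \<Lambda> \<Longrightarrow> norm (picard (\<theta> z) (A z) c n x) \<le> B" by blast
  let ?K = "\<bar>integral\<^sup>L lborel k\<bar>"
  have "norm (picard (\<theta> z) (A z) c (Suc n) x) \<le> norm c + B * ?K" if z: "z \<in> \<Lambda>" for z x
  proof -
    have k: "weight k" using dom[OF z] by (simp add: dominated_def)
    have "norm (picard (\<theta> z) (A z) c (Suc n) x - c) \<le> B * tail k x"
      using norm_volterra_le[OF im[OF z] dom[OF z] bounded_right_picard[OF im[OF z] dom[OF z]] B(2)[OF z]] by simp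
    also have "\<dots> \<le> B * ?K"
      using weight_tail_le[OF k, of x] B(1) by (intro mult_left_mono) auto
    finally show ?thesis
      using norm_triangle_ineq2[of "picard (\<theta> z) (A z) c (Suc n) x" c] by linarith
  qed
  then show ?case using B(1) by (intro exI[of _ "norm c + B * ?K"]) auto
qed (auto intro: exI[of _ "norm c"])

text \<open>The data needed to apply the two preceding theorems to one Picard step.\<close>

lemma picard_integrand:
  obtains g where "integrable lborel g"
    and "\<And>z y. z \<in> \<Lambda> \<Longrightarrow> norm (indicator {x<..} y *\<^sub>R damp (\<theta> z) (y - x) (A z y *v picard (\<theta> z) (A z) c n y)) \<le> g y"
    and "\<And>z. z \<in> \<Lambda> \<Longrightarrow> (\<lambda>y. indicator {x<..} y *\<^sub>R damp (\<theta> z) (y - x) (A z y *v picard (\<theta> z) (A z) c n y)) \<in> borel_measurable lborel"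
proof (cases "\<Lambda> = {}")
  case True then show ?thesis using that[of "\<lambda>_. 0"] by auto
next
  case False
  then obtain z0 where z0: "z0 \<in> \<Lambda>" by blast
  then have k: "weight k" using dom by (auto simp: dominated_def)
  obtain B where B: "0 \<le> B" "\<And>z x. z \<in> \<Lambda> \<Longrightarrow> norm (picard (\<theta> z) (A z) c n x) \<le> B"
    using picard_bounded by blast
  show ?thesis
  proof (rule that[of "\<lambda>y. k y * B"])
    show "integrable lborel (\<lambda>y. k y * B)" using k by (auto simp: weight_def)
    fix z assume z: "z \<in> \<Lambda>"
    show "(\<lambda>y. indicator {x<..} y *\<^sub>R damp (\<theta> z) (y - x) (A z y *v picard (\<theta> z) (A z) c n y)) \<in> borel_measurable lborel"
      by (rule borel_measurable_integrable,
          rule volterra_integrable[OF im[OF z] dom[OF z] bounded_right_picard[OF im[OF z] dom[OF z]], unfolded set_integrable_def])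
    fix y
    show "norm (indicator {x<..} y *\<^sub>R damp (\<theta> z) (y - x) (A z y *v picard (\<theta> z) (A z) c n y)) \<le> k y * B"
    proof (cases "x < y")
      case True
      have "norm (damp (\<theta> z) (y - x) (A z y *v picard (\<theta> z) (A z) c n y)) \<le> norm (A z y *v picard (\<theta> z) (A z) c n y)"
        by (rule norm_damp_le[OF im[OF z]]) (use True in auto)
      also have "\<dots> \<le> k y * norm (picard (\<theta> z) (A z) c n y)"
        by (rule norm_coefficient_le[OF im[OF z] dom[OF z]])
      also have "\<dots> \<le> k y * B" using k by (intro mult_left_mono B z) (auto simp: weight_def)
      finally show ?thesis using True by simp
    qed (use k B in \<open>auto simp: weight_def\<close>)
  qed
qed

lemma continuous_on_picard_parameter:
  assumes "\<And>l. continuous_on \<Lambda> (\<lambda>z. \<theta> z l)" and "\<And>y. continuous_on \<Lambda> (\<lambda>z. A z y)"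
  shows "continuous_on \<Lambda> (\<lambda>z. picard (\<theta> z) (A z) c n x)"
proof (induction n arbitrary: x)
  case (Suc n)
  obtain g where g: "integrable lborel g"
    "\<And>z y. z \<in> \<Lambda> \<Longrightarrow> norm (indicator {x<..} y *\<^sub>R damp (\<theta> z) (y - x) (A z y *v picard (\<theta> z) (A z) c n y)) \<le> g y"
    "\<And>z. z \<in> \<Lambda> \<Longrightarrow> (\<lambda>y. indicator {x<..} y *\<^sub>R damp (\<theta> z) (y - x) (A z y *v picard (\<theta> z) (A z) c n y)) \<in> borel_measurable lborel"
    using picard_integrand[of x c n] by blast
  have "continuous_on \<Lambda> (\<lambda>z. LINT y|lborel. indicator {x<..} y *\<^sub>R damp (\<theta> z) (y - x) (A z y *v picard (\<theta> z) (A z) c n y))"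
  proof (rule continuous_on_lebesgue_integral[OF _ g(3) g(2) g(1)])
    show "continuous_on \<Lambda> (\<lambda>z. indicator {x<..} y *\<^sub>R damp (\<theta> z) (y - x) (A z y *v picard (\<theta> z) (A z) c n y))" for y
      unfolding damp_def by (intro continuous_intros assms Suc)
  qed
  then show ?case
    by (auto simp: volterra_def tail_def set_lebesgue_integral_def intro!: continuous_intros)
qed auto

lemma holomorphic_on_picard_parameter:
  assumes U: "open U" "U \<subseteq> \<Lambda>" and "\<And>l. (\<lambda>z. \<theta> z l) holomorphic_on U"
    and "\<And>y l m. (\<lambda>z. A z y $ l $ m) holomorphic_on U"
  shows "(\<lambda>z. picard (\<theta> z) (A z) c n x $ l) holomorphic_on U"
proof (induction n arbitrary: x l)
  case (Suc n)
  let ?f = "\<lambda>z y. indicator {x<..} y *\<^sub>R damp (\<theta> z) (y - x) (A z y *v picard (\<theta> z) (A z) c n y)"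
  obtain g where g: "integrable lborel g"
    "\<And>z y. z \<in> \<Lambda> \<Longrightarrow> norm (?f z y) \<le> g y" "\<And>z. z \<in> \<Lambda> \<Longrightarrow> ?f z \<in> borel_measurable lborel"
    using picard_integrand[of x c n] by blast
  have hol: "(\<lambda>z. ?f z y $ l) holomorphic_on U" for y
    by (simp only: vector_scaleR_component damp_def vec_lambda_beta matrix_vector_mult_def)
       (unfold scaleR_conv_of_real, intro holomorphic_intros assms Suc)
  have "(\<lambda>z. integral\<^sup>L lborel (\<lambda>y. ?f z y $ l)) holomorphic_on U"
  proof (rule holomorphic_on_lebesgue_integral[OF U(1) hol _ _ g(1)])
    fix z assume "z \<in> U"
    then have z: "z \<in> \<Lambda>" using U by auto
    show "(\<lambda>y. ?f z y $ l) \<in> borel_measurable lborel"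
      by (rule measurable_compose[OF g(3)[OF z]]) (intro borel_measurable_continuous_onI continuous_intros)
    show "norm (?f z y $ l) \<le> g y" for y
      by (rule order_trans[OF Finite_Cartesian_Product.norm_nth_le g(2)[OF z]])
  qed
  moreover have "picard (\<theta> z) (A z) c (Suc n) x $ l = c $ l - integral\<^sup>L lborel (\<lambda>y. ?f z y $ l)" if "z \<in> U" for z
  proof -
    have z: "z \<in> \<Lambda>" using U that by auto
    have "tail (\<lambda>y. damp (\<theta> z) (y - x) (A z y *v picard (\<theta> z) (A z) c n y)) x $ l
      = tail (\<lambda>y. damp (\<theta> z) (y - x) (A z y *v picard (\<theta> z) (A z) c n y) $ l) x"
      by (rule tail_component, rule volterra_integrable[OF im[OF z] dom[OF z] bounded_right_picard[OF im[OF z] dom[OF z]]])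
    then show ?thesis
      by (simp add: volterra_def) (simp add: tail_def set_lebesgue_integral_def)
  qed
  ultimately show ?case
    using holomorphic_transform[of "\<lambda>z. c $ l - integral\<^sup>L lborel (\<lambda>y. ?f z y $ l)" U
      "\<lambda>z. picard (\<theta> z) (A z) c (Suc n) x $ l"]
    by (simp add: holomorphic_on_diff)
qed auto

lemma picard_uniform_limit_parameter:
  "uniform_limit \<Lambda> (\<lambda>n z. picard (\<theta> z) (A z) c n x) (\<lambda>z. volterra_solution (\<theta> z) (A z) c x) sequentially"
  using picard_uniform_limit[of \<Lambda> \<theta> A k c, OF im dom] by (fastforce simp: uniform_limit_iff elim: eventually_mono)

lemma continuous_on_volterra_solution_parameter:
  assumes "\<And>l. continuous_on \<Lambda> (\<lambda>z. \<theta> z l)" and "\<And>y. continuous_on \<Lambda> (\<lambda>z. A z y)"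
  shows "continuous_on \<Lambda> (\<lambda>z. volterra_solution (\<theta> z) (A z) c x)"
  by (rule uniform_limit_theorem[OF _ picard_uniform_limit_parameter])
     (auto intro!: always_eventually continuous_on_picard_parameter assms)

lemma holomorphic_on_volterra_solution_parameter:
  assumes U: "open U" "U \<subseteq> \<Lambda>" and "\<And>l. (\<lambda>z. \<theta> z l) holomorphic_on U"
    and "\<And>y l m. (\<lambda>z. A z y $ l $ m) holomorphic_on U"
  shows "(\<lambda>z. volterra_solution (\<theta> z) (A z) c x $ l) holomorphic_on U"
proof (rule holomorphic_uniform_sequence[OF U(1)])
  show "(\<lambda>z. picard (\<theta> z) (A z) c n x $ l) holomorphic_on U" for n
    by (rule holomorphic_on_picard_parameter[OF assms])
  fix a assume "a \<in> U"
  then obtain d where d: "0 < d" "cball a d \<subseteq> U" using U(1) open_contains_cball by blast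
  have "uniform_limit (cball a d) (\<lambda>n z. picard (\<theta> z) (A z) c n x $ l) (\<lambda>z. volterra_solution (\<theta> z) (A z) c x $ l) sequentially"
    by (intro bounded_linear.uniform_limit[OF bounded_linear_vec_nth]
          uniform_limit_on_subset[OF picard_uniform_limit_parameter]) (use d U in auto)
  with d show "\<exists>d>0. cball a d \<subseteq> U \<and> uniform_limit (cball a d) (\<lambda>n z. picard (\<theta> z) (A z) c n x $ l) (\<lambda>z. volterra_solution (\<theta> z) (A z) c x $ l) sequentially"
    by blast
qed

end

section \<open>Asymptotics for a large rate\<close>

text \<open>A Riemann--Lebesgue lemma that is uniform over a family of factors \<open>w\<close> and over the closed upper half-plane of
frequencies. Far out, the integral is small because \<open>p\<close> is integrable. On the remaining bounded interval
\<open>p\<close> is close to a polynomial, and integration by parts gains a factor \<open>1 / norm \<kappa>\<close>.\<close>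

lemma oscillatory_tail_small:
  fixes p :: "real \<Rightarrow> complex" and q :: "real \<Rightarrow> real"
  assumes p: "continuous_on UNIV p" "set_integrable lborel {x0<..} p"
    and q: "continuous_on UNIV q" and C: "0 < C" and \<delta>: "0 < \<delta>"
  obtains N where "\<And>\<kappa> w w' x. N \<le> norm \<kappa> \<Longrightarrow> 0 \<le> Im \<kappa> \<Longrightarrow>
      (\<And>y. (w has_vector_derivative w' y) (at y)) \<Longrightarrow> continuous_on UNIV w' \<Longrightarrow>
      (\<And>y. norm (w y) \<le> C) \<Longrightarrow> (\<And>y. norm (w' y) \<le> q y) \<Longrightarrow> x0 \<le> x \<Longrightarrow>
      norm (tail (\<lambda>y. exp (\<i> * \<kappa> * of_real (y - x)) * (p y * w y)) x) \<le> \<delta>"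
proof -
  have np: "set_integrable lborel {x0<..} (\<lambda>y. norm (p y))" using p(2) by (rule set_integrable_norm)
  have "(tail (\<lambda>y. norm (p y)) \<longlongrightarrow> 0) at_top" by (rule tail_tendsto_0[OF np])
  then have "\<forall>\<^sub>F R in at_top. dist (tail (\<lambda>y. norm (p y)) R) 0 < \<delta> / (4 * C)"
    by (rule tendstoD) (use C \<delta> in auto)
  then have "\<forall>\<^sub>F R in at_top. x0 \<le> R \<and> tail (\<lambda>y. norm (p y)) R < \<delta> / (4 * C)"
    using eventually_ge_at_top[of x0] by eventually_elim auto
  then obtain R where R: "x0 \<le> R" "tail (\<lambda>y. norm (p y)) R < \<delta> / (4 * C)"
    by (auto simp: eventually_at_top_linorder)
  define r where "r = R - x0 + 1"
  have r: "0 < r" using R by (simp add: r_def)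
  \<comment> \<open>The error of the polynomial approximation, integrated over the interval, stays below a quarter of the allowance.\<close>
  define \<eta> where "\<eta> = \<delta> / (4 * C * r)"
  have \<eta>: "0 < \<eta>" using C \<delta> r by (simp add: \<eta>_def)
  have "\<exists>P. polynomial_function P \<and> (\<forall>y\<in>{x0..R}. norm (p y - P y) < \<eta>)"
    by (rule Stone_Weierstrass_polynomial_function[OF compact_Icc continuous_on_subset[OF p(1) subset_UNIV] \<eta>])
  then obtain P where P: "polynomial_function P" "\<And>y. y \<in> {x0..R} \<Longrightarrow> norm (p y - P y) < \<eta>"
    by auto
  obtain P' where P': "polynomial_function P'" "\<And>y. (P has_vector_derivative P' y) (at y)"
    using has_vector_derivative_polynomial_function[OF P(1)] by blast
  have cP: "continuous_on S P" "continuous_on S P'" for S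
    using P(1) P'(1) by (auto intro: continuous_on_polymonial_function)
  have bdd: "\<exists>M>0. \<forall>y\<in>{x0..R}. norm (f y) \<le> M" if "continuous_on UNIV f" for f :: "real \<Rightarrow> 'b::euclidean_space"
  proof -
    have "bounded (f ` {x0..R})"
      by (intro compact_imp_bounded compact_continuous_image continuous_on_subset[OF that]) auto
    then show ?thesis by (auto simp: bounded_pos)
  qed
  obtain M0 where M0: "0 < M0" "\<And>y. y \<in> {x0..R} \<Longrightarrow> norm (P y) \<le> M0" using bdd[OF cP(1)] by auto
  obtain M1 where M1: "0 < M1" "\<And>y. y \<in> {x0..R} \<Longrightarrow> norm (P' y) \<le> M1" using bdd[OF cP(2)] by auto
  obtain Q where Q: "0 < Q" "\<And>y. y \<in> {x0..R} \<Longrightarrow> norm (q y) \<le> Q" using bdd[OF q] by auto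
  define D where "D = 2 * (M0 * C) + (M1 * C + M0 * Q) * (R - x0)"
  have D: "0 < D" using M0 M1 Q C R by (auto simp: D_def intro!: add_pos_nonneg)
  show ?thesis
  proof (rule that[of "4 * D / \<delta>"])
    fix \<kappa> :: complex and w w' :: "real \<Rightarrow> complex" and x :: real
    assume \<kappa>N: "4 * D / \<delta> \<le> norm \<kappa>" and im: "0 \<le> Im \<kappa>"
      and dw: "\<And>y. (w has_vector_derivative w' y) (at y)" and cw': "continuous_on UNIV w'"
      and wC: "\<And>y. norm (w y) \<le> C" and w'q: "\<And>y. norm (w' y) \<le> q y" and x: "x0 \<le> x"
    have \<kappa>: "0 < norm \<kappa>" using \<kappa>N D \<delta> by (smt (verit) divide_pos_pos)
    have cw: "continuous_on UNIV w"
      using dw by (meson continuous_at_imp_continuous_on has_vector_derivative_continuous)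
    define e where "e y = exp (\<i> * \<kappa> * of_real (y - x))" for y :: real
    have ec: "continuous_on S e" for S unfolding e_def by (intro continuous_intros)
    have e1: "norm (e y) \<le> 1" if "x \<le> y" for y
      using that im by (simp add: e_def)
    let ?F = "\<lambda>y. e y * (p y * w y)"
    have tailR: "norm (tail ?F t) \<le> C * tail (\<lambda>y. norm (p y)) t \<and> set_integrable lborel {t<..} ?F" if t: "x \<le> t" for t
    proof -
      have h: "set_integrable lborel {t<..} (\<lambda>y. C * norm (p y))"
        using set_integrable_subset[OF np, of "{t<..}"] x t by auto
      have m: "set_borel_measurable lborel {t<..} ?F"
        by (intro continuous_set_borel_measurable continuous_intros ec p cw)
      have le: "norm (?F y) \<le> C * norm (p y)" if y: "t < y" for y
      proof -
        have "norm (e y) * (norm (p y) * norm (w y)) \<le> 1 * (norm (p y) * C)"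
          by (intro mult_mono e1 wC) (use y t C in auto)
        then show ?thesis by (simp add: norm_mult mult_ac)
      qed
      show ?thesis
        using tail_bound_integrable[OF m h le] norm_tail_le[OF m h le] by (auto simp: tail_def)
    qed
    have tail_mono: "C * tail (\<lambda>y. norm (p y)) t \<le> \<delta> / 4" if "R \<le> t" for t
    proof -
      have "tail (\<lambda>y. norm (p y)) t = tail (\<lambda>y. norm (p y)) R - integral {R..t} (\<lambda>y. norm (p y))"
        using that R by (intro tail_eq_integral set_integrable_subset[OF np]) auto
      moreover have "0 \<le> integral {R..t} (\<lambda>y. norm (p y))" by (rule integral_nonneg) (auto intro!: integrable_continuous_real continuous_intros continuous_on_subset[OF p(1)])
      ultimately have "tail (\<lambda>y. norm (p y)) t \<le> \<delta> / (4 * C)" using R by linarith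
      then show ?thesis using C by (simp add: field_simps)
    qed
    show "norm (tail (\<lambda>y. exp (\<i> * \<kappa> * of_real (y - x)) * (p y * w y)) x) \<le> \<delta>"
      unfolding e_def[symmetric]
    proof (cases "R \<le> x")
      case True
      then show "norm (tail ?F x) \<le> \<delta>" using tailR[of x] tail_mono[OF True] \<delta> by auto
    next
      case False
      then have xR: "x \<le> R" by simp
      have int: "f integrable_on {x..R}" if "continuous_on UNIV f" for f :: "real \<Rightarrow> complex"
        by (rule integrable_continuous_real[OF continuous_on_subset[OF that]]) auto
      have I: "integral {x..R} ?F = integral {x..R} (\<lambda>y. e y * ((p y - P y) * w y)) + integral {x..R} (\<lambda>y. e y * (P y * w y))"
        by (subst integral_add[symmetric]) (auto intro!: int continuous_intros ec p cw cP simp: algebra_simps)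
      have "norm (integral {x..R} (\<lambda>y. e y * ((p y - P y) * w y))) \<le> (\<eta> * C) * (R - x)"
      proof (rule integral_bound[OF xR])
        show "continuous_on {x..R} (\<lambda>y. e y * ((p y - P y) * w y))"
          by (intro continuous_intros ec cP continuous_on_subset[OF p(1)] continuous_on_subset[OF cw]) auto
        fix y assume y: "y \<in> {x..R}"
        have "norm (e y) * (norm (p y - P y) * norm (w y)) \<le> 1 * (\<eta> * C)"
          using y x less_imp_le[OF P(2)[of y]] \<eta> by (intro mult_mono e1 wC) auto
        then show "norm (e y * ((p y - P y) * w y)) \<le> \<eta> * C" by (simp add: norm_mult)
      qed
      moreover have "(\<eta> * C) * (R - x) \<le> \<delta> / 4"
      proof -
        have "(\<eta> * C) * (R - x) \<le> (\<eta> * C) * r" using x \<eta> C by (intro mult_left_mono) (auto simp: r_def)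
        also have "\<dots> = \<delta> / 4" using C r by (simp add: \<eta>_def)
        finally show ?thesis .
      qed
      moreover have "norm (integral {x..R} (\<lambda>y. e y * (P y * w y))) \<le> \<delta> / 4"
      proof -
        have intP: "(\<lambda>y. e y * (P y * w y)) integrable_on {x..R}"
          by (intro int continuous_intros ec cP cw)
        define g where "g y = e y / (\<i> * \<kappa>) * (P' y * w y + P y * w' y)" for y
        have de: "((\<lambda>y. e y / (\<i> * \<kappa>)) has_vector_derivative e y) (at y)" for y
          unfolding e_def of_real_diff
          by (rule has_vector_derivative_real_field[where f="\<lambda>z. exp (\<i> * \<kappa> * (z - of_real x)) / (\<i> * \<kappa>)"])
             (use \<kappa> in \<open>auto intro!: derivative_eq_intros\<close>)
        have "((\<lambda>y. e y / (\<i> * \<kappa>) * (P y * w y)) has_vector_derivative (g y + e y * (P y * w y))) (at y)" for y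
          using has_vector_derivative_mult[OF de has_vector_derivative_mult[OF P'(2) dw], of y]
          by (simp add: g_def algebra_simps)
        then have "((\<lambda>y. g y + e y * (P y * w y)) has_integral
            (e R / (\<i> * \<kappa>) * (P R * w R) - e x / (\<i> * \<kappa>) * (P x * w x))) {x..R}"
          by (intro fundamental_theorem_of_calculus[OF xR]) (auto intro: has_vector_derivative_at_within)
        moreover have gc: "continuous_on UNIV g"
          unfolding g_def using \<kappa> by (intro continuous_intros ec cP cw cw') auto
        then have "g integrable_on {x..R}" by (rule int)
        ultimately have "integral {x..R} (\<lambda>y. e y * (P y * w y)) =
            (e R / (\<i> * \<kappa>) * (P R * w R) - e x / (\<i> * \<kappa>) * (P x * w x)) - integral {x..R} g"
          using integral_add[of g "{x..R}" "\<lambda>y. e y * (P y * w y)"] intP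
          by (auto simp: has_integral_iff eq_diff_eq add.commute)
        moreover have G: "norm (e y / (\<i> * \<kappa>) * (P y * w y)) \<le> M0 * C / norm \<kappa>" if y: "y \<in> {x..R}" for y
        proof -
          have "norm (e y) * (norm (P y) * norm (w y)) \<le> 1 * (M0 * C)"
            using y x M0 C by (intro mult_mono e1 wC) auto
          then show ?thesis using \<kappa> by (simp add: norm_mult norm_divide divide_simps)
        qed
        moreover have "norm (integral {x..R} g) \<le> ((M1 * C + M0 * Q) / norm \<kappa>) * (R - x)"
        proof (rule integral_bound[OF xR continuous_on_subset[OF gc]])
          fix y assume y: "y \<in> {x..R}"
          have "norm (P' y * w y + P y * w' y) \<le> norm (P' y) * norm (w y) + norm (P y) * norm (w' y)"
            by (rule order_trans[OF norm_triangle_ineq]) (simp add: norm_mult)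
          also have "\<dots> \<le> M1 * C + M0 * Q"
            using y x M0 M1 C order_trans[OF w'q[of y]] Q(2)[of y]
            by (intro add_mono mult_mono wC) (auto simp: abs_le_iff)
          finally have "norm (e y) * norm (P' y * w y + P y * w' y) \<le> 1 * (M1 * C + M0 * Q)"
            using y by (intro mult_mono e1) auto
          then show "norm (g y) \<le> (M1 * C + M0 * Q) / norm \<kappa>"
            using \<kappa> by (simp add: g_def norm_mult norm_divide divide_simps)
        qed auto
        moreover have "((M1 * C + M0 * Q) / norm \<kappa>) * (R - x) \<le> ((M1 * C + M0 * Q) / norm \<kappa>) * (R - x0)"
          using x M0 M1 Q C \<kappa> by (intro mult_left_mono divide_nonneg_pos) auto
        ultimately have "norm (integral {x..R} (\<lambda>y. e y * (P y * w y))) \<le>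
            M0 * C / norm \<kappa> + M0 * C / norm \<kappa> + ((M1 * C + M0 * Q) / norm \<kappa>) * (R - x0)"
          using G[of R] G[of x] xR norm_triangle_ineq4[of "e R / (\<i> * \<kappa>) * (P R * w R)" "e x / (\<i> * \<kappa>) * (P x * w x)"]
            norm_triangle_ineq4[of "e R / (\<i> * \<kappa>) * (P R * w R) - e x / (\<i> * \<kappa>) * (P x * w x)" "integral {x..R} g"]
          by (smt (verit) atLeastAtMost_iff)
        also have "\<dots> = D / norm \<kappa>" by (simp add: D_def divide_inverse algebra_simps)
        also have "\<dots> \<le> \<delta> / 4" using \<kappa>N \<kappa> \<delta> by (simp add: field_simps)
        finally show ?thesis .
      qed
      moreover have T: "tail ?F x = integral {x..R} ?F + tail ?F R"
        using tail_eq_integral[of x ?F R] tailR[of x] xR by simp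
      moreover have "norm (tail ?F R) \<le> \<delta> / 4" using tailR[OF xR] tail_mono[of R] by auto
      ultimately show "norm (tail ?F x) \<le> \<delta>"
        unfolding T I using \<delta> norm_triangle_ineq[of "integral {x..R} (\<lambda>y. e y * ((p y - P y) * w y)) + integral {x..R} (\<lambda>y. e y * (P y * w y))" "tail ?F R"]
          norm_triangle_ineq[of "integral {x..R} (\<lambda>y. e y * ((p y - P y) * w y))" "integral {x..R} (\<lambda>y. e y * (P y * w y))"]
        by linarith
    qed
  qed
qed

lemma norm_axis_one: "norm (axis i 1 :: complex^'n::finite) = 1"
  by (simp add: norm_vec_def L2_set_def axis_def if_distrib[of norm] if_distrib[of "\<lambda>t. t^2"] cong: if_cong)

lemma matrix_vector_mult_2:
  fixes A :: "complex^2^2"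
  assumes "i \<noteq> j"
  shows "(A *v w) $ l = A $ l $ i * w $ i + A $ l $ j * w $ j"
  using assms exhaust_2[of i] exhaust_2[of j] by (auto simp: matrix_vector_mult_def sum_2)

lemma mat_matrix_mult_component: "(mat e ** B) $ l $ m = e * B $ l $ m" for B :: "complex^'n::finite^'n"
  by (simp add: matrix_matrix_mult_def mat_def if_distrib[of "\<lambda>x. x * _"] cong: if_cong)

lemma norm_entry_le_entry_norm: "norm (A $ l $ m) \<le> entry_norm A"
proof -
  have "norm (A $ l $ m) \<le> (\<Sum>m\<in>UNIV. norm (A $ l $ m))" by (rule member_le_sum) auto
  also have "\<dots> \<le> entry_norm A" unfolding entry_norm_def
    by (rule member_le_sum[where f="\<lambda>l. \<Sum>m\<in>UNIV. norm (A $ l $ m)"]) (auto intro: sum_nonneg)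
  finally show ?thesis .
qed

lemma entry_norm_add_scaled: "entry_norm (A + mat e ** B) \<le> entry_norm A + norm e * entry_norm B"
  unfolding entry_norm_def sum_distrib_left sum.distrib[symmetric]
  by (intro sum_mono) (simp add: mat_matrix_mult_component order_trans[OF norm_triangle_ineq] norm_mult)

lemma weight_add: "weight k \<Longrightarrow> weight k' \<Longrightarrow> weight (\<lambda>y. k y + k' y)"
  unfolding weight_def by (auto intro: continuous_intros)

lemma weight_cmult: "weight k \<Longrightarrow> 0 \<le> c \<Longrightarrow> weight (\<lambda>y. c * k y)"
  unfolding weight_def by (auto intro: continuous_intros)

lemma continuous_on_add_scaled:
  fixes A B :: "real \<Rightarrow> complex^'n::finite^'n"
  shows "continuous_on S A \<Longrightarrow> continuous_on S B \<Longrightarrow> continuous_on S (\<lambda>y. A y + mat e ** B y)"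
proof -
  have eq: "mat e ** B y = (\<chi> l m. e * B y $ l $ m)" for y
    by (simp add: vec_eq_iff mat_matrix_mult_component)
  show "continuous_on S A \<Longrightarrow> continuous_on S B \<Longrightarrow> continuous_on S (\<lambda>y. A y + mat e ** B y)"
    unfolding eq by (intro continuous_intros)
qed

lemma dominated_add_scaled:
  assumes "dominated A k" and "dominated B k'" and "norm e \<le> c"
  shows "dominated (\<lambda>y. A y + mat e ** B y) (\<lambda>y. k y + c * k' y)"
proof -
  have c: "0 \<le> c" using assms(3) norm_ge_zero order_trans by blast
  have "entry_norm (A y + mat e ** B y) \<le> k y + c * k' y" for y
  proof -
    have "entry_norm (A y + mat e ** B y) \<le> entry_norm (A y) + norm e * entry_norm (B y)" by (rule entry_norm_add_scaled)
    also have "\<dots> \<le> k y + c * k' y"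
      using assms c by (intro add_mono mult_mono) (auto simp: dominated_def entry_norm_def intro!: sum_nonneg)
    finally show ?thesis .
  qed
  then show ?thesis
    using assms c by (auto simp: dominated_def intro!: weight_add weight_cmult continuous_on_add_scaled)
qed

lemma tail_weighted:
  fixes q :: "real \<Rightarrow> 'a::euclidean_space"
  assumes k: "weight k" and d: "continuous_on UNIV d" "\<And>y. \<bar>d y\<bar> \<le> b" and q: "continuous_on UNIV q"
    and le: "\<And>y. x < y \<Longrightarrow> norm (q y) \<le> k y * d y"
  shows "set_integrable lborel {x<..} q" "norm (tail q x) \<le> tail (\<lambda>y. k y * d y) x"
proof -
  have h: "set_integrable lborel {x<..} (\<lambda>y. k y * d y)"
    by (rule weight_bounded_integrable[OF k, where a=x and b=b])
       (use d in \<open>auto intro: continuous_on_subset\<close>)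
  show "set_integrable lborel {x<..} q" "norm (tail q x) \<le> tail (\<lambda>y. k y * d y) x"
    by (rule tail_bound_integrable[OF continuous_set_borel_measurable[OF q] h le]
             norm_tail_le[OF continuous_set_borel_measurable[OF q] h le]; assumption)+
qed

lemma tail_weighted_const:
  fixes q :: "real \<Rightarrow> 'a::euclidean_space"
  assumes k: "weight k" and q: "continuous_on UNIV q" and b: "0 \<le> b"
    and le: "\<And>y. x < y \<Longrightarrow> norm (q y) \<le> k y * b"
  shows "set_integrable lborel {x<..} q" "norm (tail q x) \<le> b * integral\<^sup>L lborel k"
proof -
  have c: "continuous_on UNIV (\<lambda>y::real. b)" "\<And>y::real. \<bar>b\<bar> \<le> b" using b by (auto intro: continuous_intros)
  show "set_integrable lborel {x<..} q" by (rule tail_weighted(1)[OF k c q le])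
  have "norm (tail q x) \<le> tail (\<lambda>y. k y * b) x" by (rule tail_weighted(2)[OF k c q le])
  also have "\<dots> = b * tail k x" by (simp add: tail_def mult.commute)
  also have "\<dots> \<le> b * integral\<^sup>L lborel k" by (intro mult_left_mono weight_tail_le k b)
  finally show "norm (tail q x) \<le> b * integral\<^sup>L lborel k" .
qed

text \<open>For column \<open>i\<close> of a Jost solution the exponential is normalised away in the entry \<open>i\<close>, which is
the one with limit \<open>1\<close>.\<close>

definition column_rate :: "2 \<Rightarrow> complex \<Rightarrow> 2 \<Rightarrow> complex" where
  "column_rate i \<kappa> l = (if l = i then 0 else \<kappa>)"

lemma dissipative_column_rate: "0 \<le> Im \<kappa> \<Longrightarrow> dissipative (column_rate i \<kappa>)"
  by (auto simp: dissipative_def column_rate_def)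

lemma tail_add:
  "set_integrable lborel {x<..} f \<Longrightarrow> set_integrable lborel {x<..} g \<Longrightarrow> tail (\<lambda>y. f y + g y) x = tail f x + tail g x"
  unfolding tail_def by (rule set_integral_add(2))

lemma tail_diff:
  "set_integrable lborel {x<..} f \<Longrightarrow> set_integrable lborel {x<..} g \<Longrightarrow> tail (\<lambda>y. f y - g y) x = tail f x - tail g x"
  unfolding tail_def by (rule set_integral_diff(2))

text \<open>The solution of the decoupled scalar equation $E' = aE$ with limit \<open>1\<close> at \<open>+\<infinity>\<close>.\<close>

lemma exp_tail:
  fixes a :: "real \<Rightarrow> complex"
  assumes k: "weight k" and a: "continuous_on UNIV a" "\<And>y. norm (a y) \<le> k y"
  defines "E \<equiv> (\<lambda>x. exp (- tail a x))"
  shows "continuous_on UNIV E" "norm (E x) \<le> exp (integral\<^sup>L lborel k)"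
    "set_integrable lborel {x<..} (\<lambda>y. a y * E y)" "tail (\<lambda>y. a y * E y) x = 1 - E x"
proof -
  have i: "set_integrable lborel {x<..} a" and le: "norm (tail a x) \<le> 1 * integral\<^sup>L lborel k" for x
    by (rule tail_weighted_const[OF k a(1), where b=1]; use a in auto)+
  have d: "(tail a has_vector_derivative - a x) (at x)" for x
    by (rule tail_has_vector_derivative[OF i a(1)])
  have dE: "(E has_vector_derivative a x * E x) (at x)" for x
  proof -
    have "((exp \<circ> (\<lambda>x. - tail a x)) has_vector_derivative (a x * exp (- tail a x))) (at x)"
      using has_vector_derivative_minus[OF d[of x]]
      by (intro field_vector_diff_chain_at) (auto intro!: derivative_eq_intros)
    then show ?thesis by (simp add: E_def comp_def)
  qed
  show cE: "continuous_on UNIV E"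
    using dE by (meson continuous_at_imp_continuous_on has_vector_derivative_continuous)
  show nE: "norm (E x) \<le> exp (integral\<^sup>L lborel k)" for x
    unfolding E_def using le[of x] abs_Re_le_cmod[of "tail a x"] by auto
  show ai: "set_integrable lborel {x<..} (\<lambda>y. a y * E y)" for x
    by (rule tail_weighted_const[OF k, where b="exp (integral\<^sup>L lborel k)"])
       (use a nE cE k in \<open>auto simp: norm_mult weight_def intro!: continuous_intros mult_mono\<close>)
  have "(E \<longlongrightarrow> exp (- 0)) at_top"
    unfolding E_def by (intro tendsto_intros tail_tendsto_0[OF i])
  then show "tail (\<lambda>y. a y * E y) x = 1 - E x"
    using tail_FTC[OF ai _ dE] a cE by (simp add: continuous_on_mult)
qed

text \<open>The entry \<open>j\<close> is driven by the oscillatory integral \<open>osc\<close> and by the term with \<open>e\<close>, so Gronwall bounds it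
by \<open>\<sigma>\<close>. The entry \<open>i\<close> then solves the decoupled scalar equation up to an error controlled by \<open>\<sigma>\<close> and
\<open>e\<close>, and a second application of Gronwall compares it with the exponential.\<close>

lemma perturbation_estimate:
  fixes A B :: "real \<Rightarrow> complex^2^2" and i j :: 2
  assumes ij: "i \<noteq> j" and A: "dominated A k" and B: "dominated B k'" and e: "norm e \<le> 1" and im: "0 \<le> Im \<kappa>"
  defines "w \<equiv> volterra_solution (column_rate i \<kappa>) (\<lambda>y. A y + mat e ** B y) (axis i 1)"
  defines "K \<equiv> integral\<^sup>L lborel k" and "K' \<equiv> integral\<^sup>L lborel k'"
  defines "C \<equiv> 1 + 2 * exp (2 * (K + K'))"
  assumes osc: "\<And>x. x0 \<le> x \<Longrightarrow> norm (tail (\<lambda>y. exp (\<i> * \<kappa> * of_real (y - x)) * (A y $ j $ i * w y $ i)) x) \<le> \<delta>"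
  defines "\<sigma> \<equiv> 2 * (\<delta> + norm e * (C * K')) * exp (2 * K)"
  assumes x: "x0 \<le> x"
  shows "norm (w x $ j) \<le> \<sigma>"
    and "norm (w x $ i - exp (- tail (\<lambda>y. A y $ i $ i) x)) \<le> 2 * (\<sigma> * K + norm e * (C * K')) * exp (2 * K)"
proof -
  let ?\<theta> = "column_rate i \<kappa>" and ?A = "\<lambda>y. A y + mat e ** B y"
  have diss: "dissipative ?\<theta>" by (rule dissipative_column_rate[OF im])
  have dom: "dominated ?A (\<lambda>y. k y + 1 * k' y)" by (rule dominated_add_scaled[OF A B e])
  have k: "weight k" "weight k'" and Ac: "continuous_on UNIV A" "continuous_on UNIV B"
    and Ak: "\<And>y. entry_norm (A y) \<le> k y" "\<And>y. entry_norm (B y) \<le> k' y"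
    using A B by (auto simp: dominated_def)
  have kc: "continuous_on UNIV k" "continuous_on UNIV k'" "\<And>y. 0 \<le> k y" "\<And>y. 0 \<le> k' y"
    using k by (auto simp: weight_def)
  have entry: "norm (A y $ l $ m) \<le> k y" "norm (B y $ l $ m) \<le> k' y" for y l m
    using order_trans[OF norm_entry_le_entry_norm Ak(1)] order_trans[OF norm_entry_le_entry_norm Ak(2)] by auto
  have K0: "0 \<le> K" "0 \<le> K'" unfolding K_def K'_def using k by (auto simp: weight_def intro!: integral_nonneg_AE)
  have C0: "0 < C" unfolding C_def by (intro add_pos_pos) auto
  have int_sum: "integral\<^sup>L lborel (\<lambda>y. k y + 1 * k' y) = K + K'"
    using k by (simp add: K_def K'_def weight_def)
  have wC: "norm (w y) \<le> C" for y
    using norm_volterra_solution_le[OF diss dom, of "axis i 1" y] unfolding int_sum C_def w_def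
    by (simp add: norm_axis_one)
  have t: "bounded_right w" unfolding w_def by (rule bounded_right_volterra_solution[OF diss dom])
  then have cw: "continuous_on UNIV w" by (simp add: bounded_right_def)
  have wl: "norm (w y $ l) \<le> C" for y l by (rule order_trans[OF Finite_Cartesian_Product.norm_nth_le wC])
  have Bw: "norm ((B y *v w y) $ l) \<le> k' y * C" for y l
  proof -
    have "norm ((B y *v w y) $ l) \<le> norm (B y *v w y)" by (rule Finite_Cartesian_Product.norm_nth_le)
    also have "\<dots> \<le> entry_norm (B y) * norm (w y)" by (rule norm_matrix_vector_le)
    also have "\<dots> \<le> k' y * C" using Ak kc wC by (intro mult_mono) auto
    finally show ?thesis .
  qed
  have ed: "norm (exp (\<i> * ?\<theta> l * of_real (y - x))) \<le> 1" if "x < y" for l x y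
    using that im by (auto simp: column_rate_def)
  have rep: "w x $ l = axis i 1 $ l - (tail (\<lambda>y. exp (\<i> * ?\<theta> l * of_real (y - x)) * (A y $ l $ i * w y $ i)) x
       + tail (\<lambda>y. exp (\<i> * ?\<theta> l * of_real (y - x)) * (A y $ l $ j * w y $ j)) x
       + e * tail (\<lambda>y. exp (\<i> * ?\<theta> l * of_real (y - x)) * (B y *v w y) $ l) x)" for x l
  proof -
    have m: "norm (exp (\<i> * ?\<theta> l * of_real (y - x)) * (A y $ l $ m * w y $ m)) \<le> k y * C" if "x < y" for y m
    proof -
      have "norm (exp (\<i> * ?\<theta> l * of_real (y - x))) * (norm (A y $ l $ m) * norm (w y $ m)) \<le> 1 * (k y * C)"
        by (intro mult_mono ed that entry wl) (use kc C0 in auto)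
      then show ?thesis by (simp add: norm_mult)
    qed
    have iA: "set_integrable lborel {x<..} (\<lambda>y. exp (\<i> * ?\<theta> l * of_real (y - x)) * (A y $ l $ m * w y $ m))" for m
      by (rule tail_weighted_const(1)[OF k(1) _ _ m])
         (use C0 in \<open>auto intro!: continuous_intros Ac cw\<close>)
    have mB: "norm (exp (\<i> * ?\<theta> l * of_real (y - x)) * (B y *v w y) $ l) \<le> k' y * C" if "x < y" for y
    proof -
      have "norm (exp (\<i> * ?\<theta> l * of_real (y - x))) * norm ((B y *v w y) $ l) \<le> 1 * (k' y * C)"
        by (intro mult_mono ed that Bw) auto
      then show ?thesis by (simp add: norm_mult)
    qed
    have iB: "set_integrable lborel {x<..} (\<lambda>y. exp (\<i> * ?\<theta> l * of_real (y - x)) * (B y *v w y) $ l)"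
      by (rule tail_weighted_const(1)[OF k(2) _ _ mB])
         (use C0 in \<open>auto intro!: continuous_intros Ac cw\<close>)
    have split: "damp ?\<theta> (y - x) (?A y *v w y) $ l =
       exp (\<i> * ?\<theta> l * of_real (y - x)) * (A y $ l $ i * w y $ i)
       + exp (\<i> * ?\<theta> l * of_real (y - x)) * (A y $ l $ j * w y $ j)
       + e * (exp (\<i> * ?\<theta> l * of_real (y - x)) * (B y *v w y) $ l)" for y
      unfolding damp_def vec_lambda_beta matrix_vector_mult_2[OF ij]
      by (simp add: mat_matrix_mult_component algebra_simps)
    have "w x $ l = axis i 1 $ l - tail (\<lambda>y. damp ?\<theta> (y - x) (?A y *v w y)) x $ l"
      using volterra_solution_eq[OF diss dom, of "axis i 1" x] unfolding w_def by (simp add: volterra_def)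
    also have "tail (\<lambda>y. damp ?\<theta> (y - x) (?A y *v w y)) x $ l = tail (\<lambda>y. damp ?\<theta> (y - x) (?A y *v w y) $ l) x"
      by (rule tail_component[OF volterra_integrable[OF diss dom t]])
    also have "\<dots> = tail (\<lambda>y. exp (\<i> * ?\<theta> l * of_real (y - x)) * (A y $ l $ i * w y $ i)) x
       + tail (\<lambda>y. exp (\<i> * ?\<theta> l * of_real (y - x)) * (A y $ l $ j * w y $ j)) x
       + tail (\<lambda>y. e * (exp (\<i> * ?\<theta> l * of_real (y - x)) * (B y *v w y) $ l)) x"
      unfolding split
      by (subst tail_add, intro set_integral_add iA set_integrable_mult_right iB, rule set_integrable_mult_right, rule iB,
          subst tail_add, rule iA, rule iA, rule refl)
    also have "tail (\<lambda>y. e * (exp (\<i> * ?\<theta> l * of_real (y - x)) * (B y *v w y) $ l)) x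
       = e * tail (\<lambda>y. exp (\<i> * ?\<theta> l * of_real (y - x)) * (B y *v w y) $ l) x"
      by (simp add: tail_def)
    finally show ?thesis .
  qed
  have Btail: "norm (e * tail (\<lambda>y. exp (\<i> * ?\<theta> l * of_real (y - x)) * (B y *v w y) $ l) x) \<le> norm e * (C * K')" for l x
  proof -
    have "norm (tail (\<lambda>y. exp (\<i> * ?\<theta> l * of_real (y - x)) * (B y *v w y) $ l) x) \<le> C * K'"
      unfolding K'_def
    proof (rule tail_weighted_const(2)[OF k(2)])
      fix y assume "x < y"
      then have "norm (exp (\<i> * ?\<theta> l * of_real (y - x))) * norm ((B y *v w y) $ l) \<le> 1 * (k' y * C)"
        by (intro mult_mono ed Bw) auto
      then show "norm (exp (\<i> * ?\<theta> l * of_real (y - x)) * (B y *v w y) $ l) \<le> k' y * C" by (simp add: norm_mult)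
    qed (use C0 in \<open>auto intro!: continuous_intros Ac cw\<close>)
    then show ?thesis by (simp add: norm_mult mult_left_mono)
  qed
  have \<delta>0: "0 \<le> \<delta>" using osc[OF x] norm_ge_zero order_trans by blast
  have gron: "2 * \<eta> * exp (2 * tail k x) \<le> 2 * \<eta> * exp (2 * K)" if "0 \<le> \<eta>" for \<eta> x
    using weight_tail_le[OF k(1), of x] that by (intro mult_left_mono) (auto simp: K_def)
  have wj: "norm (w x $ j) \<le> \<sigma>" if x: "x0 \<le> x" for x
  proof -
    have "norm (w x $ j) \<le> 2 * (\<delta> + norm e * (C * K')) * exp (2 * tail k x)"
    proof (rule gronwall_half_line[OF k(1), where a=x0 and b=C])
      fix x assume x: "x0 \<le> x"
      have "norm (tail (\<lambda>y. exp (\<i> * ?\<theta> j * of_real (y - x)) * (A y $ j $ j * w y $ j)) x) \<le> tail (\<lambda>y. k y * norm (w y $ j)) x"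
      proof (rule tail_weighted(2)[OF k(1)])
        fix y assume "x < y"
        then have "norm (exp (\<i> * ?\<theta> j * of_real (y - x))) * (norm (A y $ j $ j) * norm (w y $ j)) \<le> 1 * (k y * norm (w y $ j))"
          by (intro mult_mono ed entry) (use kc in auto)
        then show "norm (exp (\<i> * ?\<theta> j * of_real (y - x)) * (A y $ j $ j * w y $ j)) \<le> k y * norm (w y $ j)"
          by (simp add: norm_mult)
      qed (use wl in \<open>auto intro!: continuous_intros Ac cw\<close>)
      moreover have "norm (tail (\<lambda>y. exp (\<i> * ?\<theta> j * of_real (y - x)) * (A y $ j $ i * w y $ i)) x) \<le> \<delta>"
        using osc[OF x] ij by (simp add: column_rate_def)
      moreover have "axis i 1 $ j = (0::complex)" using ij by (simp add: axis_def)
      ultimately show "norm (w x $ j) \<le> \<delta> + norm e * (C * K') + tail (\<lambda>y. k y * norm (w y $ j)) x"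
        using Btail[of j x] rep[of x j]
          norm_triangle_ineq[of "tail (\<lambda>y. exp (\<i> * ?\<theta> j * of_real (y - x)) * (A y $ j $ i * w y $ i)) x"
            "tail (\<lambda>y. exp (\<i> * ?\<theta> j * of_real (y - x)) * (A y $ j $ j * w y $ j)) x"]
          norm_triangle_ineq[of "tail (\<lambda>y. exp (\<i> * ?\<theta> j * of_real (y - x)) * (A y $ j $ i * w y $ i)) x
            + tail (\<lambda>y. exp (\<i> * ?\<theta> j * of_real (y - x)) * (A y $ j $ j * w y $ j)) x"
            "e * tail (\<lambda>y. exp (\<i> * ?\<theta> j * of_real (y - x)) * (B y *v w y) $ j) x"]
        by (simp only: diff_0 norm_minus_cancel)
    qed (use wl \<delta>0 K0 C0 x in \<open>auto intro!: continuous_intros cw continuous_on_subset[OF cw]\<close>)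
    also have "\<dots> \<le> \<sigma>" unfolding \<sigma>_def using \<delta>0 K0 C0 by (intro gron) auto
    finally show ?thesis .
  qed
  show "norm (w x $ j) \<le> \<sigma>" by (rule wj[OF x])
  have \<sigma>0: "0 \<le> \<sigma>" using wj[OF x] norm_ge_zero order_trans by blast
  let ?a = "\<lambda>y. A y $ i $ i"
  define E where "E x = exp (- tail ?a x)" for x
  have ac: "continuous_on UNIV ?a" by (intro continuous_intros Ac)
  note E = exp_tail[OF k(1) ac entry(1), folded E_def]
  have "norm (w x $ i - E x) \<le> 2 * (\<sigma> * K + norm e * (C * K')) * exp (2 * tail k x)"
  proof (rule gronwall_half_line[OF k(1), where a=x0 and b="C + exp K"])
    show "norm (w y $ i - E y) \<le> C + exp K" for y
      using norm_triangle_ineq4[of "w y $ i" "E y"] wl[of y i] E(2)[of y] by (simp add: K_def)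
    then have bE: "\<bar>norm (w y $ i - E y)\<bar> \<le> C + exp K" for y by simp
    fix x assume x: "x0 \<le> x"
    have iw: "set_integrable lborel {x<..} (\<lambda>y. ?a y * w y $ i)"
      by (rule tail_weighted_const(1)[OF k(1), where b=C])
         (use C0 wl entry kc in \<open>auto intro!: continuous_intros Ac cw mult_mono simp: norm_mult\<close>)
    have "w x $ i - E x = - (tail (\<lambda>y. ?a y * w y $ i) x - tail (\<lambda>y. ?a y * E y) x)
        - tail (\<lambda>y. A y $ i $ j * w y $ j) x - e * tail (\<lambda>y. (B y *v w y) $ i) x"
      by (subst rep) (simp add: E(4) column_rate_def)
    also have "tail (\<lambda>y. ?a y * w y $ i) x - tail (\<lambda>y. ?a y * E y) x = tail (\<lambda>y. ?a y * (w y $ i - E y)) x"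
      by (subst tail_diff[symmetric, OF iw E(3)]) (simp add: algebra_simps)
    finally have eq: "w x $ i - E x = - tail (\<lambda>y. ?a y * (w y $ i - E y)) x - tail (\<lambda>y. A y $ i $ j * w y $ j) x
        - e * tail (\<lambda>y. (B y *v w y) $ i) x" .
    have 1: "norm (tail (\<lambda>y. ?a y * (w y $ i - E y)) x) \<le> tail (\<lambda>y. k y * norm (w y $ i - E y)) x"
      by (rule tail_weighted(2)[OF k(1) _ bE])
         (auto intro!: continuous_intros Ac cw E mult_right_mono entry simp: norm_mult)
    have 2: "norm (tail (\<lambda>y. A y $ i $ j * w y $ j) x) \<le> \<sigma> * K"
      unfolding K_def
      by (rule tail_weighted_const(2)[OF k(1)])
         (use x wj \<sigma>0 entry kc in \<open>auto intro!: continuous_intros Ac cw mult_mono simp: norm_mult\<close>)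
    have 3: "norm (e * tail (\<lambda>y. (B y *v w y) $ i) x) \<le> norm e * (C * K')"
      using Btail[of i x] by (simp add: column_rate_def)
    show "norm (w x $ i - E x) \<le> \<sigma> * K + norm e * (C * K') + tail (\<lambda>y. k y * norm (w y $ i - E y)) x"
      unfolding eq using 1 2 3
        norm_triangle_ineq4[of "- tail (\<lambda>y. ?a y * (w y $ i - E y)) x - tail (\<lambda>y. A y $ i $ j * w y $ j) x" "e * tail (\<lambda>y. (B y *v w y) $ i) x"]
        norm_triangle_ineq4[of "- tail (\<lambda>y. ?a y * (w y $ i - E y)) x" "tail (\<lambda>y. A y $ i $ j * w y $ j) x"]
      by simp
  qed (use \<sigma>0 K0 C0 x in \<open>auto intro!: continuous_intros continuous_on_subset[OF cw] continuous_on_subset[OF E(1)]\<close>)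
  also have "\<dots> \<le> 2 * (\<sigma> * K + norm e * (C * K')) * exp (2 * K)"
    using \<sigma>0 K0 C0 by (intro gron) auto
  finally show "norm (w x $ i - exp (- tail ?a x)) \<le> 2 * (\<sigma> * K + norm e * (C * K')) * exp (2 * K)"
    by (simp add: E_def)
qed

lemma column_rate_axis: "column_rate i \<kappa> l * axis i 1 $ l = 0"
  by (simp add: column_rate_def axis_def)

text \<open>A large rate decouples the two entries, since the coupling enters the integral equation only through an oscillatory
integral. What remains is the scalar equation of the diagonal coefficient. The limit is taken along an arbitrary
filter, which covers \<open>\<lambda> \<rightarrow> \<infinity>\<close> and \<open>\<lambda> \<rightarrow> 0\<close> alike.\<close>

theorem volterra_solution_asymptotics:
  fixes A B :: "real \<Rightarrow> complex^2^2" and i j :: 2 and \<kappa> \<epsilon> :: "'z \<Rightarrow> complex"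
  assumes ij: "i \<noteq> j" and A: "dominated A k" and B: "dominated B k'"
    and \<kappa>: "filterlim (\<lambda>z. norm (\<kappa> z)) at_top F" and im: "\<forall>\<^sub>F z in F. 0 \<le> Im (\<kappa> z)"
    and \<epsilon>: "(\<epsilon> \<longlongrightarrow> 0) F"
  shows "((\<lambda>z. volterra_solution (column_rate i (\<kappa> z)) (\<lambda>y. A y + mat (\<epsilon> z) ** B y) (axis i 1) x)
           \<longlongrightarrow> axis i (exp (- tail (\<lambda>y. A y $ i $ i) x))) F"
proof -
  define w where "w z = volterra_solution (column_rate i (\<kappa> z)) (\<lambda>y. A y + mat (\<epsilon> z) ** B y) (axis i 1)" for z
  let ?E = "exp (- tail (\<lambda>y. A y $ i $ i) x)"
  define K K' where "K = integral\<^sup>L lborel k" and "K' = integral\<^sup>L lborel k'"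
  define C where "C = 1 + 2 * exp (2 * (K + K'))"
  have k: "weight k" "weight k'" and Ac: "continuous_on UNIV A" "continuous_on UNIV B"
    and Ak: "\<And>y. entry_norm (A y) \<le> k y" "\<And>y. entry_norm (B y) \<le> k' y"
    using A B by (auto simp: dominated_def)
  have kc: "continuous_on UNIV k" "continuous_on UNIV k'" "\<And>y. 0 \<le> k y" "\<And>y. 0 \<le> k' y"
    using k by (auto simp: weight_def)
  have K0: "0 \<le> K" "0 \<le> K'" unfolding K_def K'_def using k by (auto simp: weight_def intro!: integral_nonneg_AE)
  have C0: "0 < C" unfolding C_def by (intro add_pos_pos) auto
  define G where "G = 2 * (1 + C * K') * exp (2 * K)"
  define H where "H = 2 * (G * K + C * K') * exp (2 * K)"
  have G0: "0 \<le> G" and H0: "0 \<le> H" using K0 C0 by (auto simp: G_def H_def)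
  have est: "\<forall>\<^sub>F z in F. norm (w z x $ j) < e \<and> norm (w z x $ i - ?E) < e" if e: "0 < e" for e
  proof -
    define T where "T = G + H + 1"
    have T: "0 < T" using G0 H0 by (simp add: T_def)
    define \<delta> where "\<delta> = e / (2 * T)"
    have \<delta>: "0 < \<delta>" using e T by (simp add: \<delta>_def)
    have small: "G * (2 * \<delta>) < e" "H * (2 * \<delta>) < e"
    proof -
      have "T * (2 * \<delta>) = e" using T by (simp add: \<delta>_def)
      moreover have "G * (2 * \<delta>) < T * (2 * \<delta>)" "H * (2 * \<delta>) < T * (2 * \<delta>)"
        using G0 H0 \<delta> by (auto intro!: mult_strict_right_mono simp: T_def)
      ultimately show "G * (2 * \<delta>) < e" "H * (2 * \<delta>) < e" by auto
    qed
    have pji: "continuous_on UNIV (\<lambda>y. A y $ j $ i)" by (intro continuous_intros Ac)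
    have iji: "set_integrable lborel {x<..} (\<lambda>y. A y $ j $ i)"
      by (rule tail_weighted_const(1)[OF k(1) pji, where b=1]) (use order_trans[OF norm_entry_le_entry_norm Ak(1)] in auto)
    obtain N where N: "\<And>\<kappa> w w' t. N \<le> norm \<kappa> \<Longrightarrow> 0 \<le> Im \<kappa> \<Longrightarrow>
      (\<And>y. (w has_vector_derivative w' y) (at y)) \<Longrightarrow> continuous_on UNIV w' \<Longrightarrow>
      (\<And>y. norm (w y) \<le> C) \<Longrightarrow> (\<And>y. norm (w' y) \<le> (k y + k' y) * C) \<Longrightarrow> x \<le> t \<Longrightarrow>
      norm (tail (\<lambda>y. exp (\<i> * \<kappa> * of_real (y - t)) * (A y $ j $ i * w y)) t) \<le> \<delta>"
      by (rule oscillatory_tail_small[OF pji iji, of "\<lambda>y. (k y + k' y) * C" C \<delta>])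
         (use kc C0 \<delta> in \<open>auto intro!: continuous_intros\<close>)
    have "\<forall>\<^sub>F z in F. N \<le> norm (\<kappa> z)" using \<kappa> by (simp add: filterlim_at_top)
    moreover have "\<forall>\<^sub>F z in F. norm (\<epsilon> z) < min 1 \<delta>"
      using tendstoD[OF \<epsilon>, of "min 1 \<delta>"] \<delta> by (simp add: dist_norm)
    ultimately show ?thesis using im
    proof eventually_elim
      case (elim z)
      let ?\<theta> = "column_rate i (\<kappa> z)" and ?A = "\<lambda>y. A y + mat (\<epsilon> z) ** B y"
      have diss: "dissipative ?\<theta>" by (rule dissipative_column_rate) (use elim in auto)
      have e1: "norm (\<epsilon> z) \<le> 1" using elim by simp
      have dom: "dominated ?A (\<lambda>y. k y + 1 * k' y)" by (rule dominated_add_scaled[OF A B e1])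
      have int_sum: "integral\<^sup>L lborel (\<lambda>y. k y + 1 * k' y) = K + K'"
        using k by (simp add: K_def K'_def weight_def)
      have wC: "norm (w z y) \<le> C" for y
        using norm_volterra_solution_le[OF diss dom, of "axis i 1" y] unfolding int_sum C_def w_def
        by (simp add: norm_axis_one)
      have cw: "continuous_on UNIV (w z)"
        using bounded_right_volterra_solution[OF diss dom] by (simp add: bounded_right_def w_def)
      have ode: "damped_ode ?\<theta> ?A (w z)"
        unfolding w_def by (rule damped_ode_volterra_solution[OF diss dom column_rate_axis])
      have dwi: "((\<lambda>y. w z y $ i) has_vector_derivative (?A y *v w z y) $ i) (at y)" for y
        using ode unfolding damped_ode_def has_vector_derivative_componentwise
        by (auto simp: column_rate_def dest!: spec[of _ y] spec[of _ i])
      have osc: "norm (tail (\<lambda>y. exp (\<i> * \<kappa> z * of_real (y - t)) * (A y $ j $ i * w z y $ i)) t) \<le> \<delta>"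
        if "x \<le> t" for t
      proof (rule N[OF _ _ dwi _ _ _ that])
        show "continuous_on UNIV (\<lambda>y. (?A y *v w z y) $ i)"
          by (intro continuous_intros continuous_on_add_scaled Ac cw)
        show "norm (w z y $ i) \<le> C" for y by (rule order_trans[OF Finite_Cartesian_Product.norm_nth_le wC])
        fix y
        have "norm ((?A y *v w z y) $ i) \<le> norm (?A y *v w z y)" by (rule Finite_Cartesian_Product.norm_nth_le)
        also have "\<dots> \<le> (k y + 1 * k' y) * norm (w z y)" by (rule norm_coefficient_le[OF diss dom])
        also have "\<dots> \<le> (k y + k' y) * C" using kc wC by (simp add: mult_left_mono)
        finally show "norm ((?A y *v w z y) $ i) \<le> (k y + k' y) * C" .
      qed (use elim in auto)
      note pe = perturbation_estimate[OF ij A B e1 elim(3) osc[unfolded w_def] order_refl[of x],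
        folded w_def K_def K'_def, folded C_def]
      let ?s = "\<delta> + norm (\<epsilon> z)"
      have s: "0 \<le> ?s" "?s \<le> 2 * \<delta>" using elim \<delta> by auto
      have S: "2 * (\<delta> + norm (\<epsilon> z) * (C * K')) * exp (2 * K) \<le> G * ?s"
      proof -
        have "\<delta> + norm (\<epsilon> z) * (C * K') \<le> (1 + C * K') * ?s" using \<delta> K0 C0 by (simp add: algebra_simps)
        then have "2 * (\<delta> + norm (\<epsilon> z) * (C * K')) * exp (2 * K) \<le> 2 * ((1 + C * K') * ?s) * exp (2 * K)"
          by (intro mult_right_mono mult_left_mono) auto
        then show ?thesis by (simp only: G_def mult_ac)
      qed
      have T: "2 * (2 * (\<delta> + norm (\<epsilon> z) * (C * K')) * exp (2 * K) * K + norm (\<epsilon> z) * (C * K')) * exp (2 * K) \<le> H * ?s"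
      proof -
        have "2 * (\<delta> + norm (\<epsilon> z) * (C * K')) * exp (2 * K) * K + norm (\<epsilon> z) * (C * K') \<le> G * ?s * K + ?s * (C * K')"
          using S K0 C0 \<delta> by (intro add_mono mult_right_mono) auto
        also have "\<dots> = (G * K + C * K') * ?s" by (simp add: algebra_simps)
        finally have "2 * (2 * (\<delta> + norm (\<epsilon> z) * (C * K')) * exp (2 * K) * K + norm (\<epsilon> z) * (C * K')) * exp (2 * K)
          \<le> 2 * ((G * K + C * K') * ?s) * exp (2 * K)"
          by (intro mult_right_mono mult_left_mono) auto
        then show ?thesis by (simp only: H_def mult_ac)
      qed
      have "norm (w z x $ j) \<le> G * (2 * \<delta>)"
        using pe(1) S mult_left_mono[OF s(2) G0] by linarith
      moreover have "norm (w z x $ i - ?E) \<le> H * (2 * \<delta>)"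
        using pe(2) T mult_left_mono[OF s(2) H0] by linarith
      ultimately show ?case using small by linarith
    qed
  qed
  show ?thesis
    unfolding w_def[symmetric]
  proof (rule vec_tendstoI)
    fix l
    consider "l = i" | "l = j" using ij exhaust_2[of i] exhaust_2[of j] exhaust_2[of l] by metis
    then show "((\<lambda>z. w z x $ l) \<longlongrightarrow> axis i ?E $ l) F"
    proof cases
      case 1
      show ?thesis
      proof (rule tendstoI)
        fix e :: real assume "0 < e"
        from est[OF this] show "\<forall>\<^sub>F z in F. dist (w z x $ l) (axis i ?E $ l) < e"
          by eventually_elim (simp add: 1 dist_norm axis_def)
      qed
    next
      case 2
      show ?thesis
      proof (rule tendstoI)
        fix e :: real assume "0 < e"
        from est[OF this] show "\<forall>\<^sub>F z in F. dist (w z x $ l) (axis i ?E $ l) < e"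
          by eventually_elim (use ij in \<open>simp add: 2 dist_norm axis_def\<close>)
      qed
    qed
  qed
qed

section \<open>Regularity and decay of the potentials\<close>

lemma integrable_inverse_square_weight: "integrable lborel (\<lambda>x::real. (inverse (1 + \<bar>x\<bar>))\<^sup>2)"
proof (rule Bochner_Integration.integrable_bound)
  have "set_integrable lborel (einterval (-\<infinity>) \<infinity>) (\<lambda>x. inverse (1 + x\<^sup>2))"
  proof (rule interval_integral_FTC_nonneg(1)[where F=arctan])
    show "((arctan \<circ> real_of_ereal) \<longlongrightarrow> - (pi / 2)) (at_right (- \<infinity>))"
      by (simp add: ereal_tendsto_simps tendsto_arctan_at_bot)
    show "((arctan \<circ> real_of_ereal) \<longlongrightarrow> pi / 2) (at_left \<infinity>)"
      by (simp add: ereal_tendsto_simps tendsto_arctan_at_top)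
    show "isCont (\<lambda>x. inverse (1 + x\<^sup>2)) x" for x :: real
      by (intro continuous_intros) (simp add: add_nonneg_eq_0_iff)
  qed (auto simp: DERIV_arctan)
  then show "integrable lborel (\<lambda>x::real. inverse (1 + x\<^sup>2))"
    by (simp add: set_integrable_def)
  have "(inverse (1 + \<bar>x\<bar>))\<^sup>2 \<le> inverse (1 + x\<^sup>2)" for x :: real
    unfolding power_inverse by (rule le_imp_inverse_le) (auto simp: power2_eq_square algebra_simps add_pos_nonneg)
  moreover have "0 \<le> inverse (1 + x\<^sup>2)" for x :: real by simp
  ultimately show "AE x in (lborel :: real measure). norm ((inverse (1 + \<bar>x\<bar>))\<^sup>2) \<le> norm (inverse (1 + x\<^sup>2))"
    by (auto simp: abs_of_nonneg)
qed simp

text \<open>The estimate $|f| = (1+|x|)|f|\cdot(1+|x|)^{-1} \le ((1+|x|)|f|)^2+(1+|x|)^{-2}$ and the integrability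
of $(1+|x|)^{-2}$.\<close>

lemma L21_integrable:
  assumes "f \<in> L21" shows "integrable lebesgue f"
proof (rule Bochner_Integration.integrable_bound)
  have "integrable lebesgue (\<lambda>x::real. (inverse (1 + \<bar>x\<bar>))\<^sup>2)"
    using integrable_inverse_square_weight by (subst integrable_completion) auto
  then show "integrable lebesgue (\<lambda>x. ((1 + \<bar>x\<bar>) * norm (f x))\<^sup>2 + (inverse (1 + \<bar>x\<bar>))\<^sup>2)"
    using assms unfolding L21_def by (auto intro: Bochner_Integration.integrable_add)
  show "f \<in> borel_measurable lebesgue" using assms by (simp add: L21_def)
  have "norm (f x) \<le> ((1 + \<bar>x\<bar>) * norm (f x))\<^sup>2 + (inverse (1 + \<bar>x\<bar>))\<^sup>2" for x
  proof -
    have "norm (f x) = ((1 + \<bar>x\<bar>) * norm (f x)) * inverse (1 + \<bar>x\<bar>)"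
    proof -
      have "1 + \<bar>x\<bar> \<noteq> 0" by (simp add: add_nonneg_eq_0_iff)
      then show ?thesis
        using nonzero_mult_div_cancel_left[of "1 + \<bar>x\<bar>" "norm (f x)", symmetric] by (metis divide_inverse)
    qed
    also have "\<dots> \<le> ((1 + \<bar>x\<bar>) * norm (f x))\<^sup>2 + (inverse (1 + \<bar>x\<bar>))\<^sup>2"
    proof -
      have "a * b \<le> a\<^sup>2 + b\<^sup>2" if "0 \<le> a" "0 \<le> b" for a b :: real
        using sum_squares_bound[of a b] mult_nonneg_nonneg[OF that] by linarith
      then show ?thesis by simp
    qed
    finally show ?thesis .
  qed
  then show "AE x in lebesgue. norm (f x) \<le> norm (((1 + \<bar>x\<bar>) * norm (f x))\<^sup>2 + (inverse (1 + \<bar>x\<bar>))\<^sup>2)"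
    by auto
qed

lemma has_ac_derivative_integral:
  assumes "has_ac_derivative f g" "a \<le> b"
  shows "g integrable_on {a..b}" "f b - f a = integral {a..b} g"
  using assms set_lebesgue_integral_eq_integral[of "{a..b}" g] unfolding has_ac_derivative_def by auto

lemma has_ac_derivative_continuous:
  assumes "has_ac_derivative f g"
  shows "continuous_on UNIV f"
proof -
  have "isCont f x" for x
  proof -
    have "continuous_on {x-1..x+1} (\<lambda>t. f (x-1) + integral {x-1..t} g)"
      by (intro continuous_intros indefinite_integral_continuous_1 has_ac_derivative_integral(1)[OF assms]) auto
    then have "continuous_on {x-1..x+1} f"
    proof (rule continuous_on_eq)
      show "f (x-1) + integral {x-1..t} g = f t" if "t \<in> {x-1..x+1}" for t
        using has_ac_derivative_integral(2)[OF assms, of "x-1" t] that by (simp add: algebra_simps)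
    qed
    then show ?thesis
      by (rule continuous_on_interior) auto
  qed
  then show ?thesis by (simp add: continuous_at_imp_continuous_on)
qed

lemma has_ac_derivative_has_vector_derivative:
  assumes f: "has_ac_derivative f g" and g: "continuous_on UNIV g"
  shows "(f has_vector_derivative g x) (at x)"
proof -
  have "((\<lambda>t. integral {x-1..t} g) has_vector_derivative g x) (at x within {x-1..x+1})"
    by (rule integral_has_vector_derivative) (auto intro: continuous_on_subset[OF g])
  then have "((\<lambda>t. integral {x-1..t} g) has_vector_derivative g x) (at x)"
    by (subst (asm) at_within_interior) auto
  from has_vector_derivative_add[OF has_vector_derivative_const[of "f (x-1)"] this]
  have "((\<lambda>t. f (x-1) + integral {x-1..t} g) has_vector_derivative g x) (at x)" by simp
  moreover have "f (x-1) + integral {x-1..t} g = f t" if "t \<in> {x-1<..}" for t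
    using has_ac_derivative_integral(2)[OF f, of "x-1" t] that by (auto simp: algebra_simps)
  ultimately show ?thesis
    by (intro has_vector_derivative_transform_within_open
          [of "\<lambda>t. f (x-1) + integral {x-1..t} g" _ x "{x-1<..}" f]) auto
qed

text \<open>The part of the hypothesis \<open>u \<in> I_space\<close> that the proof works with. Two weak derivatives make
\<open>f'\<close> continuous, and the weighted norms make \<open>f\<close> and \<open>f'\<close> integrable.\<close>

definition decaying_C1 :: "(real \<Rightarrow> complex) \<Rightarrow> (real \<Rightarrow> complex) \<Rightarrow> bool" where
  "decaying_C1 f f' \<longleftrightarrow> continuous_on UNIV f \<and> continuous_on UNIV f' \<and>
     (\<forall>x. (f has_vector_derivative f' x) (at x)) \<and> integrable lborel f \<and> integrable lborel f'"

lemma integrable_lebesgue_continuous: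
  fixes f :: "real \<Rightarrow> complex"
  assumes "integrable lebesgue f" "continuous_on UNIV f"
  shows "integrable lborel f"
  using assms integrable_completion[of f lborel] borel_measurable_continuous_onI[of f] by auto

lemma I_space_decaying_C1:
  assumes "u \<in> I_space"
  obtains u' where "decaying_C1 u u'"
proof -
  obtain f1 f2 where f: "has_ac_derivative u f1" "has_ac_derivative f1 f2" "f1 \<in> L21" "u \<in> L21"
    using assms by (auto simp: I_space_def)
  have c: "continuous_on UNIV u" "continuous_on UNIV f1"
    using f has_ac_derivative_continuous by blast+
  show ?thesis
    by (rule that[of f1])
       (use f c in \<open>auto simp: decaying_C1_def intro!: has_ac_derivative_has_vector_derivative
          integrable_lebesgue_continuous L21_integrable\<close>)
qed

lemma decaying_C1_reflect:
  assumes "decaying_C1 f f'"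
  shows "decaying_C1 (\<lambda>x. f (- x)) (\<lambda>x. - f' (- x))"
proof -
  have c: "continuous_on UNIV (\<lambda>x. f (- x))" "continuous_on UNIV (\<lambda>x. f' (- x))"
    using assms continuous_on_compose2[of UNIV f UNIV "\<lambda>x. - x"] continuous_on_compose2[of UNIV f' UNIV "\<lambda>x. - x"]
      continuous_on_minus[OF continuous_on_id[of UNIV]]
    by (auto simp: decaying_C1_def)
  have "((f \<circ> uminus) has_vector_derivative (- 1) *\<^sub>R f' (- x)) (at x)" for x
    by (rule vector_diff_chain_at) (use assms in \<open>auto simp: decaying_C1_def has_real_derivative_iff_has_vector_derivative[symmetric] intro!: derivative_eq_intros\<close>)
  then show ?thesis
    using assms c lborel_integrable_real_affine[of f "-1" 0] lborel_integrable_real_affine[of f' "-1" 0]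
    by (auto simp: decaying_C1_def comp_def intro: continuous_intros)
qed

text \<open>Since \<open>f'\<close> is integrable, \<open>f\<close> has a limit \<open>L\<close> at \<open>+\<infinity>\<close>. Averaging the constant \<open>L = f + tail f'\<close> over
the interval from \<open>x\<close> to \<open>x + 1\<close> bounds it by tails that tend to \<open>0\<close>, so \<open>L = 0\<close>.\<close>

lemma decaying_C1_facts:
  assumes f: "decaying_C1 f f'"
  shows decaying_C1_at_top: "(f \<longlongrightarrow> 0) at_top" and decaying_C1_bounded: "bounded (range f)"
proof -
  have c: "continuous_on UNIV f" "continuous_on UNIV f'" and d: "\<And>x. (f has_vector_derivative f' x) (at x)"
    and i: "integrable lborel f" "integrable lborel f'"
    using f by (auto simp: decaying_C1_def)
  have fi: "set_integrable lborel {x<..} f" "set_integrable lborel {x<..} f'" for x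
    unfolding set_integrable_def by (intro integrable_mult_indicator i; simp)+
  have ins: "set_integrable lborel {x<..} (\<lambda>y. norm (f y))" "set_integrable lborel {x<..} (\<lambda>y. norm (f' y))" for x
    by (intro set_integrable_norm fi)+
  have wk: "weight (\<lambda>y. norm (f y))" "weight (\<lambda>y. norm (f' y))"
    unfolding weight_def using c i by (auto intro: continuous_intros)
  have "((\<lambda>t. f t + tail f' t) has_vector_derivative 0) (at t within UNIV)" for t
    using has_vector_derivative_add[OF d[of t] tail_has_vector_derivative[OF fi(2) c(2), of t]] by simp
  then obtain L where L: "\<And>t. f t + tail f' t = L"
    using has_vector_derivative_zero_constant[of UNIV "\<lambda>t. f t + tail f' t"] by auto
  have ntail: "norm (tail f' x) \<le> tail (\<lambda>y. norm (f' y)) x" for x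
    unfolding tail_def by (rule set_integral_norm_bound[OF fi(2)])
  have tmono: "tail (\<lambda>y. norm (f' y)) b \<le> tail (\<lambda>y. norm (f' y)) a" if "a \<le> b" for a b
    using tail_eq_integral[OF ins(2) that] integral_nonneg[of "\<lambda>y. norm (f' y)" "{a..b}"]
    by (simp add: integrable_continuous_real continuous_on_norm continuous_on_subset[OF c(2)])
  have Lle: "norm L \<le> tail (\<lambda>y. norm (f y)) x + tail (\<lambda>y. norm (f' y)) x" for x
  proof -
    have "norm (integral {x..x+1} (\<lambda>y. L)) \<le> integral {x..x+1} (\<lambda>y. norm (f y) + tail (\<lambda>y. norm (f' y)) x)"
    proof (rule Henstock_Kurzweil_Integration.integral_norm_bound_integral)
      fix y assume y: "y \<in> {x..x+1}"
      have "norm L \<le> norm (f y) + norm (tail f' y)" using norm_triangle_ineq[of "f y" "tail f' y"] L[of y] by simp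
      then show "norm L \<le> norm (f y) + tail (\<lambda>y. norm (f' y)) x"
        using ntail[of y] tmono[of x y] y by auto
    qed (auto intro!: integrable_continuous_real continuous_intros continuous_on_subset[OF c(1)])
    also have "\<dots> = integral {x..x+1} (\<lambda>y. norm (f y)) + tail (\<lambda>y. norm (f' y)) x"
      by (subst integral_add) (auto intro!: integrable_continuous_real continuous_intros continuous_on_subset[OF c(1)])
    also have "integral {x..x+1} (\<lambda>y. norm (f y)) \<le> tail (\<lambda>y. norm (f y)) x"
      using tail_eq_integral[OF ins(1), of x "x+1"] weight_tail_nonneg[OF wk(1), of "x+1"] by simp
    finally show ?thesis by simp
  qed
  have "((\<lambda>x. tail (\<lambda>y. norm (f y)) x + tail (\<lambda>y. norm (f' y)) x) \<longlongrightarrow> 0 + 0) at_top"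
    by (intro tendsto_add tail_tendsto_0[OF ins(1)] tail_tendsto_0[OF ins(2)])
  then have "norm L \<le> 0"
    unfolding add_0 by (rule tendsto_lowerbound[OF _ always_eventually[OF allI[OF Lle]]]) simp
  then have fL: "f t = - tail f' t" for t using L[of t] by (simp add: eq_neg_iff_add_eq_0)
  have "((\<lambda>t. - tail f' t) \<longlongrightarrow> - 0) at_top" by (intro tendsto_minus tail_tendsto_0[OF fi(2)])
  moreover have "f = (\<lambda>t. - tail f' t)" by (rule ext) (rule fL)
  ultimately show "(f \<longlongrightarrow> 0) at_top" by simp
  have "norm (f t) \<le> integral\<^sup>L lborel (\<lambda>y. norm (f' y))" for t
    using ntail[of t] weight_tail_le[OF wk(2), of t] fL[of t] by simp
  then show "bounded (range f)" unfolding bounded_iff by auto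
qed

lemma decaying_C1_at_bot:
  assumes "decaying_C1 f f'" shows "(f \<longlongrightarrow> 0) at_bot"
  using decaying_C1_at_top[OF decaying_C1_reflect[OF assms]] by (simp add: filterlim_at_bot_mirror)

section \<open>Jost solutions as Volterra solutions\<close>

text \<open>Entries of coefficient matrices are polynomials in the potentials, their conjugates and \<open>v'\<close>. The integrable
continuous functions form a module over the bounded continuous ones, which settles the integrability of all
entries by closure rules.\<close>

definition cont_integrable :: "(real \<Rightarrow> complex) \<Rightarrow> bool" where
  "cont_integrable f \<longleftrightarrow> continuous_on UNIV f \<and> integrable lborel f"

definition cont_bounded :: "(real \<Rightarrow> complex) \<Rightarrow> bool" where
  "cont_bounded f \<longleftrightarrow> continuous_on UNIV f \<and> bounded (range f)"

lemma cont_bounded_const: "cont_bounded (\<lambda>x. c)"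
  by (auto simp: cont_bounded_def intro: continuous_intros)

lemma cont_bounded_add: "cont_bounded f \<Longrightarrow> cont_bounded g \<Longrightarrow> cont_bounded (\<lambda>x. f x + g x)"
  by (auto simp: cont_bounded_def intro: continuous_intros bounded_plus_comp)

lemma cont_bounded_cnj: "cont_bounded f \<Longrightarrow> cont_bounded (\<lambda>x. cnj (f x))"
  by (auto simp: cont_bounded_def bounded_iff intro: continuous_intros)

lemma cont_bounded_mult:
  assumes "cont_bounded f" "cont_bounded g" shows "cont_bounded (\<lambda>x. f x * g x)"
proof -
  obtain B C where "\<And>x. norm (f x) \<le> B" "\<And>x. norm (g x) \<le> C"
    using assms by (auto simp: cont_bounded_def bounded_iff)
  moreover from this have "0 \<le> B" by (meson norm_ge_zero order_trans)
  ultimately have "norm (f x * g x) \<le> B * C" for x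
    by (simp add: norm_mult mult_mono)
  then show ?thesis using assms by (auto simp: cont_bounded_def bounded_iff intro: continuous_intros)
qed

lemma cont_integrable_add: "cont_integrable f \<Longrightarrow> cont_integrable g \<Longrightarrow> cont_integrable (\<lambda>x. f x + g x)"
  by (auto simp: cont_integrable_def intro: continuous_intros)

lemma cont_integrable_uminus: "cont_integrable f \<Longrightarrow> cont_integrable (\<lambda>x. - f x)"
  by (auto simp: cont_integrable_def intro: continuous_intros)

lemma cont_integrable_diff: "cont_integrable f \<Longrightarrow> cont_integrable g \<Longrightarrow> cont_integrable (\<lambda>x. f x - g x)"
  by (auto simp: cont_integrable_def intro: continuous_intros)

lemma cont_integrable_cnj: "cont_integrable f \<Longrightarrow> cont_integrable (\<lambda>x. cnj (f x))"
  by (auto simp: cont_integrable_def intro: continuous_intros)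

lemma cont_integrable_mult:
  assumes f: "cont_bounded f" and g: "cont_integrable g"
  shows "cont_integrable (\<lambda>x. f x * g x)"
proof -
  obtain B where B: "\<And>x. norm (f x) \<le> B" using f by (auto simp: cont_bounded_def bounded_iff)
  have c: "continuous_on UNIV (\<lambda>x. f x * g x)"
    using assms by (auto simp: cont_bounded_def cont_integrable_def intro: continuous_intros)
  moreover have "integrable lborel (\<lambda>x. f x * g x)"
  proof (rule Bochner_Integration.integrable_bound)
    show "integrable lborel (\<lambda>x. B * norm (g x))" using g by (auto simp: cont_integrable_def)
    show "(\<lambda>x. f x * g x) \<in> borel_measurable lborel"
      using borel_measurable_continuous_onI[OF c] by simp
    have "norm (f x * g x) \<le> norm (B * norm (g x))" for x
      using mult_right_mono[OF B[of x], of "norm (g x)"] by (simp add: norm_mult)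
    then show "AE x in lborel. norm (f x * g x) \<le> norm (B * norm (g x))" by auto
  qed
  ultimately show ?thesis by (simp add: cont_integrable_def)
qed

lemma cont_integrable_mult': "cont_integrable f \<Longrightarrow> cont_bounded g \<Longrightarrow> cont_integrable (\<lambda>x. f x * g x)"
  using cont_integrable_mult[of g f] by (simp add: mult.commute)

lemma cont_integrable_reflect:
  assumes "cont_integrable f" shows "cont_integrable (\<lambda>x. f (- x))"
  using assms lborel_integrable_real_affine[of f "-1" 0]
    continuous_on_compose2[of UNIV f UNIV "\<lambda>x. - x"] continuous_on_minus[OF continuous_on_id[of UNIV]]
  by (auto simp: cont_integrable_def)

lemma dominated_entries:
  fixes A :: "real \<Rightarrow> complex^'n::finite^'n"
  assumes "\<And>l m. cont_integrable (\<lambda>y. A y $ l $ m)"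
  shows "dominated A (\<lambda>y. entry_norm (A y))"
proof -
  have c: "continuous_on UNIV (\<lambda>y. A y $ l $ m)" and i: "integrable lborel (\<lambda>y. A y $ l $ m)" for l m
    using assms by (auto simp: cont_integrable_def)
  have "continuous_on UNIV (\<lambda>y. \<chi> l m. A y $ l $ m)" by (intro continuous_on_vec_lambda c)
  then have "continuous_on UNIV A" by simp
  moreover have "continuous_on UNIV (\<lambda>y. entry_norm (A y))" unfolding entry_norm_def by (intro continuous_intros c)
  moreover have "integrable lborel (\<lambda>y. entry_norm (A y))"
    unfolding entry_norm_def by (intro Bochner_Integration.integrable_sum integrable_norm i)
  moreover have "0 \<le> entry_norm (A y)" for y by (simp add: entry_norm_def sum_nonneg)
  ultimately show ?thesis by (simp add: dominated_def weight_def)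
qed

lemma mat2_entries [simp]:
  "mat2 a b c d $ 1 $ 1 = a" "mat2 a b c d $ 1 $ 2 = b" "mat2 a b c d $ 2 $ 1 = c" "mat2 a b c d $ 2 $ 2 = d"
  by (simp_all add: mat2_def)

lemma all_index2: "(\<forall>l::2. P l) \<longleftrightarrow> P 1 \<and> P 2"
  by (metis exhaust_2)

locale potentials =
  fixes u v u' v' :: "real \<Rightarrow> complex"
  assumes u: "decaying_C1 u u'" and v: "decaying_C1 v v'"
begin

lemma cont_integrable_potentials: "cont_integrable u" "cont_integrable v" "cont_integrable u'" "cont_integrable v'"
  using u v by (auto simp: decaying_C1_def cont_integrable_def)

lemma cont_bounded_potentials: "cont_bounded u" "cont_bounded v"
  using u v decaying_C1_bounded[OF u] decaying_C1_bounded[OF v] by (auto simp: decaying_C1_def cont_bounded_def)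

lemmas coefficient_closure = cont_integrable_potentials cont_bounded_potentials cont_bounded_const cont_bounded_add cont_bounded_cnj cont_bounded_mult
  cont_integrable_add cont_integrable_diff cont_integrable_uminus cont_integrable_cnj

lemma Q1_eq: "Q1 u v x = mat2 (\<i> / 4 * (u x * cnj (u x) + v x * cnj (v x))) (- (\<i> / 2) * cnj (v x))
    (v' x + \<i> / 2 * (u x * cnj (u x)) * v x + \<i> / 2 * u x) (- (\<i> / 4 * (u x * cnj (u x) + v x * cnj (v x))))"
proof -
  have "vector_derivative v (at x) = v' x"
    using v by (auto simp: decaying_C1_def intro: vector_derivative_at)
  then show ?thesis unfolding Q1_def of_real_add complex_norm_square by simp
qed

lemma Q2_eq: "Q2 u v x = mat2 (- (\<i> / 2) * (cnj (u x) * v x)) (\<i> / 2 * cnj (u x))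
   (- (\<i> / 2) * (v x + cnj (u x) * (v x)\<^sup>2)) (\<i> / 2 * (cnj (u x) * v x))"
  by (simp add: Q2_def vec_eq_iff all_index2 mat_matrix_mult_component)

lemma Q1_cont_integrable: "cont_integrable (\<lambda>y. Q1 u v y $ l $ m)"
proof -
  have "cont_integrable (\<lambda>y. Q1 u v y $ 1 $ 1)" "cont_integrable (\<lambda>y. Q1 u v y $ 1 $ 2)"
    "cont_integrable (\<lambda>y. Q1 u v y $ 2 $ 1)" "cont_integrable (\<lambda>y. Q1 u v y $ 2 $ 2)"
    unfolding Q1_eq mat2_entries
    by (intro coefficient_closure cont_integrable_mult[of "\<lambda>_. _"] cont_integrable_mult')+
  then show ?thesis using exhaust_2[of l] exhaust_2[of m] by auto
qed

lemma Q2_cont_integrable: "cont_integrable (\<lambda>y. Q2 u v y $ l $ m)"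
proof -
  have "cont_integrable (\<lambda>y. Q2 u v y $ 1 $ 1)" "cont_integrable (\<lambda>y. Q2 u v y $ 1 $ 2)"
    "cont_integrable (\<lambda>y. Q2 u v y $ 2 $ 1)" "cont_integrable (\<lambda>y. Q2 u v y $ 2 $ 2)"
    unfolding Q2_eq mat2_entries power2_eq_square
    by (intro coefficient_closure cont_integrable_mult[of "\<lambda>_. _"] cont_integrable_mult')+
  then show ?thesis using exhaust_2[of l] exhaust_2[of m] by auto
qed

end

definition lax :: "(real \<Rightarrow> complex) \<Rightarrow> (real \<Rightarrow> complex) \<Rightarrow> complex \<Rightarrow> real \<Rightarrow> complex^2^2" where
  "lax u v z y = Q1 u v y + mat (inverse z) ** Q2 u v y"

definition sigma_sign :: "2 \<Rightarrow> complex" where "sigma_sign m = (if m = 1 then 1 else - 1)"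

definition plus_column where
  "plus_column u v z m = volterra_solution (column_rate m (2 * J z * sigma_sign m)) (lax u v z) (axis m 1)"

text \<open>The Jost solutions normalised at \<open>-\<infinity>\<close> become solutions normalised at \<open>+\<infinity>\<close> after the reflection
\<open>x \<mapsto> - x\<close>, which changes the signs of the coefficient and of the rate.\<close>

definition minus_column where
  "minus_column u v z m x =
     volterra_solution (column_rate m (- 2 * J z * sigma_sign m)) (\<lambda>y. - lax u v z (- y)) (axis m 1) (- x)"

text \<open>The integral equation as it occurs in the definition of the Jost solutions: integrability of the integrand is
assumed, and nothing is said about continuity of \<open>w\<close>.\<close>

definition volterra_solves where
  "volterra_solves \<theta> B c w \<longleftrightarrow> bounded (range w) \<and>
     (\<forall>x. set_integrable lborel {x<..} (\<lambda>y. damp \<theta> (y - x) (B y *v w y)) \<and> w x = volterra \<theta> B c w x)"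

text \<open>A bounded solution is automatically continuous, because each component is the tail of a fixed integrable function
times an exponential; then the uniqueness of continuous solutions applies.\<close>

lemma volterra_solves_iff:
  assumes im: "dissipative \<theta>" and dom: "dominated B k"
  shows "volterra_solves \<theta> B c w \<longleftrightarrow> w = volterra_solution \<theta> B c"
proof
  assume w: "w = volterra_solution \<theta> B c"
  show "volterra_solves \<theta> B c w"
    unfolding volterra_solves_def w bounded_iff
    using norm_volterra_solution_le[OF im dom] volterra_integrable[OF im dom bounded_right_volterra_solution[OF im dom]]
      volterra_solution_eq[OF im dom] by blast
next
  assume S: "volterra_solves \<theta> B c w"
  then have bdd: "bounded (range w)" and int: "\<And>x. set_integrable lborel {x<..} (\<lambda>y. damp \<theta> (y - x) (B y *v w y))"
    and eq: "\<And>x. w x = volterra \<theta> B c w x"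
    unfolding volterra_solves_def by blast+
  have "continuous_on {a..} w" for a
  proof -
    have "continuous_on {a..} (\<lambda>x. w x $ l)" for l
    proof -
      define h where "h y = damp \<theta> (y - a) (B y *v w y) $ l" for y
      have hi: "set_integrable lborel {a<..} h"
        using integrable_bounded_linear[OF bounded_linear_vec_nth[of l] int[of a, unfolded set_integrable_def]]
        by (simp add: h_def set_integrable_def)
      have "w x $ l = c $ l - exp (- (\<i> * \<theta> l * of_real (x - a))) * tail h x" for x
      proof -
        have "exp (\<i> * \<theta> l * of_real (y - x)) = exp (- (\<i> * \<theta> l * of_real (x - a))) * exp (\<i> * \<theta> l * of_real (y - a))" for y
          unfolding mult_exp_exp by (rule arg_cong[where f=exp]) (simp add: algebra_simps)
        then have "damp \<theta> (y - x) (B y *v w y) $ l = exp (- (\<i> * \<theta> l * of_real (x - a))) * h y" for y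
          unfolding h_def damp_def by simp
        then show ?thesis
          by (subst eq) (simp add: volterra_def tail_component[OF int], simp add: tail_def)
      qed
      moreover have "continuous_on {a..} (\<lambda>x. c $ l - exp (- (\<i> * \<theta> l * of_real (x - a))) * tail h x)"
        by (intro continuous_intros continuous_on_tail hi)
      ultimately show ?thesis by simp
    qed
    then have "continuous_on {a..} (\<lambda>x. \<chi> l. w x $ l)" by (rule continuous_on_vec_lambda)
    then show ?thesis by simp
  qed
  then have "isCont w x" for x
    using continuous_on_interior[of "{x - 1..}" w x] by (simp add: interior_Ici)
  then have "bounded_right w"
    using bdd by (auto simp: bounded_right_def continuous_at_imp_continuous_on intro: bounded_subset)
  then show "w = volterra_solution \<theta> B c" by (rule volterra_solution_eqI[OF im dom _ eq])
qed

lemma integrable_vec_iff: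
  fixes f :: "'a \<Rightarrow> ('b::euclidean_space)^'n::finite"
  shows "integrable M f \<longleftrightarrow> (\<forall>l. integrable M (\<lambda>x. f x $ l))"
proof
  assume "\<forall>l. integrable M (\<lambda>x. f x $ l)"
  have "integrable M (\<lambda>x. \<Sum>l\<in>UNIV. axis l (f x $ l))"
    by (intro Bochner_Integration.integrable_sum integrable_bounded_linear[OF bounded_linear_axis]) (use \<open>\<forall>l. _\<close> in auto)
  then show "integrable M f" by (simp add: sum_axis_components)
qed (auto intro: integrable_bounded_linear[OF bounded_linear_vec_nth])

lemma integral_vec_component:
  fixes f :: "'a \<Rightarrow> ('b::euclidean_space)^'n::finite"
  assumes "integrable M f" shows "integral\<^sup>L M f $ l = integral\<^sup>L M (\<lambda>x. f x $ l)"
  using integral_bounded_linear[OF bounded_linear_vec_nth assms] by simp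

lemma bounded_vec_iff:
  fixes f :: "'a \<Rightarrow> ('b::real_normed_vector)^'n::finite"
  shows "bounded (range f) \<longleftrightarrow> (\<forall>l. bounded (range (\<lambda>x. f x $ l)))"
proof
  assume "bounded (range f)"
  then obtain a where "\<And>x. norm (f x) \<le> a" unfolding bounded_iff by auto
  then have "norm (f x $ l) \<le> a" for x l
    using order_trans[OF Finite_Cartesian_Product.norm_nth_le] by blast
  then show "\<forall>l. bounded (range (\<lambda>x. f x $ l))" unfolding bounded_iff by auto
next
  assume "\<forall>l. bounded (range (\<lambda>x. f x $ l))"
  then obtain B where B: "\<And>l x. norm (f x $ l) \<le> B l"
    unfolding bounded_iff by (metis rangeI)
  have "norm (f x) \<le> (\<Sum>l\<in>UNIV. B l)" for x
    using L2_set_le_sum[of UNIV "\<lambda>l. norm (f x $ l)"] B sum_mono[of UNIV "\<lambda>l. norm (f x $ l)" B]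
    by (fastforce simp: norm_vec_def)
  then show "bounded (range f)" unfolding bounded_iff by auto
qed

lemma set_integrable_columns:
  fixes f :: "real \<Rightarrow> complex^2^2"
  shows "set_integrable lborel S f \<longleftrightarrow> (\<forall>m. set_integrable lborel S (\<lambda>y. column m (f y)))"
  by (auto simp: set_integrable_def integrable_vec_iff column_def)

lemma bounded_columns:
  fixes f :: "'a \<Rightarrow> complex^2^2"
  shows "bounded (range f) \<longleftrightarrow> (\<forall>m. bounded (range (\<lambda>y. column m (f y))))"
  by (auto simp: bounded_vec_iff column_def)

lemma tail_column:
  fixes f :: "real \<Rightarrow> complex^2^2"
  assumes "set_integrable lborel {x<..} f"
  shows "column m (tail f x) = tail (\<lambda>y. column m (f y)) x"
proof -
  have i: "integrable lborel (\<lambda>y. indicator {x<..} y *\<^sub>R f y)"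
    "integrable lborel (\<lambda>y. indicator {x<..} y *\<^sub>R column m (f y))"
    using assms set_integrable_columns[of "{x<..}" f] by (auto simp: set_integrable_def)
  have il: "integrable lborel (\<lambda>y. (indicator {x<..} y *\<^sub>R f y) $ l)" for l
    using i(1) by (subst (asm) integrable_vec_iff) blast
  show ?thesis
    unfolding tail_def set_lebesgue_integral_def vec_eq_iff
    using integral_vec_component[OF i(2)] integral_vec_component[OF i(1)] integral_vec_component[OF il]
    by (simp add: column_def)
qed

lemma matrix_eq_columns: "(A :: complex^2^2) = B \<longleftrightarrow> (\<forall>m. column m A = column m B)"
  by (auto simp: vec_eq_iff column_def)

lemma exp_sigma3_conj_entry:
  "(exp_sigma3 c ** X ** exp_sigma3 (- c)) $ l $ m = exp (c * (sigma_sign l - sigma_sign m)) * X $ l $ m"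
proof -
  have e: "exp_sigma3 c $ l $ k = (if k = l then exp (c * sigma_sign l) else 0)" for c l k
    using exhaust_2[of l] exhaust_2[of k] by (auto simp: exp_sigma3_def sigma_sign_def)
  have "(exp_sigma3 c ** X ** exp_sigma3 (- c)) $ l $ m = exp (c * sigma_sign l) * X $ l $ m * exp (- c * sigma_sign m)"
    by (simp add: matrix_matrix_mult_def e if_distrib[of "\<lambda>x. x * _"] if_distrib[of "\<lambda>x. _ * x"] cong: if_cong)
  also have "\<dots> = (exp (c * sigma_sign l) * exp (- c * sigma_sign m)) * X $ l $ m" by simp
  also have "exp (c * sigma_sign l) * exp (- c * sigma_sign m) = exp (c * (sigma_sign l - sigma_sign m))"
    unfolding mult_exp_exp by (simp add: algebra_simps)
  finally show ?thesis .
qed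

lemma sigma_sign_diff: "sigma_sign l - sigma_sign m = (if l = m then 0 else - 2 * sigma_sign m)"
  using exhaust_2[of l] exhaust_2[of m] by (auto simp: sigma_sign_def)

text \<open>Conjugation by $e^{c\sigma_3}$ multiplies the entry \<open>(l, m)\<close> by the exponential of \<open>c\<close> times the difference of
the signs of \<open>l\<close> and \<open>m\<close>, so the integral equation separates into its columns.\<close>

lemma jost_integrand_column:
  "column m (jost_integrand u v s n x y) =
     damp (column_rate m (2 * J (of_real s) * sigma_sign m)) (y - x) (lax u v (of_real s) y *v column m (n y))"
  (is "_ = ?r")
proof -
  have "column m (jost_integrand u v s n x y) $ l = ?r $ l" for l
  proof -
    have "exp (\<i> * J (of_real s) * of_real (x - y) * (sigma_sign l - sigma_sign m))
      = exp (\<i> * column_rate m (2 * J (of_real s) * sigma_sign m) l * of_real (y - x))"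
      unfolding sigma_sign_diff column_rate_def by (rule arg_cong[where f=exp]) (simp add: algebra_simps)
    then show ?thesis
      unfolding column_def vec_lambda_beta jost_integrand_def exp_ad_sigma3_def exp_sigma3_conj_entry damp_def lax_def
      by (simp add: matrix_matrix_mult_def matrix_vector_mult_def)
  qed
  then show ?thesis by (simp add: vec_eq_iff)
qed

lemma column_mat_1: "column m (mat 1 :: complex^2^2) = axis m 1"
  by (simp add: column_def mat_def axis_def vec_eq_iff)

lemma is_jost_plus_iff:
  "is_jost \<infinity> u v s n \<longleftrightarrow>
     (\<forall>m. volterra_solves (column_rate m (2 * J (of_real s) * sigma_sign m)) (lax u v (of_real s)) (axis m 1) (\<lambda>x. column m (n x)))"
proof -
  have "(interval_lebesgue_integrable lborel \<infinity> (ereal x) (jost_integrand u v s n x) \<and>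
          n x = mat 1 + (LBINT y=\<infinity>..ereal x. jost_integrand u v s n x y))
     \<longleftrightarrow> (\<forall>m. set_integrable lborel {x<..} (\<lambda>y. column m (jost_integrand u v s n x y)) \<and>
          column m (n x) = axis m 1 - tail (\<lambda>y. column m (jost_integrand u v s n x y)) x)" for x
  proof -
    have i: "interval_lebesgue_integrable lborel \<infinity> (ereal x) (jost_integrand u v s n x)
       \<longleftrightarrow> set_integrable lborel {x<..} (jost_integrand u v s n x)"
      by (simp add: interval_lebesgue_integrable_def)
    have e: "(LBINT y=\<infinity>..ereal x. jost_integrand u v s n x y) = - tail (jost_integrand u v s n x) x"
      by (simp add: interval_lebesgue_integral_def tail_def)
    show ?thesis
      unfolding i e set_integrable_columns[of _ "jost_integrand u v s n x"] matrix_eq_columns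
      using tail_column[of x "jost_integrand u v s n x"] set_integrable_columns[of "{x<..}" "jost_integrand u v s n x"]
      by (auto simp: column_mat_1[symmetric]) (auto simp: column_def vec_eq_iff)
  qed
  then show ?thesis
    unfolding is_jost_def volterra_solves_def volterra_def jost_integrand_column[symmetric] bounded_columns[of n]
    by blast
qed

lemma damp_column_rate_uminus: "damp (column_rate m \<kappa>) (- t) w = damp (column_rate m (- \<kappa>)) t w"
  by (simp add: damp_def column_rate_def vec_eq_iff)

lemma damp_uminus: "damp \<theta> t (- w) = - damp \<theta> t w"
  by (simp add: damp_def vec_eq_iff)

lemma matrix_vector_mult_uminus: "(- A) *v w = - (A *v (w :: complex^'n::finite))"
  by (simp add: matrix_vector_mult_def vec_eq_iff sum_negf)

lemma set_integrable_lessThan_reflect: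
  fixes f :: "real \<Rightarrow> 'a::euclidean_space"
  shows "set_integrable lborel {..<x} f \<longleftrightarrow> set_integrable lborel {- x<..} (\<lambda>y. f (- y))"
proof -
  have "(\<lambda>y. indicator {..<x} (- y) *\<^sub>R f (- y)) = (\<lambda>y. indicator {- x<..} y *\<^sub>R f (- y))"
    by (auto simp: indicator_def fun_eq_iff)
  then show ?thesis
    using lborel_integrable_real_affine_iff[of "-1" "\<lambda>y. indicator {..<x} y *\<^sub>R f y" 0]
    by (simp add: set_integrable_def)
qed

lemma set_integral_lessThan_reflect:
  fixes f :: "real \<Rightarrow> 'a::euclidean_space"
  shows "(LBINT y:{..<x}. f y) = tail (\<lambda>y. f (- y)) (- x)"
proof -
  have "{y. - y \<in> {..<x}} = {- x<..}" by auto
  then show ?thesis using set_integral_reflect[of "{..<x}" f] by (simp add: tail_def)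
qed

lemma is_jost_minus_iff:
  "is_jost (- \<infinity>) u v s n \<longleftrightarrow>
     (\<forall>m. volterra_solves (column_rate m (- 2 * J (of_real s) * sigma_sign m)) (\<lambda>y. - lax u v (of_real s) (- y)) (axis m 1)
            (\<lambda>x. column m (n (- x))))"
proof -
  let ?g = "\<lambda>x y. jost_integrand u v s n (- x) (- y)"
  have g: "damp (column_rate m (- 2 * J (of_real s) * sigma_sign m)) (y - x) (- lax u v (of_real s) (- y) *v column m (n (- y)))
     = - column m (?g x y)" for m x y
    unfolding jost_integrand_column matrix_vector_mult_uminus damp_uminus
    using damp_column_rate_uminus[of m "2 * J (of_real s) * sigma_sign m" "y - x"] by simp
  have "(interval_lebesgue_integrable lborel (-\<infinity>) (ereal (- x)) (jost_integrand u v s n (- x)) \<and>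
          n (- x) = mat 1 + (LBINT y=-\<infinity>..ereal (- x). jost_integrand u v s n (- x) y))
     \<longleftrightarrow> (\<forall>m. set_integrable lborel {x<..} (\<lambda>y. - column m (?g x y)) \<and>
          column m (n (- x)) = axis m 1 - tail (\<lambda>y. - column m (?g x y)) x)" for x
  proof -
    have i: "interval_lebesgue_integrable lborel (-\<infinity>) (ereal (- x)) (jost_integrand u v s n (- x))
       \<longleftrightarrow> set_integrable lborel {x<..} (?g x)"
      using set_integrable_lessThan_reflect[of "- x" "jost_integrand u v s n (- x)"]
      by (simp add: interval_lebesgue_integrable_def)
    have e: "(LBINT y=-\<infinity>..ereal (- x). jost_integrand u v s n (- x) y) = tail (?g x) x"
      using set_integral_lessThan_reflect[of "- x" "jost_integrand u v s n (- x)"]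
      by (simp add: interval_lebesgue_integral_def)
    have t: "tail (\<lambda>y. - column m (?g x y)) x = - tail (\<lambda>y. column m (?g x y)) x" for m
      by (simp add: tail_def set_lebesgue_integral_def)
    have s: "set_integrable lborel {x<..} (\<lambda>y. - column m (?g x y)) \<longleftrightarrow> set_integrable lborel {x<..} (\<lambda>y. column m (?g x y))" for m
      by (simp add: set_integrable_def)
    show ?thesis
      unfolding i e s t set_integrable_columns[of _ "?g x"] matrix_eq_columns
      using tail_column[of x "?g x"] set_integrable_columns[of "{x<..}" "?g x"]
      by (auto simp: column_mat_1[symmetric]) (auto simp: column_def vec_eq_iff)
  qed
  then have *: "(\<forall>x. interval_lebesgue_integrable lborel (-\<infinity>) (ereal (- x)) (jost_integrand u v s n (- x)) \<and>
          n (- x) = mat 1 + (LBINT y=-\<infinity>..ereal (- x). jost_integrand u v s n (- x) y))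
     \<longleftrightarrow> (\<forall>x m. set_integrable lborel {x<..} (\<lambda>y. - column m (?g x y)) \<and>
          column m (n (- x)) = axis m 1 - tail (\<lambda>y. - column m (?g x y)) x)"
    by blast
  have r: "range (\<lambda>x. column m (n (- x))) = range (\<lambda>x. column m (n x))" for m
    unfolding image_def by auto (metis minus_minus)
  have all: "(\<forall>x. P x) \<longleftrightarrow> (\<forall>x::real. P (- x))" for P by (metis minus_minus)
  show ?thesis
    unfolding is_jost_def volterra_solves_def volterra_def g bounded_columns[of n] r
    by (subst all[where P="\<lambda>x. interval_lebesgue_integrable lborel (-\<infinity>) (ereal x) (jost_integrand u v s n x) \<and> n x = _ x"])
       (use * in blast)
qed

lemma damped_ode_reflect:
  assumes "damped_ode \<theta> A w"
  shows "damped_ode (\<lambda>l. - \<theta> l) (\<lambda>y. - A (- y)) (\<lambda>x. w (- x))"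
  unfolding damped_ode_def
proof
  fix x :: real
  have "((w \<circ> uminus) has_vector_derivative (- 1) *\<^sub>R (A (- x) *v w (- x) - (\<chi> l. \<i> * \<theta> l * w (- x) $ l))) (at x)"
    by (rule vector_diff_chain_at)
       (use assms in \<open>auto simp: damped_ode_def has_real_derivative_iff_has_vector_derivative[symmetric] intro!: derivative_eq_intros\<close>)
  moreover have "(- 1) *\<^sub>R (A (- x) *v w (- x) - (\<chi> l. \<i> * \<theta> l * w (- x) $ l))
    = - A (- x) *v w (- x) - (\<chi> l. \<i> * - \<theta> l * w (- x) $ l)"
    by (simp add: matrix_vector_mult_uminus vec_eq_iff)
  ultimately show "((\<lambda>x. w (- x)) has_vector_derivative (- A (- x) *v w (- x) - (\<chi> l. \<i> * - \<theta> l * w (- x) $ l))) (at x)"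
    by (simp only: comp_def)
qed

lemma det_cols2: "det (cols2 a b) = a $ 1 * b $ 2 - b $ 1 * a $ 2"
  by (simp add: det_2 cols2_def)

text \<open>Abel's formula for two columns with different rates: the trace of \<open>L\<close> vanishes, and the rates add up to the same
constant \<open>c\<close> in both products of the determinant.\<close>

lemma wronskian:
  fixes L :: "real \<Rightarrow> complex^2^2"
  assumes p: "damped_ode a L p" and q: "damped_ode b L q"
    and tr: "\<And>x. L x $ 2 $ 2 = - L x $ 1 $ 1" and c: "a 1 + b 2 = c" "b 1 + a 2 = c"
  obtains C where "\<And>x. exp (\<i> * c * of_real x) * det (cols2 (p x) (q x)) = C"
proof -
  have dp: "((\<lambda>x. p x $ l) has_vector_derivative (L x $ l $ 1 * p x $ 1 + L x $ l $ 2 * p x $ 2 - \<i> * a l * p x $ l)) (at x)" for x l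
    using p unfolding damped_ode_def has_vector_derivative_componentwise
    by (simp add: matrix_vector_mult_def sum_2)
  have dq: "((\<lambda>x. q x $ l) has_vector_derivative (L x $ l $ 1 * q x $ 1 + L x $ l $ 2 * q x $ 2 - \<i> * b l * q x $ l)) (at x)" for x l
    using q unfolding damped_ode_def has_vector_derivative_componentwise
    by (simp add: matrix_vector_mult_def sum_2)
  have de: "((\<lambda>x. exp (\<i> * c * of_real x)) has_vector_derivative \<i> * c * exp (\<i> * c * of_real x)) (at x)" for x
    by (rule has_vector_derivative_real_field[where f="\<lambda>z. exp (\<i> * c * z)"]) (auto intro!: derivative_eq_intros)
  have "((\<lambda>x. exp (\<i> * c * of_real x) * det (cols2 (p x) (q x))) has_vector_derivative 0) (at x within UNIV)" for x
  proof -
    note d = has_vector_derivative_mult[OF de has_vector_derivative_diff[OF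
        has_vector_derivative_mult[OF dp[of 1] dq[of 2]] has_vector_derivative_mult[OF dq[of 1] dp[of 2]]], of x]
    have b: "b 2 = c - a 1" "b 1 = c - a 2" using c by (auto simp: algebra_simps)
    show ?thesis
      unfolding det_cols2 by (rule has_vector_derivative_eq_rhs[OF d]) (simp add: tr b algebra_simps)
  qed
  then obtain C where "\<And>x. exp (\<i> * c * of_real x) * det (cols2 (p x) (q x)) = C"
    using has_vector_derivative_zero_constant[of UNIV "\<lambda>x. exp (\<i> * c * of_real x) * det (cols2 (p x) (q x))"] by auto
  then show ?thesis by (rule that)
qed

lemma Im_J_nonneg: "0 \<le> Im z \<Longrightarrow> 0 \<le> Im (J z)"
  by (simp add: J_def divide_nonneg_nonneg)

lemma Im_J_of_real: "Im (J (of_real s)) = 0"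
  by (simp add: J_def)

text \<open>The domain of the analytic continuations, punctured at \<open>0\<close>, where the coefficient $\lambda^{-1}\widetilde Q_2$ is singular.\<close>

definition closed_upper :: "complex set" where
  "closed_upper = upper_half_plane \<union> (\<real> - {0})"

lemma closed_upper_iff: "z \<in> closed_upper \<longleftrightarrow> 0 \<le> Im z \<and> z \<noteq> 0"
  by (auto simp: closed_upper_def upper_half_plane_def complex_is_Real_iff)

lemma holomorphic_on_paste_real_line:
  assumes S: "open S"
    and f: "f holomorphic_on S \<inter> {z. Im z < 0}" "continuous_on (S \<inter> {z. Im z \<le> 0}) f"
    and g: "g holomorphic_on S \<inter> {z. 0 < Im z}" "continuous_on (S \<inter> {z. 0 \<le> Im z}) g"
    and eq: "\<And>z. z \<in> S \<Longrightarrow> Im z = 0 \<Longrightarrow> f z = g z"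
  shows "(\<lambda>z. if Im z \<le> 0 then f z else g z) holomorphic_on S"
proof (rule holomorphic_on_paste_across_line[OF S, of "\<i>" _ 0])
  have ii: "\<i> \<bullet> w = Im w" for w by (simp add: inner_complex_def)
  show "(\<lambda>z. if Im z \<le> 0 then f z else g z) holomorphic_on S \<inter> {z. \<i> \<bullet> z < 0}"
    by (rule holomorphic_transform[OF f(1)[folded ii]]) (auto simp: ii)
  show "(\<lambda>z. if Im z \<le> 0 then f z else g z) holomorphic_on S \<inter> {z. 0 < \<i> \<bullet> z}"
    by (rule holomorphic_transform[OF g(1)[folded ii]]) (auto simp: ii)
  show "continuous_on S (\<lambda>z. if Im z \<le> 0 then f z else g z)"
    by (rule continuous_on_cases_le)
       (use f(2) g(2) eq in \<open>auto simp: Collect_conj_eq intro!: continuous_intros\<close>)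
qed simp

text \<open>The difference of two extensions vanishes on the punctured real line, so extending it by zero to the lower half-plane
gives a function holomorphic on a connected set and zero on an open part of it.\<close>

lemma upper_extension_eq:
  assumes F: "is_upper_extension f F" and z: "z \<in> closed_upper"
  shows "upper_extension f z = F z"
proof -
  have G: "is_upper_extension f (upper_extension f)"
    unfolding upper_extension_def by (rule someI[of "is_upper_extension f" F]) (rule F)
  show ?thesis
  proof (cases "z \<in> upper_half_plane")
    case False
    then obtain s where "z = of_real s" "s \<noteq> 0" using z by (auto simp: closed_upper_def elim: Reals_cases)
    then show ?thesis using F G by (simp add: is_upper_extension_def)
  next
    case True
    have "upper_extension f z $ i = F z $ i" for i
    proof -
      define d where "d z = upper_extension f z $ i - F z $ i" for z
      have hd: "d holomorphic_on upper_half_plane"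
        unfolding d_def using F G by (intro holomorphic_intros) (auto simp: is_upper_extension_def)
      have cd: "continuous_on closed_upper d"
        unfolding d_def using F G by (intro continuous_intros) (auto simp: is_upper_extension_def closed_upper_def)
      have d0: "d (of_real s) = 0" if "s \<noteq> 0" for s
        using that F G by (simp add: d_def is_upper_extension_def)
      define h where "h = (\<lambda>w. if Im w \<le> 0 then 0 else d w)"
      have hh: "h holomorphic_on - {0}"
        unfolding h_def
      proof (rule holomorphic_on_paste_real_line)
        show "d holomorphic_on - {0} \<inter> {z. 0 < Im z}"
          by (rule holomorphic_on_subset[OF hd]) (auto simp: upper_half_plane_def)
        show "continuous_on (- {0} \<inter> {z. 0 \<le> Im z}) d"
          by (rule continuous_on_subset[OF cd]) (auto simp: closed_upper_iff)
        show "0 = d w" if "w \<in> - {0}" "Im w = 0" for w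
        proof -
          have "w = of_real (Re w)" using that by (simp add: complex_eq_iff)
          moreover have "Re w \<noteq> 0" using that by (auto simp: complex_eq_iff)
          ultimately show ?thesis using d0 by metis
        qed
      qed auto
      have "h z = 0"
      proof (rule analytic_continuation[OF hh, where U=lower_half_plane and \<xi>="- \<i>"])
        have op: "open lower_half_plane" unfolding lower_half_plane_def by (rule open_halfspace_Im_lt)
        show "connected (- {0} :: complex set)" by (rule connected_punctured_universe) simp
        show "- \<i> islimpt lower_half_plane"
          by (rule interior_limit_point) (simp add: interior_open[OF op], simp add: lower_half_plane_def)
        show "h w = 0" if "w \<in> lower_half_plane" for w using that by (simp add: h_def lower_half_plane_def)
      qed (use True in \<open>auto simp: lower_half_plane_def upper_half_plane_def\<close>)
      then show ?thesis using True by (simp add: h_def upper_half_plane_def d_def)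
    qed
    then show ?thesis by (simp add: vec_eq_iff)
  qed
qed

text \<open>The weight that dominates the coefficient is uniform only where \<open>norm z\<close> is bounded below. Both properties are
local, so it suffices to treat each region \<open>\<delta> < norm z\<close>.\<close>

lemma column_parameter:
  fixes A B :: "real \<Rightarrow> complex^2^2" and i :: 2 and W :: "complex \<Rightarrow> real \<Rightarrow> complex^2"
  assumes A: "dominated A k" and B: "dominated B k'"
  defines "W \<equiv> \<lambda>z x. volterra_solution (column_rate i (2 * J z)) (\<lambda>y. A y + mat (inverse z) ** B y) (axis i 1) x"
  shows "(\<lambda>z. W z x $ l) holomorphic_on upper_half_plane" and "continuous_on closed_upper (\<lambda>z. W z x)"
proof -
  define \<Lambda> where "\<Lambda> \<delta> = {z. 0 \<le> Im z \<and> \<delta> < norm z}" for \<delta> :: real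
  define U where "U \<delta> = {z. 0 < Im z} \<inter> {z. \<delta> < norm z}" for \<delta> :: real
  have diss: "dissipative (column_rate i (2 * J z))" if "z \<in> \<Lambda> \<delta>" for z \<delta>
    using that Im_J_nonneg[of z] by (intro dissipative_column_rate) (auto simp: \<Lambda>_def)
  have dom: "dominated (\<lambda>y. A y + mat (inverse z) ** B y) (\<lambda>y. k y + inverse \<delta> * k' y)"
    if "z \<in> \<Lambda> \<delta>" "0 < \<delta>" for z \<delta>
    by (rule dominated_add_scaled[OF A B]) (use that in \<open>auto simp: \<Lambda>_def norm_inverse le_imp_inverse_le\<close>)
  have entry: "(\<lambda>z. (A y + mat (inverse z) ** B y) $ a $ b) = (\<lambda>z. A y $ a $ b + inverse z * B y $ a $ b)" for y a b
    by (simp add: mat_matrix_mult_component)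
  have "(\<lambda>z. W z x $ l) holomorphic_on U \<delta>" if \<delta>: "\<delta> \<in> {0<..}" for \<delta>
    unfolding W_def
  proof (rule holomorphic_on_volterra_solution_parameter[where \<Lambda>="\<Lambda> \<delta>" and k="\<lambda>y. k y + inverse \<delta> * k' y"])
    show "open (U \<delta>)"
      unfolding U_def by (intro open_Int open_halfspace_Im_gt open_Collect_less continuous_intros)
    show "U \<delta> \<subseteq> \<Lambda> \<delta>" by (auto simp: U_def \<Lambda>_def)
    have nz: "z \<noteq> 0" if "z \<in> U \<delta>" for z using that by (auto simp: U_def)
    show "(\<lambda>z. column_rate i (2 * J z) m) holomorphic_on U \<delta>" for m
      unfolding column_rate_def J_def using nz by (cases "m = i") (auto intro!: holomorphic_intros)
    show "(\<lambda>z. (A y + mat (inverse z) ** B y) $ a $ b) holomorphic_on U \<delta>" for y a b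
      unfolding entry using nz by (auto intro!: holomorphic_intros)
  qed (use diss dom \<delta> in auto)
  then have "(\<lambda>z. W z x $ l) holomorphic_on (\<Union>\<delta>\<in>{0<..}. U \<delta>)"
    by (rule holomorphic_on_UN_open)
       (auto simp: U_def intro!: open_Int open_halfspace_Im_gt open_Collect_less continuous_intros)
  moreover have "upper_half_plane \<subseteq> (\<Union>\<delta>\<in>{0<..}. U \<delta>)"
  proof
    fix z assume z: "z \<in> upper_half_plane"
    then have "z \<noteq> 0" by (auto simp: upper_half_plane_def)
    then show "z \<in> (\<Union>\<delta>\<in>{0<..}. U \<delta>)"
      using z by (auto simp: U_def upper_half_plane_def intro!: bexI[of _ "norm z / 2"])
  qed
  ultimately show "(\<lambda>z. W z x $ l) holomorphic_on upper_half_plane" by (rule holomorphic_on_subset)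
  have c: "continuous_on (\<Lambda> \<delta>) (\<lambda>z. W z x)" if \<delta>: "0 < \<delta>" for \<delta>
    unfolding W_def
  proof (rule continuous_on_volterra_solution_parameter[where k="\<lambda>y. k y + inverse \<delta> * k' y"])
    have nz: "z \<noteq> 0" if "z \<in> \<Lambda> \<delta>" for z using that \<delta> by (auto simp: \<Lambda>_def)
    show "continuous_on (\<Lambda> \<delta>) (\<lambda>z. column_rate i (2 * J z) m)" for m
      unfolding column_rate_def J_def using nz by (cases "m = i") (auto intro!: continuous_intros)
    have "continuous_on (\<Lambda> \<delta>) (\<lambda>z. \<chi> a b. A y $ a $ b + inverse z * B y $ a $ b)" for y
      using nz by (intro continuous_intros) auto
    moreover have "(\<lambda>z. \<chi> a b. A y $ a $ b + inverse z * B y $ a $ b) = (\<lambda>z. A y + mat (inverse z) ** B y)" for y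
      by (simp add: fun_eq_iff vec_eq_iff mat_matrix_mult_component)
    ultimately show "continuous_on (\<Lambda> \<delta>) (\<lambda>z. A y + mat (inverse z) ** B y)" for y by metis
  qed (use diss dom \<delta> in auto)
  show "continuous_on closed_upper (\<lambda>z. W z x)"
    unfolding continuous_on_eq_continuous_within
  proof
    fix a assume a: "a \<in> closed_upper"
    then have na: "0 < norm a / 2" "a \<in> \<Lambda> (norm a / 2)" by (auto simp: closed_upper_iff \<Lambda>_def)
    have "at a within closed_upper = at a within \<Lambda> (norm a / 2)"
    proof (rule at_within_nhd[of a "{z. norm a / 2 < norm z}"])
      show "open {z :: complex. norm a / 2 < norm z}" by (intro open_Collect_less continuous_intros)
    qed (use na in \<open>auto simp: \<Lambda>_def closed_upper_iff\<close>)
    then show "continuous (at a within closed_upper) (\<lambda>z. W z x)"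
      using c[OF na(1)] na(2) by (simp add: continuous_on_eq_continuous_within continuous_within)
  qed
qed

section \<open>Scattering data\<close>

lemma column_rate_uminus: "column_rate m (- \<kappa>) = (\<lambda>l. - column_rate m \<kappa> l)"
  by (auto simp: column_rate_def)

lemma sigma_sign_simps [simp]: "sigma_sign 1 = 1" "sigma_sign 2 = - 1"
  by (simp_all add: sigma_sign_def)

text \<open>The conjugation symmetry of the spectral problem: if \<open>w\<close> solves it at the conjugate of \<open>z\<close>, its image solves it
at \<open>z\<close>, with the two Jost columns exchanged. It is the symmetry $\phi\mapsto\epsilon\bar\phi$, with $\epsilon$ a
rotation by a right angle, of the original system, transported by the triangular change of
variables $\phi\mapsto(\phi_1,\,v\phi_1+\zeta\phi_2)$ with $\zeta^2=z$ and rescaled by \<open>\<zeta>\<close>; the parameter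
\<open>q\<close> stands for \<open>v x\<close>.\<close>

definition conj_swap :: "complex \<Rightarrow> complex \<Rightarrow> complex^2 \<Rightarrow> complex^2" where
  "conj_swap q z w = (\<chi> l. if l = 1 then cnj q * cnj (w $ 1) - cnj (w $ 2)
      else z * cnj (w $ 1) - q * (cnj (w $ 2) - cnj q * cnj (w $ 1)))"

lemma conj_swap_entries [simp]:
  "conj_swap q z w $ 1 = cnj q * cnj (w $ 1) - cnj (w $ 2)"
  "conj_swap q z w $ 2 = z * cnj (w $ 1) - q * (cnj (w $ 2) - cnj q * cnj (w $ 1))"
  by (simp_all add: conj_swap_def)

context potentials
begin

definition Q1_reflected :: "real \<Rightarrow> complex^2^2" where "Q1_reflected y = - Q1 u v (- y)"
definition Q2_reflected :: "real \<Rightarrow> complex^2^2" where "Q2_reflected y = - Q2 u v (- y)"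

lemma dominated_Q:
  "dominated (Q1 u v) (\<lambda>y. entry_norm (Q1 u v y))" "dominated (Q2 u v) (\<lambda>y. entry_norm (Q2 u v y))"
  "dominated Q1_reflected (\<lambda>y. entry_norm (Q1_reflected y))" "dominated Q2_reflected (\<lambda>y. entry_norm (Q2_reflected y))"
proof -
  show "dominated (Q1 u v) (\<lambda>y. entry_norm (Q1 u v y))" "dominated (Q2 u v) (\<lambda>y. entry_norm (Q2 u v y))"
    by (intro dominated_entries Q1_cont_integrable Q2_cont_integrable)+
  show "dominated Q1_reflected (\<lambda>y. entry_norm (Q1_reflected y))" "dominated Q2_reflected (\<lambda>y. entry_norm (Q2_reflected y))"
    by (intro dominated_entries;
        simp add: Q1_reflected_def Q2_reflected_def cont_integrable_uminus cont_integrable_reflect[OF Q1_cont_integrable]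
          cont_integrable_reflect[OF Q2_cont_integrable])+
qed

lemma lax_alt: "lax u v z = (\<lambda>y. Q1 u v y + mat (inverse z) ** Q2 u v y)"
  by (simp add: lax_def fun_eq_iff)

lemma lax_reflect: "(\<lambda>y. - lax u v z (- y)) = (\<lambda>y. Q1_reflected y + mat (inverse z) ** Q2_reflected y)"
  by (simp add: lax_def fun_eq_iff vec_eq_iff mat_matrix_mult_component Q1_reflected_def Q2_reflected_def)

lemma dominated_lax:
  obtains k where "dominated (lax u v z) k"
  using dominated_add_scaled[OF dominated_Q(1,2) order_refl] unfolding lax_alt by blast

lemma dominated_lax_reflect:
  obtains k where "dominated (\<lambda>y. - lax u v z (- y)) k"
  using dominated_add_scaled[OF dominated_Q(3,4) order_refl] unfolding lax_reflect by blast

lemma lax_entries: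
  "lax u v z y $ 1 $ 1 = \<i> / 4 * (u y * cnj (u y) + v y * cnj (v y)) - \<i> / 2 * inverse z * (cnj (u y) * v y)"
  "lax u v z y $ 1 $ 2 = - (\<i> / 2) * cnj (v y) + \<i> / 2 * inverse z * cnj (u y)"
  "lax u v z y $ 2 $ 1 = v' y + \<i> / 2 * (u y * cnj (u y)) * v y + \<i> / 2 * u y - \<i> / 2 * inverse z * (v y + cnj (u y) * (v y)\<^sup>2)"
  "lax u v z y $ 2 $ 2 = - (lax u v z y $ 1 $ 1)"
  by (simp_all add: lax_def mat_matrix_mult_component Q1_eq Q2_eq)

lemma plus_column_ode:
  assumes "0 \<le> Im (2 * J z * sigma_sign m)"
  shows "damped_ode (column_rate m (2 * J z * sigma_sign m)) (lax u v z) (plus_column u v z m)"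
    and "(plus_column u v z m \<longlongrightarrow> axis m 1) at_top"
proof -
  obtain k where k: "dominated (lax u v z) k" by (rule dominated_lax)
  note d = dissipative_column_rate[OF assms, of m]
  show "damped_ode (column_rate m (2 * J z * sigma_sign m)) (lax u v z) (plus_column u v z m)"
    unfolding plus_column_def by (rule damped_ode_volterra_solution[OF d k column_rate_axis])
  show "(plus_column u v z m \<longlongrightarrow> axis m 1) at_top"
    unfolding plus_column_def by (rule volterra_solution_tendsto[OF d k])
qed

lemma minus_column_ode:
  assumes "0 \<le> Im (- 2 * J z * sigma_sign m)"
  shows "damped_ode (column_rate m (2 * J z * sigma_sign m)) (lax u v z) (minus_column u v z m)"
    and "(minus_column u v z m \<longlongrightarrow> axis m 1) at_bot"
proof -
  obtain k where k: "dominated (\<lambda>y. - lax u v z (- y)) k" by (rule dominated_lax_reflect)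
  note d = dissipative_column_rate[OF assms, of m]
  let ?w = "volterra_solution (column_rate m (- 2 * J z * sigma_sign m)) (\<lambda>y. - lax u v z (- y)) (axis m 1)"
  have "damped_ode (column_rate m (- 2 * J z * sigma_sign m)) (\<lambda>y. - lax u v z (- y)) ?w"
    by (rule damped_ode_volterra_solution[OF d k column_rate_axis])
  from damped_ode_reflect[OF this]
  show "damped_ode (column_rate m (2 * J z * sigma_sign m)) (lax u v z) (minus_column u v z m)"
    using column_rate_uminus[of m "2 * J z * sigma_sign m"] by (simp add: minus_column_def[abs_def])
  have "(?w \<longlongrightarrow> axis m 1) at_top" by (rule volterra_solution_tendsto[OF d k])
  then show "(minus_column u v z m \<longlongrightarrow> axis m 1) at_bot"
    by (simp add: filterlim_at_bot_mirror minus_column_def)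
qed

lemma Im_real_rate: "0 \<le> Im (2 * J (of_real s) * sigma_sign m)" "0 \<le> Im (- 2 * J (of_real s) * sigma_sign m)"
  by (simp_all add: sigma_sign_def Im_J_of_real)

lemma jost_plus_column: "column m (jost \<infinity> u v s x) = plus_column u v (of_real s) m x"
proof -
  obtain k where k: "dominated (lax u v (of_real s)) k" by (rule dominated_lax)
  have iff: "is_jost \<infinity> u v s n \<longleftrightarrow> (\<forall>m. (\<lambda>x. column m (n x)) = plus_column u v (of_real s) m)" for n
    unfolding is_jost_plus_iff plus_column_def
    by (simp add: volterra_solves_iff[OF dissipative_column_rate[OF Im_real_rate(1)] k])
  define n where "n = (\<lambda>x. \<chi> l m. plus_column u v (of_real s) m x $ l)"
  have "jost \<infinity> u v s = n"
    unfolding jost_def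
  proof (rule the_equality)
    show "is_jost \<infinity> u v s n" unfolding iff by (simp add: n_def column_def vec_eq_iff fun_eq_iff)
    show "n' = n" if "is_jost \<infinity> u v s n'" for n'
      using that unfolding iff fun_eq_iff by (simp add: n_def column_def vec_eq_iff)
  qed
  then show ?thesis by (simp add: n_def column_def vec_eq_iff)
qed

lemma jost_minus_column: "column m (jost (- \<infinity>) u v s x) = minus_column u v (of_real s) m x"
proof -
  obtain k where k: "dominated (\<lambda>y. - lax u v (of_real s) (- y)) k" by (rule dominated_lax_reflect)
  have iff: "is_jost (- \<infinity>) u v s n \<longleftrightarrow> (\<forall>m x. column m (n (- x)) = minus_column u v (of_real s) m (- x))" for n
    unfolding is_jost_minus_iff minus_column_def
    using volterra_solves_iff[OF dissipative_column_rate[OF Im_real_rate(2)[of s]] k] by (simp add: fun_eq_iff)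
  define n where "n = (\<lambda>x. \<chi> l m. minus_column u v (of_real s) m x $ l)"
  have "jost (- \<infinity>) u v s = n"
    unfolding jost_def
  proof (rule the_equality)
    show "is_jost (- \<infinity>) u v s n" unfolding iff by (simp add: n_def column_def vec_eq_iff)
    show "n' = n" if "is_jost (- \<infinity>) u v s n'" for n'
    proof
      fix x show "n' x = n x"
        using that[unfolded iff, rule_format, of _ "- x"] by (simp add: n_def column_def vec_eq_iff)
    qed
  qed
  then show ?thesis by (simp add: n_def column_def vec_eq_iff)
qed

lemma plus_column_analytic:
  "(\<lambda>z. plus_column u v z 1 x $ l) holomorphic_on upper_half_plane"
  "continuous_on closed_upper (\<lambda>z. plus_column u v z 1 x)"
  using column_parameter[OF dominated_Q(1,2), of 1 x] by (simp_all add: plus_column_def lax_alt)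

lemma minus_column_analytic:
  "(\<lambda>z. minus_column u v z 2 x $ l) holomorphic_on upper_half_plane"
  "continuous_on closed_upper (\<lambda>z. minus_column u v z 2 x)"
  using column_parameter[OF dominated_Q(3,4), of 2 "- x"] by (simp_all add: minus_column_def lax_reflect)

lemma n1_plus_eq: "z \<in> closed_upper \<Longrightarrow> n1_plus u v x z = plus_column u v z 1 x"
  unfolding n1_plus_def
  by (rule upper_extension_eq)
     (use plus_column_analytic in \<open>auto simp: is_upper_extension_def jost_plus_column closed_upper_def\<close>)

lemma n2_minus_eq: "z \<in> closed_upper \<Longrightarrow> n2_minus u v x z = minus_column u v z 2 x"
  unfolding n2_minus_def
  by (rule upper_extension_eq)
     (use minus_column_analytic in \<open>auto simp: is_upper_extension_def jost_minus_column closed_upper_def\<close>)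

lemma the_const: "(\<And>x y. f x = f y) \<Longrightarrow> (THE a. \<forall>x. a = f x) = f (x::real)"
  by (rule the_equality) auto

text \<open>The rates of the two columns cancel in the Wronskian, so the determinant does not depend on \<open>x\<close> and
the definite description in the definition picks its value.\<close>

lemma alpha_eq:
  assumes z: "z \<in> closed_upper"
  shows "alpha u v z = det (cols2 (n1_plus u v x z) (n2_minus u v x z))"
proof -
  have im: "0 \<le> Im (J z)" using z by (simp add: closed_upper_iff Im_J_nonneg)
  have p: "damped_ode (column_rate 1 (2 * J z)) (lax u v z) (plus_column u v z 1)"
    using plus_column_ode(1)[of z 1] im by simp
  have q: "damped_ode (column_rate 2 (- 2 * J z)) (lax u v z) (minus_column u v z 2)"
    using minus_column_ode(1)[of z 2] im by simp
  obtain C where C: "\<And>x. exp (\<i> * 0 * of_real x) * det (cols2 (plus_column u v z 1 x) (minus_column u v z 2 x)) = C"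
    by (rule wronskian[OF p q lax_entries(4), of 0]) (auto simp: column_rate_def)
  have "alpha0 u v z = det (cols2 (n1_plus u v x z) (n2_minus u v x z))"
    unfolding alpha0_def
    by (rule the_const) (use C in \<open>simp add: n1_plus_eq[OF z] n2_minus_eq[OF z]\<close>)
  then show ?thesis using z by (simp add: alpha_def closed_upper_iff)
qed

lemma beta_eq:
  assumes s: "s \<noteq> 0"
  shows "beta u v s = exp (- 2 * \<i> * J (of_real s) * of_real x) *
    det (cols2 (plus_column u v (of_real s) 2 x) (minus_column u v (of_real s) 2 x))"
proof -
  let ?z = "of_real s :: complex"
  have p: "damped_ode (column_rate 2 (- 2 * J ?z)) (lax u v ?z) (plus_column u v ?z 2)"
    using plus_column_ode(1)[OF Im_real_rate(1)[where s=s and m=2]] by simp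
  have q: "damped_ode (column_rate 2 (- 2 * J ?z)) (lax u v ?z) (minus_column u v ?z 2)"
    using minus_column_ode(1)[OF Im_real_rate(2)[where s=s and m=2]] by simp
  obtain C where C: "\<And>x. exp (\<i> * (- 2 * J ?z) * of_real x) * det (cols2 (plus_column u v ?z 2 x) (minus_column u v ?z 2 x)) = C"
    by (rule wronskian[OF p q lax_entries(4), of "- 2 * J ?z"]) (auto simp: column_rate_def)
  have e: "- 2 * \<i> * J ?z * of_real x = \<i> * (- 2 * J ?z) * of_real x" for x by simp
  have "beta0 u v s = exp (- 2 * \<i> * J ?z * of_real x) * det (cols2 (plus_column u v ?z 2 x) (minus_column u v ?z 2 x))"
    unfolding beta0_def jost_plus_column jost_minus_column
    by (rule the_const) (use C in \<open>simp only: e\<close>)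
  then show ?thesis using s by (simp add: beta_def)
qed

lemma plus_columns_det: "det (cols2 (plus_column u v (of_real s) 1 x) (plus_column u v (of_real s) 2 x)) = 1"
proof -
  let ?z = "of_real s :: complex"
  have p: "damped_ode (column_rate 1 (2 * J ?z)) (lax u v ?z) (plus_column u v ?z 1)"
    using plus_column_ode(1)[OF Im_real_rate(1)[where s=s and m=1]] by simp
  have q: "damped_ode (column_rate 2 (- 2 * J ?z)) (lax u v ?z) (plus_column u v ?z 2)"
    using plus_column_ode(1)[OF Im_real_rate(1)[where s=s and m=2]] by simp
  obtain C where C: "\<And>x. exp (\<i> * 0 * of_real x) * det (cols2 (plus_column u v ?z 1 x) (plus_column u v ?z 2 x)) = C"
    by (rule wronskian[OF p q lax_entries(4), of 0]) (auto simp: column_rate_def)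
  have l: "((\<lambda>x. plus_column u v ?z m x $ l) \<longlongrightarrow> axis m 1 $ l) at_top" for m l :: 2
    by (rule tendsto_vec_nth[OF plus_column_ode(2)[OF Im_real_rate(1)]])
  have "((\<lambda>x. det (cols2 (plus_column u v ?z 1 x) (plus_column u v ?z 2 x))) \<longlongrightarrow>
     axis (1::2) 1 $ 1 * axis (2::2) 1 $ 2 - axis (2::2) 1 $ 1 * axis (1::2) 1 $ 2) at_top"
    unfolding det_cols2 by (intro tendsto_intros l)
  then have "((\<lambda>x::real. C) \<longlongrightarrow> 1) at_top" using C by (simp add: axis_def)
  then have "C = 1" by (simp add: tendsto_const_iff)
  then show ?thesis using C by simp
qed

text \<open>The right-hand side satisfies the differential equation of the second column, and since \<open>v\<close> vanishes at infinity it
has the right limit there; uniqueness does the rest.\<close>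

lemma plus_column_symmetry:
  assumes s: "s \<noteq> 0"
  shows "plus_column u v (of_real s) 2 x = (\<chi> l. conj_swap (v x) (of_real s) (plus_column u v (of_real s) 1 x) $ l / of_real s)"
proof -
  let ?z = "of_real s :: complex"
  define f where "f = plus_column u v ?z 1"
  define h where "h x = (\<chi> l. conj_swap (v x) ?z (f x) $ l / ?z)" for x
  obtain k where k: "dominated (lax u v ?z) k" by (rule dominated_lax)
  have dv: "(v has_vector_derivative v' x) (at x)" for x using v by (simp add: decaying_C1_def)
  have "damped_ode (column_rate 1 (2 * J ?z)) (lax u v ?z) f"
    using plus_column_ode(1)[OF Im_real_rate(1)[where s=s and m=1]] by (simp add: f_def)
  then have df: "((\<lambda>x. f x $ l) has_vector_derivative (lax u v ?z x $ l $ 1 * f x $ 1 + lax u v ?z x $ l $ 2 * f x $ 2 - \<i> * column_rate 1 (2 * J ?z) l * f x $ l)) (at x)" for x l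
    unfolding damped_ode_def has_vector_derivative_componentwise
    by (simp add: matrix_vector_mult_def sum_2)
  have Jc: "cnj (J ?z) = J ?z" by (simp add: J_def)
  have t: "inverse ?z * ?z = 1" and J4: "4 * J ?z = ?z - inverse ?z" using s by (auto simp: J_def)
  have ode: "damped_ode (column_rate 2 (- 2 * J ?z)) (lax u v ?z) h"
    unfolding damped_ode_def has_vector_derivative_componentwise
  proof (intro allI)
    fix x and l :: 2
    have dc: "((\<lambda>x. cnj (f x $ l)) has_vector_derivative cnj (lax u v ?z x $ l $ 1 * f x $ 1 + lax u v ?z x $ l $ 2 * f x $ 2 - \<i> * column_rate 1 (2 * J ?z) l * f x $ l)) (at x)" for l
      by (rule has_vector_derivative_cnj[OF df])
    have dvc: "((\<lambda>x. cnj (v x)) has_vector_derivative cnj (v' x)) (at x)"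
      by (rule has_vector_derivative_cnj[OF dv])
    note d1 = has_vector_derivative_divide[OF has_vector_derivative_diff[OF has_vector_derivative_mult[OF dvc dc[of 1]] dc[of 2]], of ?z]
    note d2 = has_vector_derivative_divide[OF has_vector_derivative_diff[OF has_vector_derivative_mult[OF has_vector_derivative_const[of ?z] dc[of 1]]
         has_vector_derivative_mult[OF dv has_vector_derivative_diff[OF dc[of 2] has_vector_derivative_mult[OF dvc dc[of 1]]]]], of ?z]
    have r: "column_rate 1 q 1 = 0" "column_rate 1 q 2 = q" "column_rate 2 q 1 = q" "column_rate 2 q 2 = 0" for q
      by (simp_all add: column_rate_def)
    consider "l = 1" | "l = 2" using exhaust_2 by blast
    then show "((\<lambda>x. h x $ l) has_vector_derivative (lax u v ?z x *v h x - (\<chi> l. \<i> * column_rate 2 (- 2 * J ?z) l * h x $ l)) $ l) (at x)"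
    proof cases
      case 1
      show ?thesis
        unfolding 1 h_def vec_lambda_beta conj_swap_entries
        by (rule has_vector_derivative_eq_rhs[OF d1])
           (use s in \<open>simp add: r matrix_vector_mult_def sum_2 lax_entries J_def field_simps power2_eq_square\<close>)
    next
      case 2
      show ?thesis
        unfolding 2 h_def vec_lambda_beta conj_swap_entries
        by (rule has_vector_derivative_eq_rhs[OF d2])
           (use s in \<open>simp add: r matrix_vector_mult_def sum_2 lax_entries J_def field_simps power2_eq_square\<close>)
    qed
  qed
  have lim: "(h \<longlongrightarrow> axis 2 1) at_top"
  proof (rule vec_tendstoI)
    fix l :: 2
    have f1: "((\<lambda>x. f x $ 1) \<longlongrightarrow> 1) at_top" "((\<lambda>x. f x $ 2) \<longlongrightarrow> 0) at_top"
      using tendsto_vec_nth[OF plus_column_ode(2)[OF Im_real_rate(1)[where s=s and m=1]], of 1]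
        tendsto_vec_nth[OF plus_column_ode(2)[OF Im_real_rate(1)[where s=s and m=1]], of 2]
      by (simp_all add: f_def axis_def)
    have v0: "(v \<longlongrightarrow> 0) at_top" by (rule decaying_C1_at_top[OF v])
    have "((\<lambda>x. h x $ 1) \<longlongrightarrow> (cnj 0 * cnj 1 - cnj 0) / ?z) at_top"
      unfolding h_def vec_lambda_beta conj_swap_entries using s by (intro tendsto_intros f1 v0) simp
    moreover have "((\<lambda>x. h x $ 2) \<longlongrightarrow> (?z * cnj 1 - 0 * (cnj 0 - cnj 0 * cnj 1)) / ?z) at_top"
      unfolding h_def vec_lambda_beta conj_swap_entries using s by (intro tendsto_intros f1 v0) simp
    ultimately show "((\<lambda>x. h x $ l) \<longlongrightarrow> axis 2 1 $ l) at_top"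
      using s exhaust_2[of l] by (auto simp: axis_def)
  qed
  have "0 \<le> Im (- 2 * J ?z)" by (simp add: Im_J_of_real)
  from damped_ode_unique[OF dissipative_column_rate[OF this] k column_rate_axis ode lim]
  have "h = plus_column u v ?z 2" by (simp add: plus_column_def)
  then show ?thesis by (simp add: h_def f_def fun_eq_iff)
qed

end

section \<open>Limits of the Jost columns at infinity and at zero\<close>

definition upper_infinity :: "complex filter" where
  "upper_infinity = inf at_infinity (principal upper_half_plane)"

definition upper_zero :: "complex filter" where
  "upper_zero = at 0 within upper_half_plane"

lemma J_at_infinity: "filterlim (\<lambda>z. norm (2 * J z)) at_top upper_infinity"
proof -
  have id: "filterlim (\<lambda>z::complex. z) at_infinity at_infinity" by (rule filterlim_ident)
  have "((\<lambda>z::complex. - inverse z) \<longlongrightarrow> - 0) at_infinity"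
    by (intro tendsto_minus tendsto_inverse_0)
  from tendsto_add_filterlim_at_infinity[OF this id]
  have "filterlim (\<lambda>z::complex. (1/2) * (- inverse z + z)) at_infinity at_infinity"
    by (intro tendsto_mult_filterlim_at_infinity[OF tendsto_const]) auto
  then have "filterlim (\<lambda>z. 2 * J z) at_infinity upper_infinity"
    unfolding upper_infinity_def
    by (rule filterlim_mono[OF _ order_refl inf_le1, THEN filterlim_cong[THEN iffD1, rotated -1]])
       (auto simp: J_def)
  then show ?thesis by (rule filterlim_at_infinity_imp_norm_at_top)
qed

lemma J_at_zero: "filterlim (\<lambda>z. norm (2 * J z)) at_top upper_zero"
proof -
  have i: "filterlim (\<lambda>z::complex. (- 1) * inverse z) at_infinity (at 0)"
    by (intro tendsto_mult_filterlim_at_infinity[OF tendsto_const] filterlim_inverse_at_infinity) auto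
  have "((\<lambda>z::complex. z) \<longlongrightarrow> 0) (at 0)" by (rule tendsto_ident_at)
  from tendsto_add_filterlim_at_infinity[OF this i]
  have "filterlim (\<lambda>z::complex. (1/2) * (z + (- 1) * inverse z)) at_infinity (at 0)"
    by (intro tendsto_mult_filterlim_at_infinity[OF tendsto_const]) auto
  then have "filterlim (\<lambda>z. 2 * J z) at_infinity upper_zero"
    unfolding upper_zero_def
    by (rule filterlim_mono[OF _ order_refl at_le[OF subset_UNIV], THEN filterlim_cong[THEN iffD1, rotated -1]])
       (auto simp: J_def)
  then show ?thesis by (rule filterlim_at_infinity_imp_norm_at_top)
qed

lemma upper_infinity_Im: "\<forall>\<^sub>F z in upper_infinity. 0 < Im z"
  unfolding upper_infinity_def by (auto simp: eventually_inf_principal upper_half_plane_def)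

lemma upper_zero_Im: "\<forall>\<^sub>F z in upper_zero. 0 < Im z"
  unfolding upper_zero_def by (auto simp: eventually_at_filter upper_half_plane_def)

lemma eventually_Im_rate:
  assumes "\<forall>\<^sub>F z in F. 0 < Im z" shows "\<forall>\<^sub>F z in F. 0 \<le> Im (2 * J z)"
  using assms by eventually_elim (use Im_J_nonneg in auto)

lemma one_ne_two: "(1::2) \<noteq> 2" "(2::2) \<noteq> 1" by simp_all

lemma matrix_vector_mult_entry2:
  fixes A :: "complex^2^2" shows "(A *v w) $ l = A $ l $ 1 * w $ 1 + A $ l $ 2 * w $ 2"
  by (simp add: matrix_vector_mult_def sum_2)

lemma matrix_matrix_mult_entry2:
  fixes A :: "complex^2^2" shows "(A ** B) $ l $ m = A $ l $ 1 * B $ 1 $ m + A $ l $ 2 * B $ 2 $ m"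
  by (simp add: matrix_matrix_mult_def sum_2)

lemma tendsto_matrix_vector_mult:
  fixes A :: "complex^2^2"
  assumes "(w \<longlongrightarrow> c) F" shows "((\<lambda>z. A *v w z) \<longlongrightarrow> A *v c) F"
  by (rule vec_tendstoI) (unfold matrix_vector_mult_entry2, intro tendsto_intros assms)

context potentials
begin

lemma plus_column_at_infinity:
  "((\<lambda>z. plus_column u v z 1 x) \<longlongrightarrow> axis 1 (exp (- tail (\<lambda>y. Q1 u v y $ 1 $ 1) x))) upper_infinity"
proof -
  have "(inverse \<longlongrightarrow> (0::complex)) upper_infinity"
    unfolding upper_infinity_def by (rule tendsto_mono[OF inf_le1 tendsto_inverse_0])
  from volterra_solution_asymptotics[OF one_ne_two(1) dominated_Q(1,2) J_at_infinity eventually_Im_rate[OF upper_infinity_Im] this, of x]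
  show ?thesis by (simp add: plus_column_def lax_alt)
qed

lemma minus_column_at_infinity:
  obtains e where "e \<noteq> 0" "((\<lambda>z. minus_column u v z 2 x) \<longlongrightarrow> axis 2 e) upper_infinity"
proof -
  have "(inverse \<longlongrightarrow> (0::complex)) upper_infinity"
    unfolding upper_infinity_def by (rule tendsto_mono[OF inf_le1 tendsto_inverse_0])
  from volterra_solution_asymptotics[OF one_ne_two(2) dominated_Q(3,4) J_at_infinity eventually_Im_rate[OF upper_infinity_Im] this, of "- x"]
  show ?thesis
    by (intro that[of "exp (- tail (\<lambda>y. Q1_reflected y $ 2 $ 2) (- x))"]) (simp_all add: minus_column_def lax_reflect)
qed

text \<open>The columns are eigenvectors of $-\frac i4\sigma_3+\widetilde Q_2$ for the eigenvalues $\mp\frac i4$; the determinant is one.\<close>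

definition gauge :: "real \<Rightarrow> complex^2^2" where
  "gauge y = mat2 1 (cnj (u y)) (v y) (1 + cnj (u y) * v y)"

definition gauge_inv :: "real \<Rightarrow> complex^2^2" where
  "gauge_inv y = mat2 (1 + cnj (u y) * v y) (- cnj (u y)) (- v y) 1"

definition gauge_deriv :: "real \<Rightarrow> complex^2^2" where
  "gauge_deriv y = mat2 0 (cnj (u' y)) (v' y) (cnj (u' y) * v y + cnj (u y) * v' y)"

text \<open>The coefficient after the gauge is $S^{-1}\widetilde Q_1S-S^{-1}S'+\lambda\cdot\frac i4(S^{-1}\sigma_3S-\sigma_3)$; the matrix
\<open>gauged_Q2\<close> is the last factor, multiplied out.\<close>

definition gauged_Q1 :: "real \<Rightarrow> complex^2^2" where
  "gauged_Q1 y = gauge_inv y ** Q1 u v y ** gauge y - gauge_inv y ** gauge_deriv y"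

definition gauged_Q2 :: "real \<Rightarrow> complex^2^2" where
  "gauged_Q2 y = mat2 (\<i> / 2 * (cnj (u y) * v y)) (\<i> / 2 * (cnj (u y) * (1 + cnj (u y) * v y)))
     (- (\<i> / 2) * v y) (- (\<i> / 2) * (cnj (u y) * v y))"

lemma gauge_bounded: "cont_bounded (\<lambda>y. gauge y $ l $ m)" "cont_bounded (\<lambda>y. gauge_inv y $ l $ m)"
proof -
  have neg: "cont_bounded (\<lambda>y. - f y)" if "cont_bounded f" for f
    using cont_bounded_mult[OF cont_bounded_const[of "- 1"] that] by simp
  have "cont_bounded (\<lambda>y. gauge y $ 1 $ 1)" "cont_bounded (\<lambda>y. gauge y $ 1 $ 2)"
    "cont_bounded (\<lambda>y. gauge y $ 2 $ 1)" "cont_bounded (\<lambda>y. gauge y $ 2 $ 2)"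
    "cont_bounded (\<lambda>y. gauge_inv y $ 1 $ 1)" "cont_bounded (\<lambda>y. gauge_inv y $ 1 $ 2)"
    "cont_bounded (\<lambda>y. gauge_inv y $ 2 $ 1)" "cont_bounded (\<lambda>y. gauge_inv y $ 2 $ 2)"
    unfolding gauge_def gauge_inv_def mat2_entries by (intro coefficient_closure neg)+
  then show "cont_bounded (\<lambda>y. gauge y $ l $ m)" "cont_bounded (\<lambda>y. gauge_inv y $ l $ m)"
    using exhaust_2[of l] exhaust_2[of m] by auto
qed

lemma gauge_deriv_integrable: "cont_integrable (\<lambda>y. gauge_deriv y $ l $ m)"
proof -
  have z: "cont_integrable (\<lambda>y. 0)" by (auto simp: cont_integrable_def)
  have "cont_integrable (\<lambda>y. gauge_deriv y $ 1 $ 1)" "cont_integrable (\<lambda>y. gauge_deriv y $ 1 $ 2)"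
    "cont_integrable (\<lambda>y. gauge_deriv y $ 2 $ 1)" "cont_integrable (\<lambda>y. gauge_deriv y $ 2 $ 2)"
    unfolding gauge_deriv_def mat2_entries
    by (intro coefficient_closure z cont_integrable_mult[of "\<lambda>y. cnj (u y)" v'] cont_integrable_mult'[of "\<lambda>y. cnj (u' y)" v])+
  then show ?thesis using exhaust_2[of l] exhaust_2[of m] by auto
qed

lemma gauged_Q1_integrable: "cont_integrable (\<lambda>y. gauged_Q1 y $ l $ m)"
  unfolding gauged_Q1_def vector_minus_component matrix_matrix_mult_entry2
  by (intro cont_integrable_add cont_integrable_diff cont_integrable_mult cont_integrable_mult'
      Q1_cont_integrable gauge_bounded gauge_deriv_integrable)

lemma gauged_Q2_integrable: "cont_integrable (\<lambda>y. gauged_Q2 y $ l $ m)"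
proof -
  have "cont_integrable (\<lambda>y. gauged_Q2 y $ 1 $ 1)" "cont_integrable (\<lambda>y. gauged_Q2 y $ 1 $ 2)"
    "cont_integrable (\<lambda>y. gauged_Q2 y $ 2 $ 1)" "cont_integrable (\<lambda>y. gauged_Q2 y $ 2 $ 2)"
    unfolding gauged_Q2_def mat2_entries
    by (intro coefficient_closure cont_integrable_mult[of "\<lambda>_. _"] cont_integrable_mult')+
  then show ?thesis using exhaust_2[of l] exhaust_2[of m] by auto
qed

text \<open>This sign change is what makes the limit of \<open>M\<close> at zero free of exponential factors: the
factor \<open>E\<close> of the limit at infinity reappears inverted in the limit at zero.\<close>

lemma gauged_Q1_diagonal: "gauged_Q1 y $ 1 $ 1 = - Q1 u v y $ 1 $ 1"
  by (simp add: gauged_Q1_def matrix_matrix_mult_entry2 gauge_def gauge_inv_def gauge_deriv_def Q1_eq algebra_simps)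

lemma gauge_gauge_inv: "gauge x *v (gauge_inv x *v w) = w"
  by (simp add: vec_eq_iff all_index2 matrix_vector_mult_entry2 gauge_def gauge_inv_def algebra_simps)

text \<open>The gauge removes the term with \<open>inverse z\<close> from the coefficient while keeping the rates, so that \<open>z\<close> itself
becomes the small parameter.\<close>

lemma gauged_ode:
  assumes z: "z \<noteq> 0" and n: "damped_ode (column_rate m (2 * J z * sigma_sign m)) (lax u v z) n"
  shows "damped_ode (column_rate m (2 * J z * sigma_sign m)) (\<lambda>y. gauged_Q1 y + mat z ** gauged_Q2 y) (\<lambda>x. gauge_inv x *v n x)"
  unfolding damped_ode_def has_vector_derivative_componentwise
proof (intro allI)
  fix x and l :: 2
  have dn: "((\<lambda>x. n x $ l) has_vector_derivative (lax u v z x $ l $ 1 * n x $ 1 + lax u v z x $ l $ 2 * n x $ 2 - \<i> * column_rate m (2 * J z * sigma_sign m) l * n x $ l)) (at x)" for l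
    using n unfolding damped_ode_def has_vector_derivative_componentwise
    by (simp add: matrix_vector_mult_entry2)
  have dv: "(v has_vector_derivative v' x) (at x)" using v by (simp add: decaying_C1_def)
  have du: "((\<lambda>x. cnj (u x)) has_vector_derivative cnj (u' x)) (at x)"
    using u by (intro has_vector_derivative_cnj) (simp add: decaying_C1_def)
  note d1 = has_vector_derivative_add[OF has_vector_derivative_mult[OF has_vector_derivative_add[OF
      has_vector_derivative_const[of 1] has_vector_derivative_mult[OF du dv]] dn[of 1]]
      has_vector_derivative_mult[OF has_vector_derivative_minus[OF du] dn[of 2]]]
  note d2 = has_vector_derivative_add[OF has_vector_derivative_mult[OF has_vector_derivative_minus[OF dv] dn[of 1]] 
     has_vector_derivative_mult[OF has_vector_derivative_const[of 1] dn[of 2]]]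
  have r: "column_rate 1 q 1 = 0" "column_rate 1 q 2 = q" "column_rate 2 q 1 = q" "column_rate 2 q 2 = 0" for q
    by (simp_all add: column_rate_def)
  define t where "t = inverse z"
  define N1 N2 where "N1 = n x $ 1" "N2 = n x $ 2"
  define U Ub V Vb U' V' where uv: "U = u x" "Ub = cnj (u x)" "V = v x" "Vb = cnj (v x)" "U' = cnj (u' x)" "V' = v' x"
  have Jz: "2 * J z = (z - t) / 2" by (simp add: J_def t_def)
  \<comment> \<open>The polynomial identity below holds modulo this relation.\<close>
  have tz: "t * z = 1" "z * t = 1" "t * (z * w) = w" "z * (t * w) = w" for w using z by (simp_all add: t_def)
  consider "l = 1" | "l = 2" using exhaust_2 by blast
  then show "((\<lambda>x. (gauge_inv x *v n x) $ l) has_vector_derivative ((gauged_Q1 x + mat z ** gauged_Q2 x) *v (gauge_inv x *v n x) -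
      (\<chi> l. \<i> * column_rate m (2 * J z * sigma_sign m) l * (gauge_inv x *v n x) $ l)) $ l) (at x)"
  proof cases
    case 1
    show ?thesis
      unfolding 1 matrix_vector_mult_entry2 gauge_inv_def mat2_entries
      by (rule has_vector_derivative_eq_rhs[OF d1], rule disjE[OF exhaust_2[of m]];
        simp add: r lax_entries mat_def gauged_Q1_def gauged_Q2_def
          matrix_matrix_mult_entry2 matrix_vector_mult_entry2 gauge_def gauge_inv_def gauge_deriv_def Q1_eq
          Jz t_def[symmetric] N1_N2_def[symmetric] uv[symmetric] power2_eq_square;
        simp add: algebra_simps tz add_divide_distrib diff_divide_distrib)
  next
    case 2
    show ?thesis
      unfolding 2 matrix_vector_mult_entry2 gauge_inv_def mat2_entries
      by (rule has_vector_derivative_eq_rhs[OF d2], rule disjE[OF exhaust_2[of m]];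
        simp add: r lax_entries mat_def gauged_Q1_def gauged_Q2_def
          matrix_matrix_mult_entry2 matrix_vector_mult_entry2 gauge_def gauge_inv_def gauge_deriv_def Q1_eq
          Jz t_def[symmetric] N1_N2_def[symmetric] uv[symmetric] power2_eq_square;
        simp add: algebra_simps tz add_divide_distrib diff_divide_distrib)
  qed
qed

lemma gauge_inv_tendsto:
  assumes "(u \<longlongrightarrow> 0) F" "(v \<longlongrightarrow> 0) F" "(n \<longlongrightarrow> c) F"
  shows "((\<lambda>x. gauge_inv x *v n x) \<longlongrightarrow> c) F"
proof (rule vec_tendstoI)
  fix l :: 2
  have n: "((\<lambda>x. n x $ l) \<longlongrightarrow> c $ l) F" for l by (rule tendsto_vec_nth[OF assms(3)])
  have "((\<lambda>x. (gauge_inv x *v n x) $ 1) \<longlongrightarrow> (1 + cnj 0 * 0) * c $ 1 + - cnj 0 * c $ 2) F"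
    "((\<lambda>x. (gauge_inv x *v n x) $ 2) \<longlongrightarrow> - 0 * c $ 1 + 1 * c $ 2) F"
    unfolding matrix_vector_mult_entry2 gauge_inv_def mat2_entries by (intro tendsto_intros assms n)+
  then show "((\<lambda>x. (gauge_inv x *v n x) $ l) \<longlongrightarrow> c $ l) F"
    using exhaust_2[of l] by auto
qed

definition gauged_Q1_reflected :: "real \<Rightarrow> complex^2^2" where "gauged_Q1_reflected y = - gauged_Q1 (- y)"
definition gauged_Q2_reflected :: "real \<Rightarrow> complex^2^2" where "gauged_Q2_reflected y = - gauged_Q2 (- y)"

lemma dominated_gauged_Q:
  "dominated gauged_Q1 (\<lambda>y. entry_norm (gauged_Q1 y))" "dominated gauged_Q2 (\<lambda>y. entry_norm (gauged_Q2 y))"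
  "dominated gauged_Q1_reflected (\<lambda>y. entry_norm (gauged_Q1_reflected y))" "dominated gauged_Q2_reflected (\<lambda>y. entry_norm (gauged_Q2_reflected y))"
proof -
  show "dominated gauged_Q1 (\<lambda>y. entry_norm (gauged_Q1 y))" "dominated gauged_Q2 (\<lambda>y. entry_norm (gauged_Q2 y))"
    by (intro dominated_entries gauged_Q1_integrable gauged_Q2_integrable)+
  show "dominated gauged_Q1_reflected (\<lambda>y. entry_norm (gauged_Q1_reflected y))" "dominated gauged_Q2_reflected (\<lambda>y. entry_norm (gauged_Q2_reflected y))"
    by (intro dominated_entries;
        simp add: gauged_Q1_reflected_def gauged_Q2_reflected_def cont_integrable_uminus cont_integrable_reflect[OF gauged_Q1_integrable]
          cont_integrable_reflect[OF gauged_Q2_integrable])+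
qed

lemma plus_column_gauged:
  assumes z: "0 < Im z"
  shows "plus_column u v z 1 x = gauge x *v
     volterra_solution (column_rate 1 (2 * J z)) (\<lambda>y. gauged_Q1 y + mat z ** gauged_Q2 y) (axis 1 1) x"
proof -
  have z0: "z \<noteq> 0" using z by auto
  have im: "0 \<le> Im (2 * J z)" "0 \<le> Im (2 * J z * sigma_sign 1)" using Im_J_nonneg[of z] z by auto
  let ?w = "\<lambda>x. gauge_inv x *v plus_column u v z 1 x"
  have "damped_ode (column_rate 1 (2 * J z)) (\<lambda>y. gauged_Q1 y + mat z ** gauged_Q2 y) ?w"
    using gauged_ode[OF z0 plus_column_ode(1)[OF im(2)]] by simp
  moreover have "(?w \<longlongrightarrow> axis 1 1) at_top"
    by (intro gauge_inv_tendsto plus_column_ode(2) im decaying_C1_at_top[OF u] decaying_C1_at_top[OF v])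
  ultimately have "?w = volterra_solution (column_rate 1 (2 * J z)) (\<lambda>y. gauged_Q1 y + mat z ** gauged_Q2 y) (axis 1 1)"
    by (rule damped_ode_unique[OF dissipative_column_rate[OF im(1)]
        dominated_add_scaled[OF dominated_gauged_Q(1,2) order_refl] column_rate_axis])
  then show ?thesis using gauge_gauge_inv by (metis (no_types))
qed

lemma minus_column_gauged:
  assumes z: "0 < Im z"
  shows "minus_column u v z 2 x = gauge x *v
     volterra_solution (column_rate 2 (2 * J z)) (\<lambda>y. gauged_Q1_reflected y + mat z ** gauged_Q2_reflected y) (axis 2 1) (- x)"
proof -
  have z0: "z \<noteq> 0" using z by auto
  have im: "0 \<le> Im (2 * J z)" "0 \<le> Im (- 2 * J z * sigma_sign 2)" using Im_J_nonneg[of z] z by auto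
  let ?w = "\<lambda>x. gauge_inv x *v minus_column u v z 2 x"
  have "damped_ode (column_rate 2 (- (2 * J z))) (\<lambda>y. gauged_Q1 y + mat z ** gauged_Q2 y) ?w"
    using gauged_ode[OF z0 minus_column_ode(1)[OF im(2)]] by simp
  from damped_ode_reflect[OF this]
  have "damped_ode (column_rate 2 (2 * J z)) (\<lambda>y. gauged_Q1_reflected y + mat z ** gauged_Q2_reflected y) (\<lambda>x. ?w (- x))"
  proof -
    have "(\<lambda>y. - (gauged_Q1 (- y) + mat z ** gauged_Q2 (- y))) = (\<lambda>y. gauged_Q1_reflected y + mat z ** gauged_Q2_reflected y)"
      by (simp add: gauged_Q1_reflected_def gauged_Q2_reflected_def fun_eq_iff vec_eq_iff mat_matrix_mult_component)
    then show ?thesis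
      using damped_ode_reflect[OF \<open>damped_ode (column_rate 2 (- (2 * J z))) (\<lambda>y. gauged_Q1 y + mat z ** gauged_Q2 y) ?w\<close>]
        column_rate_uminus[of 2 "- (2 * J z)"] by simp
  qed
  moreover have "(?w \<longlongrightarrow> axis 2 1) at_bot"
    by (intro gauge_inv_tendsto minus_column_ode(2) im decaying_C1_at_bot[OF u] decaying_C1_at_bot[OF v])
  then have "((\<lambda>x. ?w (- x)) \<longlongrightarrow> axis 2 1) at_top" by (simp add: filterlim_at_bot_mirror)
  ultimately have "(\<lambda>x. ?w (- x)) = volterra_solution (column_rate 2 (2 * J z)) (\<lambda>y. gauged_Q1_reflected y + mat z ** gauged_Q2_reflected y) (axis 2 1)"
    by (rule damped_ode_unique[OF dissipative_column_rate[OF im(1)]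
        dominated_add_scaled[OF dominated_gauged_Q(3,4) order_refl] column_rate_axis])
  then have "?w (- (- x)) = volterra_solution (column_rate 2 (2 * J z)) (\<lambda>y. gauged_Q1_reflected y + mat z ** gauged_Q2_reflected y) (axis 2 1) (- x)"
    by (rule fun_cong)
  then show ?thesis using gauge_gauge_inv by (metis (no_types) minus_minus)
qed

lemma plus_column_at_zero:
  "((\<lambda>z. plus_column u v z 1 x) \<longlongrightarrow> gauge x *v axis 1 (exp (tail (\<lambda>y. Q1 u v y $ 1 $ 1) x))) upper_zero"
proof -
  have id: "((\<lambda>z. z) \<longlongrightarrow> 0) upper_zero" unfolding upper_zero_def by (rule tendsto_ident_at)
  have "((\<lambda>z. volterra_solution (column_rate 1 (2 * J z)) (\<lambda>y. gauged_Q1 y + mat z ** gauged_Q2 y) (axis 1 1) x)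
      \<longlongrightarrow> axis 1 (exp (- tail (\<lambda>y. gauged_Q1 y $ 1 $ 1) x))) upper_zero"
    by (rule volterra_solution_asymptotics[OF one_ne_two(1) dominated_gauged_Q(1,2) J_at_zero eventually_Im_rate[OF upper_zero_Im] id])
  moreover have "- tail (\<lambda>y. gauged_Q1 y $ 1 $ 1) x = tail (\<lambda>y. Q1 u v y $ 1 $ 1) x"
    unfolding gauged_Q1_diagonal by (simp add: tail_def set_lebesgue_integral_def)
  ultimately have "((\<lambda>z. gauge x *v volterra_solution (column_rate 1 (2 * J z)) (\<lambda>y. gauged_Q1 y + mat z ** gauged_Q2 y) (axis 1 1) x)
      \<longlongrightarrow> gauge x *v axis 1 (exp (tail (\<lambda>y. Q1 u v y $ 1 $ 1) x))) upper_zero"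
    by (simp add: tendsto_matrix_vector_mult)
  then show ?thesis
    by (rule Lim_transform_eventually)
       (rule eventually_mono[OF upper_zero_Im], simp add: plus_column_gauged)
qed

lemma minus_column_at_zero:
  obtains e where "((\<lambda>z. minus_column u v z 2 x) \<longlongrightarrow> gauge x *v axis 2 e) upper_zero" "e \<noteq> 0"
proof -
  have id: "((\<lambda>z. z) \<longlongrightarrow> 0) upper_zero" unfolding upper_zero_def by (rule tendsto_ident_at)
  let ?e = "exp (- tail (\<lambda>y. gauged_Q1_reflected y $ 2 $ 2) (- x))"
  have "((\<lambda>z. volterra_solution (column_rate 2 (2 * J z)) (\<lambda>y. gauged_Q1_reflected y + mat z ** gauged_Q2_reflected y) (axis 2 1) (- x))
      \<longlongrightarrow> axis 2 ?e) upper_zero"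
    by (rule volterra_solution_asymptotics[OF one_ne_two(2) dominated_gauged_Q(3,4) J_at_zero eventually_Im_rate[OF upper_zero_Im] id])
  then have "((\<lambda>z. gauge x *v volterra_solution (column_rate 2 (2 * J z)) (\<lambda>y. gauged_Q1_reflected y + mat z ** gauged_Q2_reflected y) (axis 2 1) (- x))
      \<longlongrightarrow> gauge x *v axis 2 ?e) upper_zero"
    by (simp add: tendsto_matrix_vector_mult)
  then have "((\<lambda>z. minus_column u v z 2 x) \<longlongrightarrow> gauge x *v axis 2 ?e) upper_zero"
    by (rule Lim_transform_eventually)
       (rule eventually_mono[OF upper_zero_Im], simp add: minus_column_gauged)
  then show ?thesis by (rule that) simp
qed

end

section \<open>A Liouville theorem with limits in two half-planes\<close>

definition lower_infinity :: "complex filter" where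
  "lower_infinity = inf at_infinity (principal lower_half_plane)"

definition lower_zero :: "complex filter" where
  "lower_zero = at 0 within lower_half_plane"

lemma at_within_upper_nontrivial:
  assumes "0 \<le> Im z" shows "at z within upper_half_plane \<noteq> bot"
proof -
  have "z islimpt upper_half_plane"
    unfolding islimpt_approachable
  proof (intro allI impI)
    fix e :: real assume "0 < e"
    then show "\<exists>x'\<in>upper_half_plane. x' \<noteq> z \<and> dist x' z < e"
      using assms by (intro bexI[of _ "z + \<i> * of_real (e/2)"]) (auto simp: dist_norm norm_mult upper_half_plane_def)
  qed
  then show ?thesis by (simp add: trivial_limit_within)
qed

lemma upper_zero_nontrivial: "upper_zero \<noteq> bot"
  unfolding upper_zero_def by (rule at_within_upper_nontrivial) simp

lemma upper_infinity_nontrivial: "upper_infinity \<noteq> bot"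
proof
  assume "upper_infinity = bot"
  then have "eventually (\<lambda>z. False) upper_infinity" by simp
  then obtain b where b: "\<And>z. b \<le> norm z \<Longrightarrow> z \<notin> upper_half_plane"
    unfolding upper_infinity_def eventually_inf_principal eventually_at_infinity by auto
  have "norm (\<i> * of_real (\<bar>b\<bar> + 1)) = \<bar>b\<bar> + 1" by (simp add: norm_mult)
  moreover have "b \<le> \<bar>b\<bar> + 1" by linarith
  moreover have "0 < \<bar>b\<bar> + 1" by linarith
  ultimately show False using b[of "\<i> * of_real (\<bar>b\<bar> + 1)"] by (simp add: upper_half_plane_def)
qed

text \<open>Estimates obtained off the real line extend to it by continuity.\<close>

lemma norm_le_by_upper_density:
  fixes h :: "complex \<Rightarrow> complex"
  assumes c: "isCont h z" and im: "Im z = 0" and U: "open U" "z \<in> U"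
    and b: "\<And>w. w \<in> U \<Longrightarrow> 0 < Im w \<Longrightarrow> norm (h w) \<le> norm (B w)" and cB: "isCont B z"
  shows "norm (h z) \<le> norm (B z :: complex)"
proof (rule tendsto_le)
  show "at z within upper_half_plane \<noteq> bot" by (rule at_within_upper_nontrivial) (simp add: im)
  show "((\<lambda>w. norm (h w)) \<longlongrightarrow> norm (h z)) (at z within upper_half_plane)"
    "((\<lambda>w. norm (B w)) \<longlongrightarrow> norm (B z)) (at z within upper_half_plane)"
    using c cB by (auto intro!: tendsto_norm simp: isCont_def intro: Lim_at_imp_Lim_at_within)
  show "\<forall>\<^sub>F w in at z within upper_half_plane. norm (h w) \<le> norm (B w)"
    using U b by (auto simp: eventually_at_topological upper_half_plane_def)
qed

lemma remove_simple_singularities: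
  assumes "finite P" and "open U" and "P \<subseteq> U" and "h holomorphic_on U - P"
    and "\<And>p. p \<in> P \<Longrightarrow> ((\<lambda>z. (z - p) * h z) \<longlongrightarrow> 0) (at p)"
  obtains g where "g holomorphic_on U" "\<And>z. z \<in> U - P \<Longrightarrow> g z = h z"
  using assms
proof (induction P arbitrary: U thesis rule: finite_induct)
  case empty
  then show ?case by auto
next
  case (insert p P)
  have o: "open (U - {p})" using insert.prems by (intro open_delete)
  obtain g0 where g0: "g0 holomorphic_on U - {p}" "\<And>z. z \<in> U - {p} - P \<Longrightarrow> g0 z = h z"
  proof (rule insert.IH[of "U - {p}"])
    show "P \<subseteq> U - {p}" using insert by auto
    have "U - {p} - P = U - insert p P" by auto
    then show "h holomorphic_on U - {p} - P" using insert.prems by simp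
  qed (use o insert.prems in auto)
  have pU: "p \<in> interior U" using insert.prems by (simp add: interior_open)
  have "((\<lambda>z. (z - p) * g0 z) \<longlongrightarrow> 0) (at p)"
  proof (rule Lim_transform_within_open)
    show "((\<lambda>z. (z - p) * h z) \<longlongrightarrow> 0) (at p)" using insert.prems by auto
    show "open (U - P)" using insert by (intro open_Diff finite_imp_closed)
    show "p \<in> U - P" using insert by auto
    show "(z - p) * h z = (z - p) * g0 z" if "z \<in> U - P" "z \<noteq> p" for z using g0(2)[of z] that by auto
  qed
  then obtain g where "g holomorphic_on U" "\<forall>z\<in>U - {p}. g z = g0 z"
    using holomorphic_on_extend_lim[OF g0(1) pU] by blast
  then show ?case using g0(2) by (intro insert.prems(1)[of g]) auto
qed

lemma tendsto_zero_bound: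
  assumes "((h :: complex \<Rightarrow> complex) \<longlongrightarrow> c) (at 0 within H)"
  obtains B r where "0 < r" "\<And>z. z \<in> H \<Longrightarrow> z \<noteq> 0 \<Longrightarrow> norm z < r \<Longrightarrow> norm (h z) \<le> B"
proof -
  have "\<forall>\<^sub>F z in at 0 within H. dist (h z) c < 1" using assms by (rule tendstoD) simp
  then obtain r where r: "0 < r" "\<And>z. z \<in> H \<Longrightarrow> z \<noteq> 0 \<Longrightarrow> dist z 0 < r \<Longrightarrow> dist (h z) c < 1"
    unfolding eventually_at by auto
  show ?thesis
  proof (rule that[OF r(1), of "norm c + 1"])
    fix z assume "z \<in> H" "z \<noteq> 0" "norm z < r"
    then have "norm (h z - c) < 1" using r(2)[of z] by (simp add: dist_norm)
    then show "norm (h z) \<le> norm c + 1" using norm_triangle_ineq2[of "h z" c] by linarith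
  qed
qed

lemma tendsto_infinity_bound:
  assumes "((h :: complex \<Rightarrow> complex) \<longlongrightarrow> c) (inf at_infinity (principal H))"
  obtains B r where "0 < r" "0 \<le> B" "\<And>z. z \<in> H \<Longrightarrow> r \<le> norm z \<Longrightarrow> norm (h z) \<le> B"
proof -
  have "\<forall>\<^sub>F z in inf at_infinity (principal H). dist (h z) c < 1" using assms by (rule tendstoD) simp
  then obtain r where r: "\<And>z. z \<in> H \<Longrightarrow> r \<le> norm z \<Longrightarrow> dist (h z) c < 1"
    unfolding eventually_inf_principal eventually_at_infinity by auto
  show ?thesis
  proof (rule that[of "\<bar>r\<bar> + 1" "norm c + 1"])
    fix z assume "z \<in> H" "\<bar>r\<bar> + 1 \<le> norm z"
    then have "norm (h z - c) < 1" using r[of z] by (simp add: dist_norm)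
    then show "norm (h z) \<le> norm c + 1" using norm_triangle_ineq2[of "h z" c] by linarith
  qed auto
qed

text \<open>At \<open>0\<close> the function has at most a simple pole, and the limit along the upper half-plane excludes it. Hence it
extends to an entire function of at most linear growth, that is, an affine one, and the limit at infinity in
the upper half-plane leaves only the constant \<open>l\<close>. In the lower half-plane only the growth rates enter, and
these are easy to read off there.\<close>

lemma constant_by_half_plane_limits:
  assumes hol: "g holomorphic_on - {0}"
    and uz: "((\<lambda>z. z * g z) \<longlongrightarrow> 0) upper_zero" and lz: "((\<lambda>z. z * g z) \<longlongrightarrow> c) lower_zero"
    and ui: "(g \<longlongrightarrow> l) upper_infinity" and li: "((\<lambda>z. g z / z) \<longlongrightarrow> d) lower_infinity"
    and z: "z \<noteq> 0"
  shows "g z = l"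
proof -
  have cont: "isCont g z" if "z \<noteq> 0" for z
    using holomorphic_on_imp_continuous_on[OF hol] that by (simp add: continuous_on_eq_continuous_at open_Compl)
  obtain B1 r1 where F1: "0 < r1" "\<And>z. z \<in> upper_half_plane \<Longrightarrow> z \<noteq> 0 \<Longrightarrow> norm z < r1 \<Longrightarrow> norm (z * g z) \<le> B1"
    by (rule tendsto_zero_bound[OF uz[unfolded upper_zero_def]]) (rule that; assumption)
  obtain B2 r2 where F2: "0 < r2" "\<And>z. z \<in> lower_half_plane \<Longrightarrow> z \<noteq> 0 \<Longrightarrow> norm z < r2 \<Longrightarrow> norm (z * g z) \<le> B2"
    by (rule tendsto_zero_bound[OF lz[unfolded lower_zero_def]]) (rule that; assumption)
  obtain B3 r3 where F3: "0 < r3" "0 \<le> B3" "\<And>z. z \<in> upper_half_plane \<Longrightarrow> r3 \<le> norm z \<Longrightarrow> norm (g z) \<le> B3"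
    by (rule tendsto_infinity_bound[OF ui[unfolded upper_infinity_def]]) (rule that; assumption)
  obtain B4 r4 where F4: "0 < r4" "0 \<le> B4" "\<And>z. z \<in> lower_half_plane \<Longrightarrow> r4 \<le> norm z \<Longrightarrow> norm (g z / z) \<le> B4"
    by (rule tendsto_infinity_bound[OF li[unfolded lower_infinity_def]]) (rule that; assumption)
  define B where "B = max 0 (max B1 B2)"
  define r where "r = min r1 r2"
  have r: "0 < r" using F1 F2 by (simp add: r_def)
  have near0: "norm (z * g z) \<le> B" if z: "z \<noteq> 0" "norm z < r" for z
  proof -
    have BB: "B1 \<le> B" "B2 \<le> B" "0 \<le> B" "r \<le> r1" "r \<le> r2" by (auto simp: B_def r_def)
    have U: "norm (w * g w) \<le> B" if "0 < Im w" "norm w < r" for w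
    proof (rule order_trans[OF F1(2) BB(1)])
      show "w \<noteq> 0" using that by auto
    qed (use that BB in \<open>auto simp: upper_half_plane_def\<close>)
    consider (up) "0 < Im z" | (low) "Im z < 0" | (real) "Im z = 0" by linarith
    then show ?thesis
    proof cases
      case up
      then show ?thesis using U z by blast
    next
      case low
      show ?thesis
        by (rule order_trans[OF F2(2) BB(2)]) (use low z BB in \<open>auto simp: lower_half_plane_def\<close>)
    next
      case real
      have "norm (z * g z) \<le> norm (complex_of_real B)"
      proof (rule norm_le_by_upper_density[where h="\<lambda>z. z * g z" and U="ball 0 r" and B="\<lambda>_. complex_of_real B"])
        show "isCont (\<lambda>z. z * g z) z" by (intro continuous_intros cont z)
        show "norm (w * g w) \<le> norm (complex_of_real B)" if "w \<in> ball 0 r" "0 < Im w" for w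
          using U[of w] that BB by simp
      qed (use real z in auto)
      then show ?thesis using BB by simp
    qed
  qed
  have far: "norm (g z) \<le> (B3 + B4) * norm z" if z: "r3 + r4 + 1 < norm z" for z
  proof -
    have U: "norm (g w) \<le> norm (complex_of_real (B3 + B4) * w)" if w: "0 < Im w" "r3 + r4 + 1 < norm w" for w
    proof -
      have "norm (g w) \<le> B3" using F3(3)[of w] w F4(1) by (auto simp: upper_half_plane_def)
      also have "B3 \<le> (B3 + B4) * 1" using F4 by simp
      also have "\<dots> \<le> (B3 + B4) * norm w" using w F3(1,2) F4(1,2) by (intro mult_left_mono) auto
      finally show ?thesis using F3 F4 by (simp add: norm_mult del: of_real_add)
    qed
    consider "0 < Im z" | "Im z < 0" | "Im z = 0" by linarith
    then have "norm (g z) \<le> norm (complex_of_real (B3 + B4) * z)"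
    proof cases
      case 2
      then have zz: "z \<noteq> 0" "norm (g z / z) \<le> B4" using F4(3)[of z] z F3(1) F4(1) by (auto simp: lower_half_plane_def)
      then have "norm (g z) \<le> B4 * norm z" by (simp add: norm_divide divide_le_eq)
      also have "\<dots> \<le> (B3 + B4) * norm z" using F3 by (intro mult_right_mono) auto
      finally show ?thesis using F3 F4 by (simp add: norm_mult del: of_real_add)
    next
      case 3
      then have z0: "z \<noteq> 0" using z F3(1) F4(1) by auto
      show ?thesis
        by (rule norm_le_by_upper_density[where B="\<lambda>w. complex_of_real (B3 + B4) * w" and U="{w. r3 + r4 + 1 < norm w}"])
           (use 3 z z0 cont U in \<open>auto intro!: continuous_intros open_Collect_less\<close>)
    qed (use U z in auto)
    then show ?thesis using F3 F4 by (simp add: norm_mult del: of_real_add)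
  qed
  have h0: "(\<lambda>z. z * g z) holomorphic_on UNIV - {0}"
    using hol by (intro holomorphic_intros) (simp add: Compl_eq_Diff_UNIV)
  have "\<forall>\<^sub>F z in at 0. norm (z * g z) \<le> B"
    unfolding eventually_at using r near0 by (auto intro!: exI[of _ r])
  then obtain G where G: "G holomorphic_on UNIV" "\<And>z. z \<noteq> 0 \<Longrightarrow> G z = z * g z"
    using holomorphic_on_extend_bounded[OF h0, of] by auto
  have "isCont G 0"
    using holomorphic_on_imp_continuous_on[OF G(1)] by (simp add: continuous_on_eq_continuous_at)
  then have G0: "(G \<longlongrightarrow> G 0) (at 0)" by (simp add: isCont_def)
  then have "(G \<longlongrightarrow> G 0) upper_zero" unfolding upper_zero_def by (rule Lim_at_imp_Lim_at_within)
  moreover have "(G \<longlongrightarrow> 0) upper_zero"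
    by (rule Lim_transform_eventually[OF uz], rule eventually_mono[OF upper_zero_Im]) (metis G(2) less_irrefl zero_complex.sel(2))
  ultimately have "G 0 = 0" by (rule tendsto_unique[OF upper_zero_nontrivial])
  with G0 have "(G \<longlongrightarrow> 0) (at 0)" by simp
  then have "((\<lambda>z. (z - 0) * g z) \<longlongrightarrow> 0) (at 0)"
  proof (rule Lim_transform_within_open[where s=UNIV])
    show "G w = (w - 0) * g w" if "w \<noteq> 0" for w using G(2)[OF that] by simp
  qed auto
  moreover have "g holomorphic_on UNIV - {0}" using hol by (simp add: Compl_eq_Diff_UNIV)
  ultimately obtain e where e: "e holomorphic_on UNIV" "\<And>z. z \<noteq> 0 \<Longrightarrow> e z = g z"
    using holomorphic_on_extend_lim[of g UNIV 0] by auto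
  have grow: "norm (e z) \<le> (B3 + B4) * norm z ^ 1" if "r3 + r4 + 2 \<le> norm z" for z
  proof -
    have "z \<noteq> 0" using that F3(1) F4(1) by auto
    then show ?thesis using far[of z] that e(2) by simp
  qed
  have L: "e w = (\<Sum>k\<le>1. (deriv ^^ k) e 0 / fact k * w ^ k)" for w
    by (rule Liouville_polynomial[OF e(1) grow])
  define a b where "a = e 0" and "b = deriv e 0"
  have lin: "e w = a + b * w" for w using L[of w] by (simp add: a_def b_def)
  have "((\<lambda>z. e z) \<longlongrightarrow> l) upper_infinity"
    by (rule Lim_transform_eventually[OF ui], rule eventually_mono[OF upper_infinity_Im]) (metis e(2) less_irrefl zero_complex.sel(2))
  moreover have inv: "(inverse \<longlongrightarrow> (0::complex)) upper_infinity"
    unfolding upper_infinity_def by (rule tendsto_mono[OF inf_le1 tendsto_inverse_0])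
  ultimately have "((\<lambda>z. e z * inverse z - a * inverse z) \<longlongrightarrow> l * 0 - a * 0) upper_infinity"
    by (intro tendsto_intros)
  then have "((\<lambda>z. e z * inverse z - a * inverse z) \<longlongrightarrow> 0) upper_infinity" by simp
  then have "((\<lambda>z. b) \<longlongrightarrow> 0) upper_infinity"
  proof (rule Lim_transform_eventually)
    show "\<forall>\<^sub>F z in upper_infinity. e z * inverse z - a * inverse z = b"
      using upper_infinity_Im
    proof eventually_elim
      case (elim z)
      then have "z \<noteq> 0" by auto
      then show ?case by (simp add: lin field_simps)
    qed
  qed
  then have b0: "b = 0" by (simp add: tendsto_const_iff upper_infinity_nontrivial)
  have "((\<lambda>z. a) \<longlongrightarrow> l) upper_infinity" using \<open>((\<lambda>z. e z) \<longlongrightarrow> l) upper_infinity\<close> lin b0 by simp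
  then have "a = l" by (simp add: tendsto_const_iff upper_infinity_nontrivial)
  then show ?thesis using lin[of z] b0 e(2)[OF z] by simp
qed

lemma boundary_extension_continuous:
  fixes m :: "complex \<Rightarrow> complex" and mp :: "real \<Rightarrow> complex"
  assumes D: "open D" "D \<subseteq> H" "\<And>z. z \<in> D \<Longrightarrow> Im z \<noteq> 0" and m: "m holomorphic_on D"
    and lim: "\<And>s. (m \<longlongrightarrow> mp s) (at (of_real s) within H)" and mp: "continuous_on UNIV mp"
  shows "continuous_on (D \<union> {z. Im z = 0}) (\<lambda>z. if Im z = 0 then mp (Re z) else m z)"
  unfolding continuous_on_eq_continuous_within
proof
  let ?f = "\<lambda>z. if Im z = 0 then mp (Re z) else m z"
  fix z assume z: "z \<in> D \<union> {z. Im z = 0}"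
  show "continuous (at z within D \<union> {z. Im z = 0}) ?f"
  proof (cases "Im z = 0")
    case False
    then have zD: "z \<in> D" using z by auto
    have "continuous_on D ?f"
      by (rule continuous_on_eq[OF holomorphic_on_imp_continuous_on[OF m]]) (use D(3) in auto)
    then have "isCont ?f z" using D(1) zD by (simp add: continuous_on_eq_continuous_at)
    then show ?thesis by (rule continuous_at_imp_continuous_at_within)
  next
    case True
    have zr: "z = of_real (Re z)" using True by (simp add: complex_eq_iff)
    have "(?f \<longlongrightarrow> mp (Re z)) (at z within D)"
    proof (rule Lim_transform_eventually)
      show "(m \<longlongrightarrow> mp (Re z)) (at z within D)"
        using lim[of "Re z"] D(2) zr by (metis tendsto_within_subset)
      show "\<forall>\<^sub>F w in at z within D. m w = ?f w"
        using D(3) by (auto simp: eventually_at_filter)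
    qed
    moreover have "(?f \<longlongrightarrow> mp (Re z)) (at z within {z. Im z = 0})"
    proof (rule Lim_transform_eventually)
      have "isCont mp (Re z)" using mp by (simp add: continuous_on_eq_continuous_at)
      then have "isCont (\<lambda>z. mp (Re z)) z" by (intro isCont_o2[of z Re mp]) (auto intro: continuous_intros)
      then show "((\<lambda>z. mp (Re z)) \<longlongrightarrow> mp (Re z)) (at z within {z. Im z = 0})"
        unfolding isCont_def by (rule Lim_at_imp_Lim_at_within)
      show "\<forall>\<^sub>F w in at z within {z. Im z = 0}. mp (Re w) = ?f w" by (auto simp: eventually_at_filter)
    qed
    ultimately have "(?f \<longlongrightarrow> mp (Re z)) (at z within D \<union> {z. Im z = 0})" by (rule Lim_Un)
    then show ?thesis using True by (simp add: continuous_within)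
  qed
qed

section \<open>The jump in terms of the Jost columns\<close>

text \<open>\<open>conj_swap\<close> is affine in its spectral argument; \<open>swap_lin\<close> and \<open>swap_const\<close> are its coefficients.\<close>

definition swap_lin :: "2 \<Rightarrow> complex^2 \<Rightarrow> complex" where
  "swap_lin b w = (if b = 1 then 0 else cnj (w $ 1))"

definition swap_const :: "complex \<Rightarrow> 2 \<Rightarrow> complex^2 \<Rightarrow> complex" where
  "swap_const q b w = (if b = 1 then cnj q * cnj (w $ 1) - cnj (w $ 2) else - q * (cnj (w $ 2) - cnj q * cnj (w $ 1)))"

lemma conj_swap_split: "conj_swap q z w $ b = z * swap_lin b w + swap_const q b w"
  using exhaust_2[of b] by (auto simp: swap_lin_def swap_const_def)

lemma conj_swap_scale: "conj_swap q z (k *s w) $ b = cnj k * conj_swap q z w $ b"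
  using exhaust_2[of b] by (auto simp: algebra_simps)

text \<open>The hypotheses of the theorem, with \<open>x\<close> fixed. The names \<open>f\<close>, \<open>g\<close> and \<open>al\<close> below are those of the
overview at the beginning.\<close>

locale riemann_hilbert = potentials +
  fixes N1 :: nat and lam c :: "nat \<Rightarrow> complex" and x :: real and M :: "complex \<Rightarrow> complex^2^2"
  assumes gen: "generic u v"
    and refl: "refl_coeff u v \<in> H11_0"
    and lam: "bij_betw lam {1..N1} (eigenvalues u v)"
    and norming: "\<And>j. j \<in> {1..N1} \<Longrightarrow> is_norming_constant u v (lam j) (c j)"
    and rhp: "is_RHP_solution x (refl_coeff u v) N1 lam c M"
begin

abbreviation "P \<equiv> eigenvalues u v"
abbreviation "f z \<equiv> n1_plus u v x z"
abbreviation "g z \<equiv> n2_minus u v x z"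
abbreviation "al z \<equiv> alpha u v z"

lemma lam_image: "lam ` {1..N1} = P"
  using lam by (rule bij_betw_imp_surj_on)

lemma P_finite: "finite P" and P_upper: "P \<subseteq> upper_half_plane" and P_zero: "p \<in> P \<Longrightarrow> al p = 0"
  using gen by (auto simp: generic_def eigenvalues_def)

lemma upper_closed: "upper_half_plane \<subseteq> closed_upper"
  by (auto simp: closed_upper_def)

lemma open_upper: "open upper_half_plane"
  unfolding upper_half_plane_def by (rule open_halfspace_Im_gt)

lemma open_lower: "open lower_half_plane"
  unfolding lower_half_plane_def by (rule open_halfspace_Im_lt)

lemma f_hol: "(\<lambda>z. f z $ b) holomorphic_on upper_half_plane"
  by (rule holomorphic_transform[OF plus_column_analytic(1)[of x b]])
     (use upper_closed n1_plus_eq in auto)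

lemma g_hol: "(\<lambda>z. g z $ b) holomorphic_on upper_half_plane"
  by (rule holomorphic_transform[OF minus_column_analytic(1)[of x b]])
     (use upper_closed n2_minus_eq in auto)

lemma f_cont: "continuous_on closed_upper (\<lambda>z. f z $ b)"
  using continuous_on_eq[OF plus_column_analytic(2)[of x], of "\<lambda>z. f z"] n1_plus_eq
  by (auto intro: continuous_intros)

lemma g_cont: "continuous_on closed_upper (\<lambda>z. g z $ b)"
  using continuous_on_eq[OF minus_column_analytic(2)[of x], of "\<lambda>z. g z"] n2_minus_eq
  by (auto intro: continuous_intros)

lemma al_det: "z \<in> closed_upper \<Longrightarrow> al z = f z $ 1 * g z $ 2 - g z $ 1 * f z $ 2"
  using alpha_eq[of z x] by (simp add: det_cols2)

lemma al_hol: "al holomorphic_on upper_half_plane"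
proof (rule holomorphic_transform)
  show "(\<lambda>z. f z $ 1 * g z $ 2 - g z $ 1 * f z $ 2) holomorphic_on upper_half_plane"
    by (intro holomorphic_intros f_hol g_hol)
qed (use al_det upper_closed in auto)

lemma al_cont: "continuous_on closed_upper al"
proof (rule continuous_on_eq)
  show "continuous_on closed_upper (\<lambda>z. f z $ 1 * g z $ 2 - g z $ 1 * f z $ 2)"
    by (intro continuous_intros f_cont g_cont)
qed (use al_det in auto)

lemma al_real_nonzero: "al (of_real s) \<noteq> 0"
proof -
  obtain A where "0 < A" "\<And>s::real. A \<le> norm (al (of_real s))" using gen by (auto simp: generic_def)
  then show ?thesis using norm_zero less_le_not_le by metis
qed

lemma al_nonzero: "z \<in> closed_upper \<Longrightarrow> z \<notin> P \<Longrightarrow> al z \<noteq> 0"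
  using al_real_nonzero by (auto simp: closed_upper_def eigenvalues_def elim!: Reals_cases)

definition jump_exp :: "real \<Rightarrow> complex" where
  "jump_exp s = exp (\<i> / 2 * of_real ((s - inverse s) * x))"

lemma of_real_closed_upper: "s \<noteq> 0 \<Longrightarrow> of_real s \<in> closed_upper"
  by (simp add: closed_upper_iff)

lemma jump_exp_J: "jump_exp s = exp (2 * \<i> * J (of_real s) * of_real x)"
  unfolding jump_exp_def J_def by (rule arg_cong[where f=exp]) (simp add: field_simps)

lemma cnj_jump_exp: "cnj (jump_exp s) = exp (- (\<i> / 2) * of_real ((s - inverse s) * x))"
  by (simp add: jump_exp_def exp_cnj)

lemma jump_exp_cnj_mult: "jump_exp s * cnj (jump_exp s) = 1"
  unfolding cnj_jump_exp unfolding jump_exp_def mult_exp_exp by simp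

lemma symmetric_column:
  assumes "s \<noteq> 0"
  shows "plus_column u v (of_real s) 2 x $ b = conj_swap (v x) (of_real s) (f (of_real s)) $ b / of_real s"
  using plus_column_symmetry[OF assms, of x] n1_plus_eq[OF of_real_closed_upper[OF assms]] by simp

text \<open>In the basis formed by the two Jost columns at \<open>+\<infinity>\<close>, Cramer's rule expresses \<open>g\<close> with the coefficients \<open>\<alpha>\<close>
and \<open>- \<beta>\<close> times the exponential; dividing by \<open>\<alpha>\<close> gives the second column of the jump relation.\<close>

lemma jump_second_column:
  assumes s: "s \<noteq> 0"
  defines "h \<equiv> \<lambda>b. conj_swap (v x) (of_real s) (f (of_real s)) $ b / of_real s"
  shows "g (of_real s) $ b / al (of_real s) = h b - refl_coeff u v s * jump_exp s * f (of_real s) $ b"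
proof -
  let ?z = "of_real s :: complex"
  have z: "?z \<in> closed_upper" by (rule of_real_closed_upper[OF s])
  have h: "plus_column u v ?z 2 x $ b = h b" for b unfolding h_def by (rule symmetric_column[OF s])
  have det1: "f ?z $ 1 * h 2 - h 1 * f ?z $ 2 = 1"
    using plus_columns_det[of s x] n1_plus_eq[OF z] by (simp add: det_cols2 h)
  have be: "beta u v s * jump_exp s = h 1 * g ?z $ 2 - g ?z $ 1 * h 2"
  proof -
    have "beta u v s * jump_exp s = (exp (- 2 * \<i> * J ?z * of_real x) * exp (2 * \<i> * J ?z * of_real x)) *
       det (cols2 (plus_column u v ?z 2 x) (minus_column u v ?z 2 x))"
      unfolding jump_exp_J by (subst beta_eq[OF s, of x]) simp
    also have "exp (- 2 * \<i> * J ?z * of_real x) * exp (2 * \<i> * J ?z * of_real x) = 1"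
      unfolding mult_exp_exp by simp
    finally show ?thesis using n2_minus_eq[OF z] by (simp add: det_cols2 h)
  qed
  have "g ?z $ b = (f ?z $ 1 * h 2 - h 1 * f ?z $ 2) * g ?z $ b" using det1 by simp
  also have "\<dots> = al ?z * h b - (h 1 * g ?z $ 2 - g ?z $ 1 * h 2) * f ?z $ b"
    unfolding al_det[OF z] using exhaust_2[of b] by (auto simp: algebra_simps)
  also have "\<dots> = al ?z * h b - beta u v s * jump_exp s * f ?z $ b" by (simp add: be)
  finally have "g ?z $ b / al ?z = (al ?z * h b - beta u v s * jump_exp s * f ?z $ b) / al ?z" by simp
  also have "\<dots> = h b - refl_coeff u v s * jump_exp s * f ?z $ b"
    using al_real_nonzero[of s] by (simp add: refl_coeff_def diff_divide_distrib)
  finally show ?thesis .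
qed

text \<open>The image of the preceding relation under the conjugation symmetry. Applied twice, the symmetry is multiplication by
\<open>- s\<close>, which brings back \<open>f\<close>; this is where the factor \<open>\<lambda>\<close> in the jump matrix comes from.\<close>

lemma jump_first_column:
  assumes s: "s \<noteq> 0"
  defines "fl \<equiv> \<lambda>b. conj_swap (v x) (of_real s) (f (of_real s)) $ b"
  shows "conj_swap (v x) (of_real s) (g (of_real s)) $ b / cnj (al (of_real s)) =
     - f (of_real s) $ b - cnj (refl_coeff u v s) * cnj (jump_exp s) * fl b"
proof -
  let ?z = "of_real s :: complex"
  let ?r = "refl_coeff u v s"
  have a: "al ?z \<noteq> 0" by (rule al_real_nonzero)
  have G: "g ?z $ b = al ?z * (fl b / ?z - ?r * jump_exp s * f ?z $ b)" for b
    using jump_second_column[OF s, of b] a by (simp add: fl_def field_simps)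
  show ?thesis
    unfolding fl_def using exhaust_2[of b] a s
    by (auto simp: G fl_def field_simps)
qed

end

section \<open>Comparison of the two solutions\<close>

lemma filterlim_cnj_upper_zero: "filterlim cnj upper_zero lower_zero"
  unfolding upper_zero_def lower_zero_def filterlim_at
proof
  show "(cnj \<longlongrightarrow> 0) (at 0 within lower_half_plane)"
    using tendsto_cnj[OF tendsto_ident_at[of 0 lower_half_plane]] by simp
  show "\<forall>\<^sub>F z in at 0 within lower_half_plane. cnj z \<in> upper_half_plane \<and> cnj z \<noteq> 0"
    by (auto simp: eventually_at_filter upper_half_plane_def lower_half_plane_def)
qed

lemma filterlim_cnj_upper_infinity: "filterlim cnj upper_infinity lower_infinity"
  unfolding upper_infinity_def lower_infinity_def filterlim_inf
proof
  have "filterlim cnj at_infinity at_infinity"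
    unfolding filterlim_at_infinity[OF order_refl] eventually_at_infinity by (auto intro: exI)
  then show "filterlim cnj at_infinity (inf at_infinity (principal lower_half_plane))"
    by (rule filterlim_mono[OF _ order_refl inf_le1])
  show "filterlim cnj (principal upper_half_plane) (inf at_infinity (principal lower_half_plane))"
    by (auto simp: filterlim_principal eventually_inf_principal upper_half_plane_def lower_half_plane_def)
qed

lemma filterlim_cnj_at: "filterlim cnj (at (cnj p)) (at p)"
  unfolding filterlim_at using tendsto_cnj[OF tendsto_ident_at[of p UNIV]]
  by (auto simp: eventually_at_filter)

lemma residue_of_tendsto:
  assumes "open S" "p \<in> S" "h holomorphic_on S - {p}" "((\<lambda>z. (z - p) * h z) \<longlongrightarrow> R) (at p)"
  shows "residue h p = R"
  by (rule residue_simple'[OF assms(1-3)]) (use assms(4) in \<open>simp add: mult.commute\<close>)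

lemma cnj_image_lower: "cnj ` lower_half_plane = upper_half_plane"
proof
  show "upper_half_plane \<subseteq> cnj ` lower_half_plane"
  proof
    fix z assume "z \<in> upper_half_plane"
    then show "z \<in> cnj ` lower_half_plane"
      by (intro image_eqI[of _ _ "cnj z"]) (auto simp: lower_half_plane_def upper_half_plane_def)
  qed
qed (auto simp: lower_half_plane_def upper_half_plane_def)

context riemann_hilbert
begin

text \<open>The boundary values of \<open>M\<close>. They are fixed once and for all by choice, jointly, because the jump
relation involves both.\<close>

definition "Mp = (SOME Mp. \<exists>Mm. continuous_on UNIV Mp \<and> continuous_on UNIV Mm \<and>
        (\<forall>s. (M \<longlongrightarrow> Mp s) (at (of_real s) within upper_half_plane)) \<and>
        (\<forall>s. (M \<longlongrightarrow> Mm s) (at (of_real s) within lower_half_plane)) \<and>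
        (\<forall>s::real. Mp s = Mm s ** jump_matrix x (refl_coeff u v) s))"

definition "Mm = (SOME Mm. continuous_on UNIV Mp \<and> continuous_on UNIV Mm \<and>
        (\<forall>s. (M \<longlongrightarrow> Mp s) (at (of_real s) within upper_half_plane)) \<and>
        (\<forall>s. (M \<longlongrightarrow> Mm s) (at (of_real s) within lower_half_plane)) \<and>
        (\<forall>s::real. Mp s = Mm s ** jump_matrix x (refl_coeff u v) s))"

lemma boundary:
  shows Mp_cont: "continuous_on UNIV Mp" and Mm_cont: "continuous_on UNIV Mm"
    and Mp_lim: "(M \<longlongrightarrow> Mp s) (at (of_real s) within upper_half_plane)"
    and Mm_lim: "(M \<longlongrightarrow> Mm s) (at (of_real s) within lower_half_plane)"
    and Mp_jump: "Mp s = Mm s ** jump_matrix x (refl_coeff u v) s"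
proof -
  have "\<exists>Mp Mm. continuous_on UNIV Mp \<and> continuous_on UNIV Mm \<and>
        (\<forall>s. (M \<longlongrightarrow> Mp s) (at (of_real s) within upper_half_plane)) \<and>
        (\<forall>s. (M \<longlongrightarrow> Mm s) (at (of_real s) within lower_half_plane)) \<and>
        (\<forall>s::real. Mp s = Mm s ** jump_matrix x (refl_coeff u v) s)"
    using rhp unfolding is_RHP_solution_def by blast
  from someI_ex[OF someI_ex[OF this, folded Mp_def], folded Mm_def]
  show "continuous_on UNIV Mp" "continuous_on UNIV Mm"
    "(M \<longlongrightarrow> Mp s) (at (of_real s) within upper_half_plane)"
    "(M \<longlongrightarrow> Mm s) (at (of_real s) within lower_half_plane)"
    "Mp s = Mm s ** jump_matrix x (refl_coeff u v) s"
    by blast+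
qed

abbreviation "poles \<equiv> P \<union> cnj ` P"

lemma M_hol: "(\<lambda>z. M z $ i $ j) holomorphic_on (- \<real> - poles)"
proof -
  have "cnj ` lam ` {1..N1} = cnj ` P" using lam_image by simp
  then show ?thesis using rhp lam_image unfolding is_RHP_solution_def by metis
qed

lemma poles_finite: "finite poles" and zero_not_pole: "0 \<notin> poles" and poles_nonreal: "p \<in> poles \<Longrightarrow> Im p \<noteq> 0"
  using P_finite P_upper by (auto simp: upper_half_plane_def)

lemma P_Im: "p \<in> P \<Longrightarrow> 0 < Im p"
  using P_upper by (auto simp: upper_half_plane_def)

lemma not_pole_upper: "0 < Im z \<Longrightarrow> z \<in> poles \<longleftrightarrow> z \<in> P"
  using P_upper by (auto simp: upper_half_plane_def)

text \<open>The first row of \<open>M\<close>, extended to the real line by the boundary values from above, respectively from below.\<close>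

definition row_upper :: "2 \<Rightarrow> complex \<Rightarrow> complex" where
  "row_upper k z = (if Im z = 0 then Mp (Re z) $ 1 $ k else M z $ 1 $ k)"

definition row_lower :: "2 \<Rightarrow> complex \<Rightarrow> complex" where
  "row_lower k z = (if Im z = 0 then Mm (Re z) $ 1 $ k else M z $ 1 $ k)"

text \<open>Up to sign and order of the entries, this is the first row of \<open>M\<close> times the adjugate of $[f, g/\alpha]$. In the lower half-plane the
columns of the comparison matrix are minus the image of \<open>g\<close> over the conjugate of \<open>\<alpha>\<close>, and the
image of \<open>f\<close> over \<open>z\<close>, both taken at the conjugate point.\<close>

definition quot_upper :: "2 \<Rightarrow> complex \<Rightarrow> complex" where
  "quot_upper b z = row_upper 1 z * (g z $ b / al z) - row_upper 2 z * f z $ b"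

definition quot_lower :: "2 \<Rightarrow> complex \<Rightarrow> complex" where
  "quot_lower b z = row_lower 1 z * (conj_swap (v x) z (f (cnj z)) $ b / z) + row_lower 2 z * (conj_swap (v x) z (g (cnj z)) $ b / cnj (al (cnj z)))"

definition quot :: "2 \<Rightarrow> complex \<Rightarrow> complex" where
  "quot b z = (if Im z \<le> 0 then quot_lower b z else quot_upper b z)"

text \<open>Both \<open>M\<close> and the comparison matrix jump by the same unimodular matrix, which cancels in the product.\<close>

lemma quot_lower_eq_quot_upper:
  assumes s: "s \<noteq> 0"
  shows "quot_lower b (of_real s) = quot_upper b (of_real s)"
proof -
  let ?z = "of_real s :: complex" and ?r = "refl_coeff u v s"
  define F H G where "F = f ?z $ b" "H = conj_swap (v x) ?z (f ?z) $ b" "G = conj_swap (v x) ?z (g ?z) $ b"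
  have 1: "g ?z $ b / al ?z = H / ?z - ?r * jump_exp s * F"
    using jump_second_column[OF s, of b] by (simp add: F_H_G_def)
  have 2: "G / cnj (al ?z) = - F - cnj ?r * cnj (jump_exp s) * H"
    using jump_first_column[OF s, of b] by (simp add: F_H_G_def)
  have V: "jump_matrix x (refl_coeff u v) s = mat2 1 (- ?r * jump_exp s) (- ?z * cnj ?r * cnj (jump_exp s)) (1 + ?z * (?r * cnj ?r))"
    unfolding jump_matrix_def cnj_jump_exp unfolding jump_exp_def complex_norm_square by simp
  define m1 m2 where "m1 = Mm s $ 1 $ 1" "m2 = Mm s $ 1 $ 2"
  have p1: "Mp s $ 1 $ 1 = m1 - m2 * (?z * cnj ?r * cnj (jump_exp s))"
    and p2: "Mp s $ 1 $ 2 = - m1 * (?r * jump_exp s) + m2 * (1 + ?z * (?r * cnj ?r))"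
    using Mp_jump[of s] by (simp_all add: V matrix_matrix_mult_entry2 m1_m2_def)
  have "quot_upper b ?z = (m1 - m2 * (?z * cnj ?r * cnj (jump_exp s))) * (H / ?z - ?r * jump_exp s * F)
      - (- m1 * (?r * jump_exp s) + m2 * (1 + ?z * (?r * cnj ?r))) * F"
    by (simp add: quot_upper_def row_upper_def p1 p2 1 F_H_G_def(1)[symmetric])
  also have "\<dots> = m1 * (H / ?z) + m2 * (- F - cnj ?r * cnj (jump_exp s) * H)
      + m2 * (?z * cnj ?r * ?r * F) * (jump_exp s * cnj (jump_exp s) - 1)"
    using s by (simp add: field_simps)
  also have "\<dots> = m1 * (H / ?z) + m2 * (G / cnj (al ?z))"
    unfolding jump_exp_cnj_mult 2 by simp
  also have "\<dots> = quot_lower b ?z"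
    by (simp add: quot_lower_def row_lower_def m1_m2_def F_H_G_def)
  finally show ?thesis by simp
qed

lemma open_regular_region: "open (- ({0} \<union> poles))"
  by (intro open_Compl finite_imp_closed) (use poles_finite in auto)

lemma cnj_parts:
  fixes h :: "complex \<Rightarrow> complex^2"
  assumes "\<And>b. (\<lambda>z. h z $ b) holomorphic_on upper_half_plane" "\<And>b. continuous_on closed_upper (\<lambda>z. h z $ b)"
  shows "(\<lambda>z. cnj (h (cnj z) $ b)) holomorphic_on lower_half_plane"
    and "continuous_on (cnj ` closed_upper) (\<lambda>z. cnj (h (cnj z) $ b))"
proof -
  have "cnj ` lower_half_plane = upper_half_plane"
    by (rule cnj_image_lower)
  then show "(\<lambda>z. cnj (h (cnj z) $ b)) holomorphic_on lower_half_plane"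
    using holomorphic_on_compose_cnj_cnj[of "\<lambda>z. h z $ b" lower_half_plane] assms(1) open_lower by (simp add: comp_def)
  show "continuous_on (cnj ` closed_upper) (\<lambda>z. cnj (h (cnj z) $ b))"
    by (intro continuous_intros continuous_on_compose2[OF assms(2)]) auto
qed

lemma conj_swap_cnj_parts:
  fixes h :: "complex \<Rightarrow> complex^2"
  assumes "\<And>b. (\<lambda>z. h z $ b) holomorphic_on upper_half_plane" "\<And>b. continuous_on closed_upper (\<lambda>z. h z $ b)"
  shows "(\<lambda>z. conj_swap (v x) z (h (cnj z)) $ b) holomorphic_on lower_half_plane"
    and "continuous_on (cnj ` closed_upper) (\<lambda>z. conj_swap (v x) z (h (cnj z)) $ b)"
proof -
  have "(\<lambda>z. conj_swap (v x) z (h (cnj z)) $ 1) holomorphic_on lower_half_plane"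
    "(\<lambda>z. conj_swap (v x) z (h (cnj z)) $ 2) holomorphic_on lower_half_plane"
    unfolding conj_swap_entries by (intro holomorphic_intros cnj_parts(1)[OF assms])+
  then show "(\<lambda>z. conj_swap (v x) z (h (cnj z)) $ b) holomorphic_on lower_half_plane"
    using exhaust_2[of b] by auto
  have "continuous_on (cnj ` closed_upper) (\<lambda>z. conj_swap (v x) z (h (cnj z)) $ 1)"
    "continuous_on (cnj ` closed_upper) (\<lambda>z. conj_swap (v x) z (h (cnj z)) $ 2)"
    unfolding conj_swap_entries by (intro continuous_intros cnj_parts(2)[OF assms])+
  then show "continuous_on (cnj ` closed_upper) (\<lambda>z. conj_swap (v x) z (h (cnj z)) $ b)"
    using exhaust_2[of b] by auto
qed

lemma al_cnj:
  shows "(\<lambda>z. cnj (al (cnj z))) holomorphic_on lower_half_plane"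
    and "continuous_on (cnj ` closed_upper) (\<lambda>z. cnj (al (cnj z)))"
proof -
  have "cnj ` lower_half_plane = upper_half_plane"
    by (rule cnj_image_lower)
  then show "(\<lambda>z. cnj (al (cnj z))) holomorphic_on lower_half_plane"
    using holomorphic_on_compose_cnj_cnj[of al lower_half_plane] al_hol open_lower by (simp add: comp_def)
  show "continuous_on (cnj ` closed_upper) (\<lambda>z. cnj (al (cnj z)))"
    by (intro continuous_intros continuous_on_compose2[OF al_cont]) auto
qed

lemma upper_subset: "upper_half_plane - P \<subseteq> - \<real> - poles"
proof
  fix z assume z: "z \<in> upper_half_plane - P"
  then have "0 < Im z" by (auto simp: upper_half_plane_def)
  then have "z \<notin> poles" "z \<notin> \<real>" using z not_pole_upper[of z] by (auto simp: complex_is_Real_iff)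
  then show "z \<in> - \<real> - poles" by blast
qed

lemma row_upper_holomorphic: "row_upper k holomorphic_on upper_half_plane - P"
  by (rule holomorphic_transform[OF holomorphic_on_subset[OF M_hol[of 1 k] upper_subset]])
     (auto simp: row_upper_def upper_half_plane_def)

lemma lower_subset: "lower_half_plane - cnj ` P \<subseteq> - \<real> - poles"
proof
  fix z assume z: "z \<in> lower_half_plane - cnj ` P"
  then have "Im z < 0" by (auto simp: lower_half_plane_def)
  then have "z \<notin> P" "z \<notin> \<real>" using P_Im[of z] by (auto simp: complex_is_Real_iff)
  with z show "z \<in> - \<real> - poles" by blast
qed

lemma row_lower_holomorphic: "row_lower k holomorphic_on lower_half_plane - cnj ` P"
  by (rule holomorphic_transform[OF holomorphic_on_subset[OF M_hol[of 1 k] lower_subset]])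
     (auto simp: row_lower_def lower_half_plane_def)

lemma row_upper_continuous: "continuous_on (- poles \<inter> {z. 0 \<le> Im z}) (row_upper k)"
proof (rule continuous_on_subset)
  show "continuous_on ((upper_half_plane - P) \<union> {z. Im z = 0}) (row_upper k)"
    unfolding row_upper_def[abs_def]
  proof (rule boundary_extension_continuous[where H=upper_half_plane])
    show "open (upper_half_plane - P)" by (intro open_Diff open_upper finite_imp_closed P_finite)
    show "(\<lambda>z. M z $ 1 $ k) holomorphic_on upper_half_plane - P"
      by (rule holomorphic_on_subset[OF M_hol[of 1 k] upper_subset])
    show "((\<lambda>z. M z $ 1 $ k) \<longlongrightarrow> Mp s $ 1 $ k) (at (of_real s) within upper_half_plane)" for s
      by (intro tendsto_intros Mp_lim)
    show "continuous_on UNIV (\<lambda>s. Mp s $ 1 $ k)" by (intro continuous_intros Mp_cont)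
  qed (auto simp: upper_half_plane_def)
qed (auto simp: upper_half_plane_def)

lemma row_lower_continuous: "continuous_on (- poles \<inter> {z. Im z \<le> 0}) (row_lower k)"
proof (rule continuous_on_subset)
  show "continuous_on ((lower_half_plane - cnj ` P) \<union> {z. Im z = 0}) (row_lower k)"
    unfolding row_lower_def[abs_def]
  proof (rule boundary_extension_continuous[where H=lower_half_plane])
    show "open (lower_half_plane - cnj ` P)" by (intro open_Diff open_lower finite_imp_closed finite_imageI P_finite)
    show "(\<lambda>z. M z $ 1 $ k) holomorphic_on lower_half_plane - cnj ` P"
      by (rule holomorphic_on_subset[OF M_hol[of 1 k] lower_subset])
    show "((\<lambda>z. M z $ 1 $ k) \<longlongrightarrow> Mm s $ 1 $ k) (at (of_real s) within lower_half_plane)" for s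
      by (intro tendsto_intros Mm_lim)
    show "continuous_on UNIV (\<lambda>s. Mm s $ 1 $ k)" by (intro continuous_intros Mm_cont)
  qed (auto simp: lower_half_plane_def)
qed (auto simp: lower_half_plane_def)

lemma quot_holomorphic: "quot b holomorphic_on - ({0} \<union> poles)"
  unfolding quot_def[abs_def]
proof (rule holomorphic_on_paste_real_line[OF open_regular_region])
  let ?S = "- ({0} \<union> poles)"
  have u1: "?S \<inter> {z. 0 < Im z} \<subseteq> upper_half_plane - P" by (auto simp: upper_half_plane_def)
  have l1: "?S \<inter> {z. Im z < 0} \<subseteq> lower_half_plane - cnj ` P" by (auto simp: lower_half_plane_def)
  have u2: "?S \<inter> {z. 0 \<le> Im z} \<subseteq> closed_upper" "?S \<inter> {z. 0 \<le> Im z} \<subseteq> - poles \<inter> {z. 0 \<le> Im z}"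
    by (auto simp: closed_upper_iff)
  have l2: "?S \<inter> {z. Im z \<le> 0} \<subseteq> cnj ` closed_upper" "?S \<inter> {z. Im z \<le> 0} \<subseteq> - poles \<inter> {z. Im z \<le> 0}"
  proof -
    show "?S \<inter> {z. Im z \<le> 0} \<subseteq> cnj ` closed_upper"
    proof
      fix z assume "z \<in> ?S \<inter> {z. Im z \<le> 0}"
      then have "cnj z \<in> closed_upper" by (auto simp: closed_upper_iff)
      then show "z \<in> cnj ` closed_upper" by (metis complex_cnj_cnj imageI)
    qed
  qed auto
  have al_u: "al z \<noteq> 0" if "z \<in> ?S" "0 \<le> Im z" for z
    using that by (intro al_nonzero) (auto simp: closed_upper_iff)
  have al_l: "al (cnj z) \<noteq> 0" if "z \<in> ?S" "Im z \<le> 0" for z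
  proof (rule al_nonzero)
    show "cnj z \<notin> P" using that by (metis ComplD UnCI complex_cnj_cnj imageI)
  qed (use that in \<open>auto simp: closed_upper_iff\<close>)
  show "quot_lower b holomorphic_on ?S \<inter> {z. Im z < 0}"
    unfolding quot_lower_def[abs_def]
    by (intro holomorphic_intros holomorphic_on_subset[OF row_lower_holomorphic l1]
        holomorphic_on_subset[OF conj_swap_cnj_parts(1)[OF f_hol f_cont]]
        holomorphic_on_subset[OF conj_swap_cnj_parts(1)[OF g_hol g_cont]]
        holomorphic_on_subset[OF al_cnj(1)])
       (use al_l l1 in \<open>auto simp: lower_half_plane_def\<close>)
  show "quot_upper b holomorphic_on ?S \<inter> {z. 0 < Im z}"
    unfolding quot_upper_def[abs_def]
    by (intro holomorphic_intros holomorphic_on_subset[OF row_upper_holomorphic u1]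
        holomorphic_on_subset[OF f_hol] holomorphic_on_subset[OF g_hol] holomorphic_on_subset[OF al_hol])
       (use al_u u1 in \<open>auto simp: upper_half_plane_def\<close>)
  show "continuous_on (?S \<inter> {z. Im z \<le> 0}) (quot_lower b)"
    unfolding quot_lower_def[abs_def]
    by (intro continuous_intros continuous_on_subset[OF row_lower_continuous l2(2)]
        continuous_on_subset[OF conj_swap_cnj_parts(2)[OF f_hol f_cont] l2(1)]
        continuous_on_subset[OF conj_swap_cnj_parts(2)[OF g_hol g_cont] l2(1)]
        continuous_on_subset[OF al_cnj(2) l2(1)])
       (use al_l in auto)
  show "continuous_on (?S \<inter> {z. 0 \<le> Im z}) (quot_upper b)"
    unfolding quot_upper_def[abs_def]
    by (intro continuous_intros continuous_on_subset[OF row_upper_continuous u2(2)]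
        continuous_on_subset[OF f_cont u2(1)] continuous_on_subset[OF g_cont u2(1)] continuous_on_subset[OF al_cont u2(1)])
       (use al_u in auto)
  show "quot_lower b z = quot_upper b z" if "z \<in> ?S" "Im z = 0" for z
  proof -
    have "z = of_real (Re z)" "Re z \<noteq> 0" using that by (auto simp: complex_eq_iff)
    then show ?thesis using quot_lower_eq_quot_upper by metis
  qed
qed

end

context riemann_hilbert
begin

text \<open>The residue condition of \<open>M\<close> and the norming relation between \<open>f\<close> and \<open>g\<close>, brought to a common form: the
constant \<open>ce\<close> contains the exponential, and the last equation says that $[f, g/\alpha]$ has the same residue
relation as \<open>M\<close>.\<close>

lemma eigenvalue_data:
  assumes p: "p \<in> P"
  obtains ce k where "ce \<noteq> 0"
    "simple_pole_with M p (mat2 0 ce 0 0)"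
    "simple_pole_with M (cnj p) (mat2 0 0 (- cnj p * cnj ce) 0)"
    "f p = k *s g p" "deriv al p \<noteq> 0" "k * (ce * deriv al p) = 1"
proof -
  obtain j where j: "j \<in> {1..N1}" "p = lam j" using p lam_image by (metis imageE)
  define ce where "ce = c j * exp (\<i> * of_real x * (p - inverse p) / 2)"
  have d': "deriv al p \<noteq> 0" using gen p by (auto simp: generic_def)
  obtain d where d: "d \<noteq> 0" "n1_plus u v x p = (d * exp (- \<i> * of_real x * (p - inverse p) / 2)) *s n2_minus u v x p"
    "c j = 1 / (d * deriv al p)"
    using norming[OF j(1)] unfolding is_norming_constant_def j(2)[symmetric] by blast
  have e: "exp (- \<i> * of_real x * (p - inverse p) / 2) * exp (\<i> * of_real x * (p - inverse p) / 2) = 1"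
    unfolding mult_exp_exp by simp
  have "cnj (exp (\<i> * of_real x * (p - inverse p) / 2)) = exp (- \<i> * of_real x * (cnj p - inverse (cnj p)) / 2)"
    by (simp add: exp_cnj)
  then have n: "- cnj p * cnj ce = - cnj p * cnj (c j) * exp (- \<i> * of_real x * (cnj p - inverse (cnj p)) / 2)"
    by (simp add: ce_def)
  show ?thesis
  proof (rule that[of ce "d * exp (- \<i> * of_real x * (p - inverse p) / 2)"])
    show "ce \<noteq> 0" using d(1,3) d' by (simp add: ce_def)
    show "simple_pole_with M p (mat2 0 ce 0 0)"
      using rhp j unfolding is_RHP_solution_def ce_def by blast
    show "simple_pole_with M (cnj p) (mat2 0 0 (- cnj p * cnj ce) 0)"
      using rhp j unfolding is_RHP_solution_def n by blast
    have "d * exp (- \<i> * of_real x * (p - inverse p) / 2) * (ce * deriv al p) =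
      (d * deriv al p * c j) * (exp (- \<i> * of_real x * (p - inverse p) / 2) * exp (\<i> * of_real x * (p - inverse p) / 2))"
      by (simp only: ce_def mult_ac)
    also have "\<dots> = 1" unfolding e using d d' by simp
    finally show "d * exp (- \<i> * of_real x * (p - inverse p) / 2) * (ce * deriv al p) = 1" .
  qed (use d d' in auto)
qed

text \<open>The residue of a simple pole is the limit that the definition provides only existentially.\<close>

lemma pole_row:
  fixes N :: "complex^2^2"
  assumes p: "p \<in> poles" and N: "simple_pole_with M p N"
  shows "((\<lambda>z. (z - p) * M z $ 1 $ k) \<longlongrightarrow> residue (\<lambda>z. M z $ 1 $ k) p) (at p)"
    and "((\<lambda>z. M z $ 1 $ 1 * N $ 1 $ k + M z $ 1 $ 2 * N $ 2 $ k) \<longlongrightarrow> residue (\<lambda>z. M z $ 1 $ k) p) (at p)"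
proof -
  obtain R where R: "((\<lambda>z. (z - p) * M z $ 1 $ k) \<longlongrightarrow> R) (at p)"
    using N unfolding simple_pole_with_def by blast
  define S where "S = - \<real> - (poles - {p})"
  have "open S" unfolding S_def using poles_finite
    by (intro open_Diff open_Compl closed_complex_Reals finite_imp_closed) auto
  moreover have "p \<in> S" using p poles_nonreal[OF p] by (auto simp: S_def complex_is_Real_iff)
  moreover have "(\<lambda>z. M z $ 1 $ k) holomorphic_on S - {p}"
    by (rule holomorphic_on_subset[OF M_hol]) (auto simp: S_def)
  ultimately have "residue (\<lambda>z. M z $ 1 $ k) p = R" by (rule residue_of_tendsto) (rule R)
  with R show "((\<lambda>z. (z - p) * M z $ 1 $ k) \<longlongrightarrow> residue (\<lambda>z. M z $ 1 $ k) p) (at p)" by simp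
  have "((\<lambda>z. M z ** N) \<longlongrightarrow> (\<chi> i j. residue (\<lambda>z. M z $ i $ j) p)) (at p)"
    using N unfolding simple_pole_with_def by blast
  from tendsto_vec_nth[OF tendsto_vec_nth[OF this], of 1 k]
  show "((\<lambda>z. M z $ 1 $ 1 * N $ 1 $ k + M z $ 1 $ 2 * N $ 2 $ k) \<longlongrightarrow> residue (\<lambda>z. M z $ 1 $ k) p) (at p)"
    by (simp add: matrix_matrix_mult_entry2)
qed

lemma al_simple_zero:
  assumes p: "p \<in> P" and d: "deriv al p \<noteq> 0"
  shows "((\<lambda>z. (z - p) / al z) \<longlongrightarrow> 1 / deriv al p) (at p)"
proof -
  have "(al has_field_derivative deriv al p) (at p)"
    using holomorphic_derivI[OF al_hol open_upper] p P_upper by blast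
  then have "((\<lambda>z. (al z - al p) / (z - p)) \<longlongrightarrow> deriv al p) (at p)"
    by (simp add: has_field_derivative_iff)
  then have "((\<lambda>z. al z / (z - p)) \<longlongrightarrow> deriv al p) (at p)" using P_zero[OF p] by simp
  from tendsto_inverse[OF this d] show ?thesis by (simp add: inverse_eq_divide)
qed

lemma tendsto_holomorphic_upper:
  assumes "p \<in> upper_half_plane" "h holomorphic_on upper_half_plane"
  shows "(h \<longlongrightarrow> h p) (at p)"
  using holomorphic_on_imp_continuous_on[OF assms(2)] open_upper assms(1)
  by (simp add: continuous_on_eq_continuous_at isCont_def)

lemma tendsto_holomorphic_lower:
  assumes "p \<in> lower_half_plane" "h holomorphic_on lower_half_plane"
  shows "(h \<longlongrightarrow> h p) (at p)"
  using holomorphic_on_imp_continuous_on[OF assms(2)] open_lower assms(1)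
  by (simp add: continuous_on_eq_continuous_at isCont_def)

text \<open>The residues of the two products that make up the quotient are equal, as \<open>M\<close> and $[f, g/\alpha]$ satisfy the same
residue relation.\<close>

lemma quot_pole_upper:
  assumes p: "p \<in> P"
  shows "((\<lambda>z. (z - p) * quot b z) \<longlongrightarrow> 0) (at p)"
proof -
  obtain ce k where D: "ce \<noteq> 0" "simple_pole_with M p (mat2 0 ce 0 0)"
    "f p = k *s g p" "deriv al p \<noteq> 0" "k * (ce * deriv al p) = 1"
    using eigenvalue_data[OF p] by metis
  have pp: "p \<in> poles" using p by auto
  have pu: "p \<in> upper_half_plane" using p P_upper by auto
  define \<rho> where "\<rho> = residue (\<lambda>z. M z $ 1 $ 2) p"
  have 1: "((\<lambda>z. M z $ 1 $ 1 * ce) \<longlongrightarrow> \<rho>) (at p)"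
    using pole_row(2)[OF pp D(2), of 2] by (simp add: \<rho>_def)
  have m1: "((\<lambda>z. M z $ 1 $ 1) \<longlongrightarrow> \<rho> / ce) (at p)"
    using tendsto_divide[OF 1 tendsto_const D(1)] D(1) by simp
  have m2: "((\<lambda>z. (z - p) * M z $ 1 $ 2) \<longlongrightarrow> \<rho>) (at p)"
    unfolding \<rho>_def by (rule pole_row(1)[OF pp D(2)])
  have "((\<lambda>z. M z $ 1 $ 1 * ((z - p) / al z) * g z $ b - (z - p) * M z $ 1 $ 2 * f z $ b)
     \<longlongrightarrow> \<rho> / ce * (1 / deriv al p) * g p $ b - \<rho> * f p $ b) (at p)"
    by (intro tendsto_diff tendsto_mult m1 m2 al_simple_zero[OF p D(4)] tendsto_holomorphic_upper[OF pu g_hol] tendsto_holomorphic_upper[OF pu f_hol])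
  moreover have "\<rho> / ce * (1 / deriv al p) * g p $ b - \<rho> * f p $ b = 0"
  proof -
    have "k = 1 / (ce * deriv al p)" using D by (simp add: field_simps)
    then show ?thesis using D(3) by simp
  qed
  ultimately have "((\<lambda>z. M z $ 1 $ 1 * ((z - p) / al z) * g z $ b - (z - p) * M z $ 1 $ 2 * f z $ b) \<longlongrightarrow> 0) (at p)" by simp
  then show ?thesis
  proof (rule Lim_transform_within_open[OF _ open_upper pu])
    fix z assume "z \<in> upper_half_plane"
    then show "M z $ 1 $ 1 * ((z - p) / al z) * g z $ b - (z - p) * M z $ 1 $ 2 * f z $ b = (z - p) * quot b z"
      by (simp add: quot_def quot_upper_def row_upper_def upper_half_plane_def algebra_simps)
  qed
qed

lemma quot_pole_lower:
  assumes p: "p \<in> P"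
  shows "((\<lambda>z. (z - cnj p) * quot b z) \<longlongrightarrow> 0) (at (cnj p))"
proof -
  obtain ce k where D: "ce \<noteq> 0" "simple_pole_with M (cnj p) (mat2 0 0 (- cnj p * cnj ce) 0)"
    "f p = k *s g p" "deriv al p \<noteq> 0" "k * (ce * deriv al p) = 1"
    using eigenvalue_data[OF p] by metis
  let ?q = "cnj p" and ?n = "- cnj p * cnj ce"
  have pp: "?q \<in> poles" using p by auto
  have ql: "?q \<in> lower_half_plane" using P_Im[OF p] by (simp add: lower_half_plane_def)
  have p0: "p \<noteq> 0" using P_Im[OF p] by auto
  have n0: "?n \<noteq> 0" using D(1) p0 by simp
  define \<rho> where "\<rho> = residue (\<lambda>z. M z $ 1 $ 1) ?q"
  have 1: "((\<lambda>z. M z $ 1 $ 2 * ?n) \<longlongrightarrow> \<rho>) (at ?q)"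
    using pole_row(2)[OF pp D(2), of 1] by (simp add: \<rho>_def)
  have m2: "((\<lambda>z. M z $ 1 $ 2) \<longlongrightarrow> \<rho> / ?n) (at ?q)"
    using tendsto_divide[OF 1 tendsto_const n0] n0 by simp
  have m1: "((\<lambda>z. (z - ?q) * M z $ 1 $ 1) \<longlongrightarrow> \<rho>) (at ?q)"
    unfolding \<rho>_def by (rule pole_row(1)[OF pp D(2)])
  have "((\<lambda>z. (cnj z - p) / al (cnj z)) \<longlongrightarrow> 1 / deriv al p) (at ?q)"
    by (rule filterlim_compose[OF al_simple_zero[OF p D(4)]]) (use filterlim_cnj_at[of ?q] in simp)
  from tendsto_cnj[OF this]
  have a: "((\<lambda>z. (z - ?q) / cnj (al (cnj z))) \<longlongrightarrow> 1 / cnj (deriv al p)) (at ?q)" by simp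
  have "((\<lambda>z. (z - ?q) * M z $ 1 $ 1 * (conj_swap (v x) z (f (cnj z)) $ b / z) +
        M z $ 1 $ 2 * (((z - ?q) / cnj (al (cnj z))) * conj_swap (v x) z (g (cnj z)) $ b))
     \<longlongrightarrow> \<rho> * (conj_swap (v x) ?q (f (cnj ?q)) $ b / ?q) + \<rho> / ?n * (1 / cnj (deriv al p) * conj_swap (v x) ?q (g (cnj ?q)) $ b)) (at ?q)"
    by (intro tendsto_add tendsto_mult tendsto_divide m1 m2 a tendsto_ident_at
        tendsto_holomorphic_lower[OF ql conj_swap_cnj_parts(1)[OF f_hol f_cont]] tendsto_holomorphic_lower[OF ql conj_swap_cnj_parts(1)[OF g_hol g_cont]])
       (use p0 in simp)
  moreover have "\<rho> * (conj_swap (v x) ?q (f (cnj ?q)) $ b / ?q) + \<rho> / ?n * (1 / cnj (deriv al p) * conj_swap (v x) ?q (g (cnj ?q)) $ b) = 0"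
  proof -
    have k: "k = 1 / (ce * deriv al p)" using D by (simp add: field_simps)
    have "conj_swap (v x) ?q (f (cnj ?q)) $ b = cnj k * conj_swap (v x) ?q (g p) $ b"
      using D(3) by (simp add: conj_swap_scale)
    then show ?thesis using p0 D(1,4) by (simp add: k field_simps)
  qed
  ultimately have "((\<lambda>z. (z - ?q) * M z $ 1 $ 1 * (conj_swap (v x) z (f (cnj z)) $ b / z) +
        M z $ 1 $ 2 * (((z - ?q) / cnj (al (cnj z))) * conj_swap (v x) z (g (cnj z)) $ b)) \<longlongrightarrow> 0) (at ?q)" by simp
  then show ?thesis
  proof (rule Lim_transform_within_open[OF _ open_lower ql])
    fix z assume z: "z \<in> lower_half_plane"
    have ring: "a * m * X + m' * ((a / d) * Y) = a * (m * X + m' * (Y / d))" for a m m' X Y d :: complex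
      by (simp add: algebra_simps)
    show "(z - ?q) * M z $ 1 $ 1 * (conj_swap (v x) z (f (cnj z)) $ b / z) +
        M z $ 1 $ 2 * (((z - ?q) / cnj (al (cnj z))) * conj_swap (v x) z (g (cnj z)) $ b) = (z - ?q) * quot b z"
      unfolding ring using z by (simp add: quot_def quot_lower_def row_lower_def lower_half_plane_def)
  qed
qed

lemma quot_extension:
  obtains k where "k holomorphic_on - {0}" "\<And>z. z \<noteq> 0 \<Longrightarrow> z \<notin> poles \<Longrightarrow> k z = quot b z"
proof (rule remove_simple_singularities[of poles "- {0}" "quot b"])
  have eq: "- {0} - poles = - ({0} \<union> poles)" by auto
  show "quot b holomorphic_on - {0} - poles" unfolding eq by (rule quot_holomorphic)
  show "poles \<subseteq> - {0}" using zero_not_pole by auto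
  show "((\<lambda>z. (z - p) * quot b z) \<longlongrightarrow> 0) (at p)" if "p \<in> poles" for p
    using that quot_pole_upper quot_pole_lower by auto
qed (use poles_finite that in auto)

end

lemma eventually_not_in_finite:
  fixes Q :: "complex set"
  assumes "finite Q"
  shows "\<forall>\<^sub>F z in at_infinity. z \<notin> Q" and "\<forall>\<^sub>F z in at a. z \<notin> Q"
proof -
  obtain B where B: "\<And>z. z \<in> Q \<Longrightarrow> norm z \<le> B"
    using finite_imp_bounded[OF assms] by (auto simp: bounded_iff)
  show "\<forall>\<^sub>F z in at_infinity. z \<notin> Q"
    unfolding eventually_at_infinity by (rule exI[of _ "B + 1"]) (use B in force)
  have "open (- (Q - {a}))" by (intro open_Compl finite_imp_closed) (use assms in auto)
  then show "\<forall>\<^sub>F z in at a. z \<notin> Q"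
    unfolding eventually_at_topological by (intro exI[of _ "- (Q - {a})"]) auto
qed

lemma lower_infinity_Im: "\<forall>\<^sub>F z in lower_infinity. Im z < 0"
  unfolding lower_infinity_def by (auto simp: eventually_inf_principal lower_half_plane_def)

lemma lower_zero_Im: "\<forall>\<^sub>F z in lower_zero. Im z < 0"
  unfolding lower_zero_def by (auto simp: eventually_at_filter lower_half_plane_def)

lemma swap_tendsto:
  assumes "(w \<longlongrightarrow> c) F"
  shows "((\<lambda>z. swap_lin b (w z)) \<longlongrightarrow> swap_lin b c) F" "((\<lambda>z. swap_const q b (w z)) \<longlongrightarrow> swap_const q b c) F"
  unfolding swap_lin_def swap_const_def using assms by (cases "b = 1"; auto intro!: tendsto_intros)+

context riemann_hilbert
begin

lemma M_infinity:
  "((\<lambda>z. M z $ 1 $ k) \<longlongrightarrow> mat 1 $ 1 $ k) upper_infinity" "((\<lambda>z. M z $ 1 $ k) \<longlongrightarrow> mat 1 $ 1 $ k) lower_infinity"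
proof -
  have "(M \<longlongrightarrow> mat 1) (inf at_infinity (principal (- \<real>)))" using rhp by (simp add: is_RHP_solution_def)
  then have l: "(M \<longlongrightarrow> mat 1) upper_infinity" "(M \<longlongrightarrow> mat 1) lower_infinity"
    unfolding upper_infinity_def lower_infinity_def
    by (auto elim!: tendsto_mono[rotated] intro!: inf_mono simp: upper_half_plane_def lower_half_plane_def complex_is_Real_iff)
  show "((\<lambda>z. M z $ 1 $ k) \<longlongrightarrow> mat 1 $ 1 $ k) upper_infinity" "((\<lambda>z. M z $ 1 $ k) \<longlongrightarrow> mat 1 $ 1 $ k) lower_infinity"
    by (rule tendsto_vec_nth[OF tendsto_vec_nth[OF l(1)]] tendsto_vec_nth[OF tendsto_vec_nth[OF l(2)]])+
qed

lemma M_zero: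
  "((\<lambda>z. M z $ 1 $ k) \<longlongrightarrow> Mp 0 $ 1 $ k) upper_zero" "((\<lambda>z. M z $ 1 $ k) \<longlongrightarrow> Mm 0 $ 1 $ k) lower_zero"
  using tendsto_vec_nth[OF tendsto_vec_nth[OF Mp_lim[of 0]]] tendsto_vec_nth[OF tendsto_vec_nth[OF Mm_lim[of 0]]]
  by (simp_all add: upper_zero_def lower_zero_def)

lemma tendsto_fg:
  assumes F: "\<forall>\<^sub>F z in F. 0 < Im z"
  shows "((\<lambda>z. plus_column u v z 1 x) \<longlongrightarrow> l) F \<Longrightarrow> (f \<longlongrightarrow> l) F"
    and "((\<lambda>z. minus_column u v z 2 x) \<longlongrightarrow> l) F \<Longrightarrow> (g \<longlongrightarrow> l) F"
proof -
  have e: "\<forall>\<^sub>F z in F. plus_column u v z 1 x = f z" "\<forall>\<^sub>F z in F. minus_column u v z 2 x = g z"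
    using F by (eventually_elim, subst n1_plus_eq n2_minus_eq, auto simp: closed_upper_iff)+
  show "((\<lambda>z. plus_column u v z 1 x) \<longlongrightarrow> l) F \<Longrightarrow> (f \<longlongrightarrow> l) F"
    by (rule Lim_transform_eventually[OF _ e(1)])
  show "((\<lambda>z. minus_column u v z 2 x) \<longlongrightarrow> l) F \<Longrightarrow> (g \<longlongrightarrow> l) F"
    by (rule Lim_transform_eventually[OF _ e(2)])
qed

lemma tendsto_al:
  fixes a b :: "complex^2"
  assumes F: "\<forall>\<^sub>F z in F. 0 < Im z" and f: "(f \<longlongrightarrow> a) F" and g: "(g \<longlongrightarrow> b) F"
  shows "(al \<longlongrightarrow> a $ 1 * b $ 2 - b $ 1 * a $ 2) F"
proof (rule Lim_transform_eventually)
  show "((\<lambda>z. f z $ 1 * g z $ 2 - g z $ 1 * f z $ 2) \<longlongrightarrow> a $ 1 * b $ 2 - b $ 1 * a $ 2) F"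
    by (intro tendsto_intros f g)
  show "\<forall>\<^sub>F z in F. f z $ 1 * g z $ 2 - g z $ 1 * f z $ 2 = al z"
    using F by eventually_elim (subst al_det, auto simp: closed_upper_iff)
qed

lemma quot_upper_tendsto:
  fixes a gl :: "complex^2"
  assumes F: "\<forall>\<^sub>F z in F. 0 < Im z" and f: "(f \<longlongrightarrow> a) F" and g: "(g \<longlongrightarrow> gl) F" and al: "(al \<longlongrightarrow> d) F" "d \<noteq> 0"
    and M: "((\<lambda>z. M z $ 1 $ 1) \<longlongrightarrow> m1) F" "((\<lambda>z. M z $ 1 $ 2) \<longlongrightarrow> m2) F"
  shows "(quot b \<longlongrightarrow> m1 * (gl $ b / d) - m2 * a $ b) F"
proof (rule Lim_transform_eventually)
  show "((\<lambda>z. M z $ 1 $ 1 * (g z $ b / al z) - M z $ 1 $ 2 * f z $ b) \<longlongrightarrow> m1 * (gl $ b / d) - m2 * a $ b) F"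
    by (intro tendsto_intros assms)
  show "\<forall>\<^sub>F z in F. M z $ 1 $ 1 * (g z $ b / al z) - M z $ 1 $ 2 * f z $ b = quot b z"
    using F by eventually_elim (simp add: quot_def quot_upper_def row_upper_def)
qed

lemma quot_lower_alt:
  "Im z < 0 \<Longrightarrow> quot b z = M z $ 1 $ 1 * ((z * swap_lin b (f (cnj z)) + swap_const (v x) b (f (cnj z))) / z)
     + M z $ 1 $ 2 * ((z * swap_lin b (g (cnj z)) + swap_const (v x) b (g (cnj z))) / cnj (al (cnj z)))"
  by (simp add: quot_def quot_lower_def row_lower_def conj_swap_split)

text \<open>The images under the symmetry grow linearly at infinity, which is the growth that
\<open>constant_by_half_plane_limits\<close> permits.\<close>

lemma quot_lower_infinity:
  assumes f: "(f \<longlongrightarrow> a) upper_infinity" and g: "(g \<longlongrightarrow> gl) upper_infinity" and al: "(al \<longlongrightarrow> d) upper_infinity" "d \<noteq> 0"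
  obtains e where "((\<lambda>z. quot b z / z) \<longlongrightarrow> e) lower_infinity"
proof -
  note cc = filterlim_cnj_upper_infinity
  have fg: "((\<lambda>z. f (cnj z)) \<longlongrightarrow> a) lower_infinity" "((\<lambda>z. g (cnj z)) \<longlongrightarrow> gl) lower_infinity"
    by (rule filterlim_compose[OF f cc] filterlim_compose[OF g cc])+
  have A: "((\<lambda>z. cnj (al (cnj z))) \<longlongrightarrow> cnj d) lower_infinity"
    by (intro tendsto_cnj filterlim_compose[OF al(1) cc])
  have inv: "(inverse \<longlongrightarrow> (0::complex)) lower_infinity"
    unfolding lower_infinity_def by (rule tendsto_mono[OF inf_le1 tendsto_inverse_0])
  let ?h = "\<lambda>z. M z $ 1 $ 1 * (swap_lin b (f (cnj z)) * inverse z + swap_const (v x) b (f (cnj z)) * inverse z * inverse z)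
     + M z $ 1 $ 2 * ((swap_lin b (g (cnj z)) + swap_const (v x) b (g (cnj z)) * inverse z) / cnj (al (cnj z)))"
  define e where "e = (mat 1 :: complex^2^2) $ 1 $ 1 * (swap_lin b a * 0 + swap_const (v x) b a * 0 * 0)
     + (mat 1 :: complex^2^2) $ 1 $ 2 * ((swap_lin b gl + swap_const (v x) b gl * 0) / cnj d)"
  have "(?h \<longlongrightarrow> e) lower_infinity"
    unfolding e_def
    by (intro tendsto_add tendsto_mult tendsto_divide M_infinity(2) swap_tendsto[OF fg(1)] swap_tendsto[OF fg(2)] inv A)
       (use al in simp)
  then have "((\<lambda>z. quot b z / z) \<longlongrightarrow> e) lower_infinity"
  proof (rule Lim_transform_eventually)
    have ring: "m * (p * inverse z + r * inverse z * inverse z) + m' * ((p' + r' * inverse z) / s)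
        = (m * ((z * p + r) / z) + m' * ((z * p' + r') / s)) / z" if "z \<noteq> 0" for z m m' p r p' r' s :: complex
      using that by (simp add: divide_inverse algebra_simps)
    show "\<forall>\<^sub>F z in lower_infinity. ?h z = quot b z / z"
      using lower_infinity_Im
    proof eventually_elim
      case (elim z)
      then have "z \<noteq> 0" by auto
      then show ?case unfolding quot_lower_alt[OF elim] by (rule ring)
    qed
  qed
  then show ?thesis by (rule that)
qed

lemma quot_lower_zero:
  assumes f: "(f \<longlongrightarrow> a) upper_zero" and g: "(g \<longlongrightarrow> gl) upper_zero" and al: "(al \<longlongrightarrow> d) upper_zero" "d \<noteq> 0"
  obtains e where "((\<lambda>z. z * quot b z) \<longlongrightarrow> e) lower_zero"
proof -
  note cc = filterlim_cnj_upper_zero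
  have fg: "((\<lambda>z. f (cnj z)) \<longlongrightarrow> a) lower_zero" "((\<lambda>z. g (cnj z)) \<longlongrightarrow> gl) lower_zero"
    by (rule filterlim_compose[OF f cc] filterlim_compose[OF g cc])+
  have A: "((\<lambda>z. cnj (al (cnj z))) \<longlongrightarrow> cnj d) lower_zero"
    by (intro tendsto_cnj filterlim_compose[OF al(1) cc])
  have id: "((\<lambda>z. z) \<longlongrightarrow> 0) lower_zero" unfolding lower_zero_def by (rule tendsto_ident_at)
  let ?h = "\<lambda>z. M z $ 1 $ 1 * (z * swap_lin b (f (cnj z)) + swap_const (v x) b (f (cnj z)))
     + z * (M z $ 1 $ 2 * ((z * swap_lin b (g (cnj z)) + swap_const (v x) b (g (cnj z))) / cnj (al (cnj z))))"
  define e where "e = Mm 0 $ 1 $ 1 * (0 * swap_lin b a + swap_const (v x) b a)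
     + 0 * (Mm 0 $ 1 $ 2 * ((0 * swap_lin b gl + swap_const (v x) b gl) / cnj d))"
  have "(?h \<longlongrightarrow> e) lower_zero"
    unfolding e_def
    by (intro tendsto_add tendsto_mult tendsto_divide M_zero(2) swap_tendsto[OF fg(1)] swap_tendsto[OF fg(2)] id A)
       (use al in simp)
  then have "((\<lambda>z. z * quot b z) \<longlongrightarrow> e) lower_zero"
  proof (rule Lim_transform_eventually)
    have ring: "m * q + z * r = z * (m * (q / z) + r)" if "z \<noteq> 0" for z m q r :: complex
      using that by (simp add: algebra_simps)
    show "\<forall>\<^sub>F z in lower_zero. ?h z = z * quot b z"
      using lower_zero_Im
    proof eventually_elim
      case (elim z)
      then have "z \<noteq> 0" by auto
      then show ?case unfolding quot_lower_alt[OF elim] by (rule ring)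
    qed
  qed
  then show ?thesis by (rule that)
qed

lemma quot_constant:
  assumes "(quot b \<longlongrightarrow> l) upper_infinity" "(quot b \<longlongrightarrow> l0) upper_zero"
    "((\<lambda>z. quot b z / z) \<longlongrightarrow> d) lower_infinity" "((\<lambda>z. z * quot b z) \<longlongrightarrow> e) lower_zero"
    and z: "z \<noteq> 0" "z \<notin> poles"
  shows "quot b z = l"
proof -
  obtain k where k: "k holomorphic_on - {0}" "\<And>z. z \<noteq> 0 \<Longrightarrow> z \<notin> poles \<Longrightarrow> k z = quot b z"
    using quot_extension[of b] by blast
  have ev: "\<forall>\<^sub>F z in F. quot b z = k z" if "\<forall>\<^sub>F z in F. z \<noteq> 0" "\<forall>\<^sub>F z in F. z \<notin> poles" for F
    using that by eventually_elim (simp add: k(2))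
  have np: "\<forall>\<^sub>F z in inf at_infinity (principal H). z \<notin> poles" "\<forall>\<^sub>F z in at 0 within H. z \<notin> poles" for H
    using filter_leD[OF inf_le1 eventually_not_in_finite(1)[OF poles_finite]]
      filter_leD[OF at_le[OF subset_UNIV] eventually_not_in_finite(2)[OF poles_finite]] by auto
  have nz: "\<forall>\<^sub>F z in F. z \<noteq> 0" if "(\<forall>\<^sub>F z in F. 0 < Im z) \<or> (\<forall>\<^sub>F z in F. Im z < 0)" for F
    using that by (auto elim: eventually_mono)
  note evs = ev[OF nz[OF disjI1[OF upper_infinity_Im]] np(1)[of upper_half_plane, folded upper_infinity_def]]
    ev[OF nz[OF disjI2[OF lower_infinity_Im]] np(1)[of lower_half_plane, folded lower_infinity_def]]
    ev[OF nz[OF disjI1[OF upper_zero_Im]] np(2)[of upper_half_plane, folded upper_zero_def]]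
    ev[OF nz[OF disjI2[OF lower_zero_Im]] np(2)[of lower_half_plane, folded lower_zero_def]]
  have "k z = l"
  proof (rule constant_by_half_plane_limits[OF k(1)])
    have id: "((\<lambda>z. z) \<longlongrightarrow> 0) upper_zero" unfolding upper_zero_def by (rule tendsto_ident_at)
    have "((\<lambda>z. z * quot b z) \<longlongrightarrow> 0) upper_zero" using tendsto_mult[OF id assms(2)] by simp
    then show "((\<lambda>z. z * k z) \<longlongrightarrow> 0) upper_zero"
      by (rule Lim_transform_eventually) (use evs(3) in eventually_elim, simp)
    show "((\<lambda>z. z * k z) \<longlongrightarrow> e) lower_zero"
      by (rule Lim_transform_eventually[OF assms(4)]) (use evs(4) in eventually_elim, simp)
    show "(k \<longlongrightarrow> l) upper_infinity"
      by (rule Lim_transform_eventually[OF assms(1) evs(1)])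
    show "((\<lambda>z. k z / z) \<longlongrightarrow> d) lower_infinity"
      by (rule Lim_transform_eventually[OF assms(3)]) (use evs(2) in eventually_elim, simp)
  qed (rule z)
  then show ?thesis using k(2)[OF z] by simp
qed

text \<open>The constant row is evaluated at infinity and then solved for the second entry of the row of \<open>M\<close>, whose limit at
zero is read off from the limits of \<open>g\<close> and \<open>\<alpha>\<close>.\<close>

lemma M12_upper_zero: "((\<lambda>z. M z $ 1 $ 2) \<longlongrightarrow> cnj (u x)) upper_zero"
proof -
  define E where "E = exp (- tail (\<lambda>y. Q1 u v y $ 1 $ 1) x)"
  have E0: "E \<noteq> 0" by (simp add: E_def)
  have E1: "exp (tail (\<lambda>y. Q1 u v y $ 1 $ 1) x) = 1 / E" by (simp add: E_def exp_minus field_simps)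
  obtain e where e: "e \<noteq> 0" "((\<lambda>z. minus_column u v z 2 x) \<longlongrightarrow> axis 2 e) upper_infinity"
    using minus_column_at_infinity[of x] by blast
  obtain e' where e': "e' \<noteq> 0" "((\<lambda>z. minus_column u v z 2 x) \<longlongrightarrow> gauge x *v axis 2 e') upper_zero"
    using minus_column_at_zero[of x] by blast
  have fi: "(f \<longlongrightarrow> axis 1 E) upper_infinity"
    by (rule tendsto_fg(1)[OF upper_infinity_Im]) (use plus_column_at_infinity[of x] in \<open>simp add: E_def\<close>)
  have gi: "(g \<longlongrightarrow> axis 2 e) upper_infinity"
    by (rule tendsto_fg(2)[OF upper_infinity_Im e(2)])
  have ai: "(al \<longlongrightarrow> E * e) upper_infinity"
    using tendsto_al[OF upper_infinity_Im fi gi] by (simp add: axis_def)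
  have fz: "(f \<longlongrightarrow> gauge x *v axis 1 (1 / E)) upper_zero"
    by (rule tendsto_fg(1)[OF upper_zero_Im]) (use plus_column_at_zero[of x] in \<open>simp add: E1\<close>)
  have gz: "(g \<longlongrightarrow> gauge x *v axis 2 e') upper_zero"
    by (rule tendsto_fg(2)[OF upper_zero_Im e'(2)])
  have entries: "(gauge x *v axis 1 (1 / E)) $ 1 = 1 / E" "(gauge x *v axis 1 (1 / E)) $ 2 = v x / E"
    "(gauge x *v axis 2 e') $ 1 = cnj (u x) * e'" "(gauge x *v axis 2 e') $ 2 = (1 + cnj (u x) * v x) * e'"
    by (simp_all add: matrix_vector_mult_entry2 gauge_def axis_def)
  have az: "(al \<longlongrightarrow> e' / E) upper_zero"
  proof -
    have "(gauge x *v axis 1 (1 / E)) $ 1 * (gauge x *v axis 2 e') $ 2 - (gauge x *v axis 2 e') $ 1 * (gauge x *v axis 1 (1 / E)) $ 2 = e' / E"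
      unfolding entries using E0 by (simp add: field_simps)
    then show ?thesis using tendsto_al[OF upper_zero_Im fz gz] by simp
  qed
  have n0: "E * e \<noteq> 0" "e' / E \<noteq> 0" using E0 e(1) e'(1) by auto
  have Kc: "quot b z = axis 2 e $ b / (E * e)" if "z \<noteq> 0" "z \<notin> poles" for b z
  proof -
    have "(quot b \<longlongrightarrow> (mat 1 :: complex^2^2) $ 1 $ 1 * (axis 2 e $ b / (E * e)) - (mat 1 :: complex^2^2) $ 1 $ 2 * axis 1 E $ b) upper_infinity"
      by (rule quot_upper_tendsto[OF upper_infinity_Im fi gi ai n0(1) M_infinity(1) M_infinity(1)])
    then have 1: "(quot b \<longlongrightarrow> axis 2 e $ b / (E * e)) upper_infinity" by (simp add: mat_def)
    have 2: "(quot b \<longlongrightarrow> Mp 0 $ 1 $ 1 * ((gauge x *v axis 2 e') $ b / (e' / E)) - Mp 0 $ 1 $ 2 * (gauge x *v axis 1 (1 / E)) $ b) upper_zero"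
      by (rule quot_upper_tendsto[OF upper_zero_Im fz gz az n0(2) M_zero(1) M_zero(1)])
    obtain d where 3: "((\<lambda>z. quot b z / z) \<longlongrightarrow> d) lower_infinity"
      using quot_lower_infinity[OF fi gi ai n0(1)] by blast
    obtain d' where 4: "((\<lambda>z. z * quot b z) \<longlongrightarrow> d') lower_zero"
      using quot_lower_zero[OF fz gz az n0(2)] by blast
    show ?thesis by (rule quot_constant[OF 1 2 3 4 that])
  qed
  have M12: "M z $ 1 $ 2 = g z $ 1 / (E * al z)" if z: "0 < Im z" "z \<notin> P" for z
  proof -
    have zc: "z \<in> closed_upper" and z0: "z \<noteq> 0" and zp: "z \<notin> poles"
      using z not_pole_upper[OF z(1)] by (auto simp: closed_upper_iff)
    have a: "al z \<noteq> 0" by (rule al_nonzero[OF zc z(2)])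
    have quot_value: "M z $ 1 $ 1 * (g z $ b / al z) - M z $ 1 $ 2 * f z $ b = axis 2 e $ b / (E * e)" for b
      using Kc[OF z0 zp, of b] z by (simp add: quot_def quot_upper_def row_upper_def)
    have K1: "M z $ 1 $ 1 * (g z $ 1 / al z) - M z $ 1 $ 2 * f z $ 1 = 0"
      unfolding quot_value by (simp add: axis_def)
    have K2: "M z $ 1 $ 1 * (g z $ 2 / al z) - M z $ 1 $ 2 * f z $ 2 = 1 / E"
      unfolding quot_value using e(1) by (simp add: axis_def)
    have solve: "m2 * (f1 * g2 - g1 * f2) = g1 * k"
      if "m1 * (g1 / d) - m2 * f1 = 0" "m1 * (g2 / d) - m2 * f2 = k" for m1 m2 f1 f2 g1 g2 d k :: complex
      using arg_cong[OF that(2), of "\<lambda>t. g1 * t"] arg_cong[OF that(1), of "\<lambda>t. g2 * t"] by (simp add: algebra_simps)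
    have "M z $ 1 $ 2 * al z = g z $ 1 * (1 / E)"
      unfolding al_det[OF zc] by (rule solve[OF K1 K2])
    then show ?thesis using a E0 by (simp add: field_simps)
  qed
  have "((\<lambda>z. g z $ 1 / (E * al z)) \<longlongrightarrow> cnj (u x) * e' / (E * (e' / E))) upper_zero"
    unfolding entries(3)[symmetric]
    by (intro tendsto_divide tendsto_mult tendsto_const az tendsto_vec_nth[OF gz]) (use n0 E0 in simp)
  moreover have "cnj (u x) * e' / (E * (e' / E)) = cnj (u x)" using E0 e'(1) by simp
  ultimately have "((\<lambda>z. g z $ 1 / (E * al z)) \<longlongrightarrow> cnj (u x)) upper_zero" by simp
  then show ?thesis
  proof (rule Lim_transform_eventually)
    have "\<forall>\<^sub>F z in upper_zero. z \<notin> P"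
      unfolding upper_zero_def by (rule filter_leD[OF at_le[OF subset_UNIV] eventually_not_in_finite(2)[OF P_finite]])
    with upper_zero_Im show "\<forall>\<^sub>F z in upper_zero. g z $ 1 / (E * al z) = M z $ 1 $ 2"
      by eventually_elim (simp add: M12)
  qed
qed

text \<open>A consequence of continuity and of the vanishing of \<open>r(s) / s\<close> at zero. It makes the jump
matrix the identity at \<open>0\<close>.\<close>

lemma refl_coeff_0: "refl_coeff u v 0 = 0"
proof -
  let ?r = "refl_coeff u v"
  obtain r1 where "has_ac_derivative ?r r1" using refl by (auto simp: H11_0_def H11_def)
  from has_ac_derivative_continuous[OF this] have "isCont ?r 0" by (simp add: continuous_on_eq_continuous_at)
  then have c: "(?r \<longlongrightarrow> ?r 0) (at 0)" by (simp add: isCont_def)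
  have l: "((\<lambda>s. ?r s / of_real s) \<longlongrightarrow> 0) (at 0)" using refl by (simp add: H11_0_def)
  have "((\<lambda>s::real. ?r s / of_real s * of_real s) \<longlongrightarrow> 0 * of_real 0) (at 0)"
    by (intro tendsto_mult l tendsto_of_real tendsto_ident_at)
  then have "((\<lambda>s::real. ?r s / of_real s * of_real s) \<longlongrightarrow> 0) (at 0)" by simp
  then have "(?r \<longlongrightarrow> 0) (at 0)"
    by (rule Lim_transform_eventually) (auto simp: eventually_at_filter)
  with c show ?thesis by (metis LIM_unique)
qed

lemma M12_punctured: "((\<lambda>z. M z $ 1 $ 2) \<longlongrightarrow> cnj (u x)) (at 0 within {z. Im z \<noteq> 0})"
proof -
  have "Mp 0 $ 1 $ 2 = cnj (u x)"
    by (rule tendsto_unique[OF upper_zero_nontrivial M_zero(1) M12_upper_zero])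
  moreover have "Mp 0 $ 1 $ 2 = Mm 0 $ 1 $ 2"
    using Mp_jump[of 0] by (simp add: matrix_matrix_mult_entry2 jump_matrix_def refl_coeff_0)
  ultimately have "((\<lambda>z. M z $ 1 $ 2) \<longlongrightarrow> cnj (u x)) lower_zero" using M_zero(2)[of 2] by simp
  from Lim_Un[OF M12_upper_zero[unfolded upper_zero_def] this[unfolded lower_zero_def]]
  show ?thesis
  proof (rule tendsto_within_subset)
    show "{z. Im z \<noteq> 0} \<subseteq> upper_half_plane \<union> lower_half_plane"
      by (auto simp: upper_half_plane_def lower_half_plane_def)
  qed
qed

end

theorem proposition2p24:
  fixes u v :: "real \<Rightarrow> complex"
    and N1 :: nat and lam c :: "nat \<Rightarrow> complex"
    and x :: real and M :: "complex \<Rightarrow> complex^2^2"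
  assumes "u \<in> I_space" and "v \<in> I_space"
    and "generic u v"
    and "refl_coeff u v \<in> H11_0"
    and "bij_betw lam {1..N1} (eigenvalues u v)"
    and "\<And>j. j \<in> {1..N1} \<Longrightarrow> is_norming_constant u v (lam j) (c j)"
    and "is_RHP_solution x (refl_coeff u v) N1 lam c M"
  shows "\<forall>\<delta>>0. ((\<lambda>z. M z $ 1 $ 2) \<longlongrightarrow> cnj (u x))
                  (at 0 within {z. \<bar>Im z\<bar> \<ge> \<delta> * \<bar>Re z\<bar>})"
proof (intro allI impI)
  fix \<delta> :: real assume \<delta>: "0 < \<delta>"
  obtain u' where u': "decaying_C1 u u'" by (rule I_space_decaying_C1[OF assms(1)])
  obtain v' where v': "decaying_C1 v v'" by (rule I_space_decaying_C1[OF assms(2)])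
  interpret riemann_hilbert u v u' v' N1 lam c x M
    by unfold_locales (use u' v' assms in auto)
  have "Im z \<noteq> 0" if "\<bar>Im z\<bar> \<ge> \<delta> * \<bar>Re z\<bar>" "z \<noteq> 0" for z
    using that \<delta> by (auto simp: complex_eq_iff mult_le_0_iff)
  then have "at 0 within {z. \<bar>Im z\<bar> \<ge> \<delta> * \<bar>Re z\<bar>} \<le> at 0 within {z. Im z \<noteq> 0}"
    unfolding at_within_def by (intro inf_mono) auto
  then show "((\<lambda>z. M z $ 1 $ 2) \<longlongrightarrow> cnj (u x)) (at 0 within {z. \<bar>Im z\<bar> \<ge> \<delta> * \<bar>Re z\<bar>})"
    by (rule tendsto_mono[OF _ M12_punctured])
qed

end
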